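(* Let $f\in\mathcal G$ with $r>0$ and let $\beta>0$ be a local minimum point for $f$ on the positive half line. Let $f^{-1}$ be the inverse of $f|_{(\beta,\infty)}$, defined on $(f(\beta),\infty)$ and extended to a Pick-function in $\mathbb C\setminus(-\infty,f(\beta)]$. Then there exist a constant $c\ge0$ and a function $d$, positive and real analytic on $(0,f(\beta))\cup(f(\beta),\infty)$ and satisfying $\int_0^\infty\frac{d(t)}{t+1}\,dt<\infty$, such that for all $w\in\mathbb C\setminus(-\infty,f(\beta)]$, $$f^{-1}(w)=\beta+(w-f(\beta))\int_0^\infty\frac{d(t)}{t+w-f(\beta)}\,dt-\frac cw.$$
   Context: A Pick-function is a holomorphic function $p$ in the open upper half plane $\mathbb C_+$ with $\Im p(z)\ge0$ for all $z\in\mathbb C_+$; a Pick-function in a cut plane $\mathbb C\setminus(-\infty,c]$ is a holomorphic function there whose restriction to $\mathbb C_+$ is a Pick-function. Consider entire functions $f$ of the form $$f(z)=z^re^{az^2+bz}\prod_{k=1}^\infty\left(1+\frac z{\lambda_k}\right)e^{-z/\lambda_k+z^2/(2\lambda_k^2)},\qquad( * )$$ where $r$ is a non-negative integer, $a,b\in\mathbb R$, $0<\lambda_1\le\lambda_2\le\cdots$, $\sum_k\lambda_k^{-2}=\infty$ and $\sum_k\lambda_k^{-3}<\infty$. A function $f$ of the form $( * )$ is said to belong to the class $\mathcal G$ if it decreases on some open interval of the positive real line. If $f\in\mathcal G$ and $r>0$, there is a bounded interval $(\alpha,\beta)$ with $0<\alpha<\beta$ such that $f$ decreases on $(\alpha,\beta)$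 and increases on $(0,\alpha)$ and on $(\beta,\infty)$. The inverse of $f|_{(\beta,\infty)}$ extends (uniquely) to a Pick-function in $\mathbb C\setminus(-\infty,f(\beta)]$. *)

theory Defs
  imports "HOL-Complex_Analysis.Complex_Analysis"
begin

definition pick_function :: "(complex \<Rightarrow> complex) \<Rightarrow> bool" where
  "pick_function p \<longleftrightarrow>
     p holomorphic_on {z. Im z > 0} \<and> (\<forall>z. Im z > 0 \<longrightarrow> Im (p z) \<ge> 0)"

definition cut_plane :: "real \<Rightarrow> complex set" where
  "cut_plane c = - (complex_of_real ` {..c})"

definition pick_function_in_cut_plane :: "real \<Rightarrow> (complex \<Rightarrow> complex) \<Rightarrow> bool" where
  "pick_function_in_cut_plane c p \<longleftrightarrow> p holomorphic_on cut_plane c \<and> pick_function p"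

text \<open>
  The zeros are indexed from 0 instead of 1. The infinite product is that of
  \<^theory>\<open>HOL-Analysis.Infinite_Products\<close>: its value is 0 when some factor vanishes,
  provided that only finitely many do and that the product of the others converges.
\<close>

definition genus2_form ::
    "nat \<Rightarrow> real \<Rightarrow> real \<Rightarrow> (nat \<Rightarrow> real) \<Rightarrow> (complex \<Rightarrow> complex) \<Rightarrow> bool" where
  "genus2_form r a b lam f \<longleftrightarrow>
     (\<forall>k. 0 < lam k) \<and> incseq lam \<and>
     \<not> summable (\<lambda>k. 1 / lam k ^ 2) \<and> summable (\<lambda>k. 1 / lam k ^ 3) \<and>
     (\<forall>z. f z = z ^ r * exp (of_real a * z ^ 2 + of_real b * z) *
        (\<Prod>k. (1 + z / of_real (lam k)) *
               exp (- z / of_real (lam k) + z ^ 2 / (2 * of_real (lam k) ^ 2))))"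

text \<open>
  Functions of the above form are real on the real axis, so nothing is lost by taking
  the real part.
\<close>

definition on_reals :: "(complex \<Rightarrow> complex) \<Rightarrow> real \<Rightarrow> real" where
  "on_reals f x = Re (f (of_real x))"

definition class_G :: "(complex \<Rightarrow> complex) set" where
  "class_G = {f. (\<exists>r a b lam. genus2_form r a b lam f) \<and>
     (\<exists>p q. 0 \<le> p \<and> p < q \<and> strict_antimono_on {p<..<q} (on_reals f))}"

definition local_min_on :: "real set \<Rightarrow> (real \<Rightarrow> real) \<Rightarrow> real \<Rightarrow> bool" where
  "local_min_on S h x \<longleftrightarrow> x \<in> S \<and> (\<forall>\<^sub>F y in at x within S. h x \<le> h y)"

definition real_analytic_on :: "(real \<Rightarrow> real) \<Rightarrow> real set \<Rightarrow> bool" where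
  "real_analytic_on h S \<longleftrightarrow>
     (\<forall>x\<in>S. \<exists>\<epsilon>>0. \<exists>c :: nat \<Rightarrow> real.
        \<forall>y. \<bar>y - x\<bar> < \<epsilon> \<longrightarrow> (\<lambda>n. c n * (y - x) ^ n) sums h y)"

end

theory Submission
  imports Defs
begin

text \<open>
  Write \<open>p\<close> for the extended inverse, \<open>h = f'/f\<close> and \<open>L = log f\<close> on the plane slit along the
  negative axis. The function \<open>h\<close> has exactly two positive zeros \<open>\<alpha> < \<beta>\<close>, and the second
  divided difference of \<open>z h(z)\<close> at \<open>\<alpha>\<close>, \<open>\<beta>\<close> is a Pick function \<open>P\<close>, so
  \<open>z h(z) = (z - \<alpha>) (z - \<beta>) P(z)\<close> with \<open>Im P > 0\<close> in the upper half plane; in particular \<open>f'\<close> has no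
  zero there. The identity theorem gives \<open>f (p w) = w\<close>, hence \<open>L (p w) = Ln w\<close> and
  \<open>w p'(w) = 1 / h (p w)\<close>.

  The set of limits of \<open>p\<close> at a real point \<open>x\<close> is connected and contained in the discrete set of
  solutions of \<open>f z = x\<close> together with \<open>\<infinity>\<close>, so \<open>p\<close> has a limit at \<open>x\<close>. Let
  \<open>\<Phi>'(z) = (z - \<alpha>) (z - \<beta>) / z\<close>. Since \<open>w (\<Phi> \<circ> p)'(w) = 1 / P (p w)\<close>, the function \<open>Im (\<Phi> \<circ> p)\<close>
  decreases strictly along rays from the origin. This monotonicity, combined with
  \<open>0 < Im (L (p w)) < \<pi>\<close> and with the fact that \<open>Im L\<close> is at least \<open>r \<pi>\<close> near the negative axis,
  excludes real and infinite limits at every \<open>x < f \<beta>\<close>, \<open>x \<noteq> 0\<close>. So \<open>p\<close> continues analytically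
  across these points with positive imaginary part.

  The Herglotz representation of \<open>p\<close> therefore has a real analytic density on
  \<open>(-\<infinity>, f \<beta>) - {0}\<close> and at most one point mass, at \<open>0\<close>. The linear term vanishes since
  \<open>p y / y \<rightarrow> 0\<close>; a point mass would make \<open>|p (\<i> \<epsilon>)|\<close> comparable to \<open>1 / \<epsilon>\<close>, whereas \<open>|p'(w)| \<le> 1 / |w|\<close>
  as soon as \<open>|h (p w)| \<ge> 1\<close>, which only allows logarithmic growth. Hence the constant \<open>c\<close> is \<open>0\<close>.
\<close>


lemma norm_Ln_taylor2_le:
  fixes z :: complex
  assumes "norm z \<le> 1/2"
  shows "norm (Ln (1 + z) - z + z^2/2) \<le> 2 * norm z ^ 3"
proof -
  define S where "S = cball (0::complex) (norm z)"
  have der: "((\<lambda>z. Ln (1 + z) - z + z^2/2) has_field_derivative u^2 / (1 + u)) (at u within S)"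
    if "u \<in> S" for u
  proof -
    have nu: "norm u \<le> 1/2" using that assms by (auto simp: S_def)
    then have re: "Re (1 + u) > 0"
      using abs_Re_le_cmod[of u] by auto
    then have "1 + u \<notin> \<real>\<^sub>\<le>\<^sub>0" "1 + u \<noteq> 0"
      by (auto simp: complex_nonpos_Reals_iff complex_eq_iff)
    moreover have "1 / (1 + u) - 1 + u = u^2 / (1 + u)"
      using \<open>1 + u \<noteq> 0\<close> by (simp add: divide_simps) (simp add: algebra_simps power2_eq_square)
    moreover have "((\<lambda>z. Ln (1 + z) - z + z^2/2) has_field_derivative 1 / (1 + u) - 1 + u) (at u within S)"
      using \<open>1 + u \<notin> \<real>\<^sub>\<le>\<^sub>0\<close> by (auto intro!: derivative_eq_intros simp: inverse_eq_divide)
    ultimately show ?thesis by simp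
  qed
  have "norm ((Ln (1 + z) - z + z^2/2) - (Ln (1 + 0) - 0 + 0^2/2)) \<le> (2 * norm z ^ 2) * norm (z - 0)"
  proof (rule field_differentiable_bound[of S])
    fix u assume u: "u \<in> S"
    then have nu: "norm u \<le> norm z" by (simp add: S_def)
    have "1 \<le> norm (1 + u) + norm u"
      using norm_triangle_ineq4[of "1 + u" u] by simp
    then have "norm (1 + u) \<ge> 1/2" using nu assms by linarith
    then have "norm (u^2 / (1 + u)) \<le> norm u ^ 2 / (1/2)"
      unfolding norm_divide norm_power by (intro frac_le) auto
    also have "\<dots> \<le> 2 * norm z ^ 2" using power_mono[OF nu, of 2] by simp
    finally show "norm (u^2 / (1 + u)) \<le> 2 * norm z ^ 2" .
  qed (use der in \<open>auto simp: S_def\<close>)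
  then show ?thesis by (simp add: power3_eq_cube power2_eq_square)
qed

locale genus2 =
  fixes r :: nat and a b :: real and lam :: "nat \<Rightarrow> real" and f :: "complex \<Rightarrow> complex"
  assumes form: "genus2_form r a b lam f" and r_pos: "r > 0"
begin

lemma lam_pos [simp, intro]: "lam k > 0" "lam k \<ge> 0" "lam k \<noteq> 0"
  using form by (auto simp: genus2_form_def less_imp_le less_imp_neq[THEN not_sym])

lemma lam_mono: "i \<le> j \<Longrightarrow> lam i \<le> lam j"
  using form by (auto simp: genus2_form_def incseq_def)

lemma summable_lam3: "summable (\<lambda>k. 1 / lam k ^ 3)"
  using form by (auto simp: genus2_form_def)

lemma lam_at_top: "filterlim lam at_top sequentially"
proof -
  have "(\<lambda>k. 1 / lam k ^ 3) \<longlonglongrightarrow> 0"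
    using summable_lam3 by (rule summable_LIMSEQ_zero)
  then have "filterlim (\<lambda>k. inverse (1 / lam k ^ 3)) at_top sequentially"
    by (intro filterlim_inverse_at_top) auto
  then have 1: "filterlim (\<lambda>k. lam k ^ 3) at_top sequentially" by simp
  show ?thesis
    unfolding filterlim_at_top_gt[of _ _ 0]
  proof (intro allI impI)
    fix Z :: real assume "Z > 0"
    have "\<forall>\<^sub>F k in sequentially. Z ^ 3 \<le> lam k ^ 3"
      using 1 by (simp add: filterlim_at_top)
    then show "\<forall>\<^sub>F k in sequentially. Z \<le> lam k"
      by eventually_elim (use power_mono_iff lam_pos(2) \<open>Z > 0\<close> in \<open>metis less_imp_le zero_less_numeral\<close>)
  qed
qed

lemma sum_lam2_unbounded: "\<exists>K. (\<Sum>k<K. 1 / lam k ^ 2) \<ge> C"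
proof (rule ccontr)
  assume *: "\<not> ?thesis"
  have "summable (\<lambda>k. 1 / lam k ^ 2)"
    by (rule summableI_nonneg_bounded[of _ C]) (use * in \<open>auto simp: not_le intro: less_imp_le\<close>)
  then show False using form by (simp add: genus2_form_def)
qed

definition W :: "complex \<Rightarrow> complex" where
  "W z = (\<Prod>k. (1 + z / of_real (lam k)) *
       exp (- z / of_real (lam k) + z ^ 2 / (2 * of_real (lam k) ^ 2)))"

lemma weierstrass_factor_2:
  "weierstrass_factor 2 (z / - of_real (lam k)) = (1 + z / of_real (lam k)) *
       exp (- z / of_real (lam k) + z ^ 2 / (2 * of_real (lam k) ^ 2))"
proof -
  have "{1..2} = {1, 2::nat}" by auto
  then show ?thesis by (simp add: weierstrass_factor_def power_divide mult_ac)
qed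

sublocale wp: weierstrass_product "\<lambda>k. - of_real (lam k)" "\<lambda>_. 2"
proof
  show "filterlim (\<lambda>k. - complex_of_real (lam k)) at_infinity sequentially"
    using lam_at_top by (simp add: filterlim_at_infinity_conv_norm_at_top)
  fix R :: real assume "R > 0"
  show "summable (\<lambda>n. (R / norm (- complex_of_real (lam n))) ^ Suc 2)"
    using summable_mult[OF summable_lam3, of "R^3"]
    by (simp add: power_divide numeral_3_eq_3)
qed auto

lemma f_eq: "f z = z ^ r * exp (of_real a * z ^ 2 + of_real b * z) * W z"
  using form by (simp add: genus2_form_def W_def)

lemma W_eq: "W z = wp.f z"
  unfolding W_def wp.f_def weierstrass_factor_2 ..


lemma W_nonzero_iff: "W z \<noteq> 0 \<longleftrightarrow> (\<forall>k. z \<noteq> - of_real (lam k))"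
  unfolding W_eq wp.zero by auto

lemma W_0 [simp]: "W 0 = 1"
  by (simp add: W_def)

lemma holomorphic_W: "W holomorphic_on A"
  using wp.holomorphic[of A] by (simp add: W_eq[abs_def])

lemma holomorphic_f: "f holomorphic_on A"
  unfolding f_eq[abs_def] by (intro holomorphic_intros holomorphic_W)

lemma continuous_on_f: "continuous_on A f"
  using holomorphic_f holomorphic_on_imp_continuous_on by blast

lemma isCont_f: "isCont f z"
  using continuous_on_f[of UNIV] by (simp add: continuous_on_eq_continuous_at)

lemma f_0 [simp]: "f 0 = 0"
  using r_pos by (simp add: f_eq)

lemma f_minus_lam [simp]: "f (- of_real (lam k)) = 0"
proof -
  have "W (- of_real (lam k)) = 0" using W_nonzero_iff by blast
  then show ?thesis by (simp add: f_eq)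
qed

definition t :: "nat \<Rightarrow> complex \<Rightarrow> complex" where
  "t k z = Ln (1 + z / of_real (lam k)) - z / of_real (lam k) + z^2 / (2 * of_real (lam k) ^ 2)"

definition dt :: "nat \<Rightarrow> complex \<Rightarrow> complex" where
  "dt k z = z^2 / (of_real (lam k) ^ 2 * (z + of_real (lam k)))"

lemma t_bound:
  assumes "norm z \<le> lam k / 2"
  shows "norm (t k z) \<le> 2 * norm z ^ 3 / lam k ^ 3"
proof -
  have "norm (z / lam k) \<le> 1/2" using assms by (simp add: norm_divide field_simps)
  from norm_Ln_taylor2_le[OF this] show ?thesis
    by (simp add: t_def norm_divide power_divide mult_ac)
qed

lemma slit_plus:
  assumes "z \<notin> \<real>\<^sub>\<le>\<^sub>0" "l > 0"
  shows "1 + z / complex_of_real l \<notin> \<real>\<^sub>\<le>\<^sub>0" "z + complex_of_real l \<noteq> 0"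
        "1 + z / complex_of_real l \<noteq> 0"
proof -
  show *: "1 + z / complex_of_real l \<notin> \<real>\<^sub>\<le>\<^sub>0"
  proof
    assume "1 + z / complex_of_real l \<in> \<real>\<^sub>\<le>\<^sub>0"
    then have "Im z = 0" "1 + Re z / l \<le> 0" using \<open>l > 0\<close>
      by (auto simp: complex_nonpos_Reals_iff)
    then show False using assms by (auto simp: complex_nonpos_Reals_iff field_simps)
  qed
  then show "1 + z / complex_of_real l \<noteq> 0" by force
  then show "z + complex_of_real l \<noteq> 0" using \<open>l > 0\<close>
    by (auto simp: add_eq_0_iff2)
qed

lemma t_deriv:
  assumes "z \<notin> \<real>\<^sub>\<le>\<^sub>0"
  shows "(t k has_field_derivative dt k z) (at z)"
proof -
  define l where "l = complex_of_real (lam k)"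
  have l: "l \<noteq> 0" by (simp add: l_def)
  note s = slit_plus[OF assms lam_pos(1)[of k], folded l_def]
  have "((\<lambda>z. Ln (1 + z / l) - z / l + z^2 / (2 * l^2)) has_field_derivative
      (1 / l) / (1 + z / l) - 1 / l + z / l ^ 2) (at z)"
    using s(1) l by (auto intro!: derivative_eq_intros simp: power2_eq_square inverse_eq_divide)
  moreover have "(1 / l) / (1 + z / l) = 1 / (z + l)"
    using s l by (simp add: divide_simps add.commute)
  moreover have "1 / (z + l) - 1 / l + z / l ^ 2 = dt k z"
    using s(2) l by (simp add: dt_def l_def[symmetric] divide_simps)
      (simp add: algebra_simps power2_eq_square)
  ultimately show ?thesis by (simp add: t_def[abs_def] l_def)
qed

definition T :: "complex \<Rightarrow> complex" where "T z = (\<Sum>k. t k z)"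
definition dT :: "complex \<Rightarrow> complex" where "dT z = (\<Sum>k. dt k z)"

lemma t_series:
  assumes "z \<notin> \<real>\<^sub>\<le>\<^sub>0"
  shows "(\<lambda>k. t k z) sums T z" "(\<lambda>k. dt k z) sums dT z"
        "(T has_field_derivative dT z) (at z)"
proof -
  let ?S = "- \<real>\<^sub>\<le>\<^sub>0 :: complex set"
  have op: "open ?S" by (simp add: open_Compl)
  have "\<exists>g g'. \<forall>x \<in> ?S. ((\<lambda>n. t n x) sums g x) \<and> ((\<lambda>n. dt n x) sums g' x) \<and>
        (g has_field_derivative g' x) (at x)"
  proof (rule series_and_derivative_comparison_complex[OF op, of t dt])
    show "(t n has_field_derivative dt n x) (at x)" if "x \<in> ?S" for n x
      using t_deriv that by simp
  next
    fix x :: complex assume "x \<in> ?S"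
    define R where "R = norm x + 1"
    have "\<forall>\<^sub>F n in sequentially. 2 * R \<le> lam n"
      using lam_at_top by (simp add: filterlim_at_top)
    then have "\<forall>\<^sub>F n in sequentially. \<forall>y\<in>ball x 1 \<inter> ?S. norm (t n y) \<le> norm (complex_of_real (2 * R^3 * (1 / lam n ^ 3)))"
    proof eventually_elim
      case (elim n)
      show ?case
      proof
        fix y assume "y \<in> ball x 1 \<inter> ?S"
        then have y: "norm y \<le> R" unfolding R_def
          by (smt (verit) IntE dist_norm mem_ball norm_minus_commute norm_triangle_sub)
        then have "norm (t n y) \<le> 2 * norm y ^ 3 / lam n ^ 3"
          using elim by (intro t_bound) auto
        also have "\<dots> \<le> 2 * R ^ 3 / lam n ^ 3"
          using power_mono[OF y, of 3] by (intro divide_right_mono) auto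
        finally show "norm (t n y) \<le> norm (complex_of_real (2 * R^3 * (1 / lam n ^ 3)))"
          unfolding norm_of_real by (simp add: abs_if)
      qed
    qed
    moreover have "summable (\<lambda>n. complex_of_real (2 * R^3 * (1 / lam n ^ 3)))"
      by (intro summable_of_real summable_mult summable_lam3)
    moreover have "range (\<lambda>n. complex_of_real (2 * R^3 * (1 / lam n ^ 3))) \<subseteq> \<real>\<^sub>\<ge>\<^sub>0"
      by (auto simp: R_def nonneg_Reals_of_real_iff)
    ultimately show "\<exists>d (h::nat\<Rightarrow>complex). 0 < d \<and> summable h \<and> range h \<subseteq> \<real>\<^sub>\<ge>\<^sub>0 \<and>
        (\<forall>\<^sub>F n in sequentially. \<forall>y\<in>ball x d \<inter> ?S. norm (t n y) \<le> norm (h n))"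
      by (intro exI[of _ 1] exI[of _ "\<lambda>n. complex_of_real (2 * R^3 * (1 / lam n ^ 3))"]) (intro conjI zero_less_one)
  qed
  then obtain g g' where g: "\<And>x. x \<in> ?S \<Longrightarrow> ((\<lambda>n. t n x) sums g x) \<and> ((\<lambda>n. dt n x) sums g' x) \<and>
        (g has_field_derivative g' x) (at x)"
    by blast
  have T: "T x = g x" "dT x = g' x" if "x \<in> ?S" for x
    using g[OF that] by (auto simp: T_def dT_def sums_iff)
  have z: "z \<in> ?S" using assms by simp
  show "(\<lambda>k. t k z) sums T z" "(\<lambda>k. dt k z) sums dT z"
    using g[OF z] T[OF z] by auto
  show "(T has_field_derivative dT z) (at z)"
    using has_field_derivative_transform_within_open[of g "g' z" z ?S T] g[OF z] T op z by auto
qed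

definition L :: "complex \<Rightarrow> complex" where
  "L z = of_nat r * Ln z + of_real a * z^2 + of_real b * z + T z"

definition h :: "complex \<Rightarrow> complex" where
  "h z = of_nat r / z + 2 * of_real a * z + of_real b + dT z"

lemma L_deriv:
  assumes "z \<notin> \<real>\<^sub>\<le>\<^sub>0"
  shows "(L has_field_derivative h z) (at z)"
proof -
  have "((\<lambda>z. of_nat r * Ln z + of_real a * z^2 + of_real b * z + T z) has_field_derivative
      of_nat r * (1 / z) + of_real a * (2 * z) + of_real b * 1 + dT z) (at z)"
    using assms
    by (intro DERIV_add DERIV_cmult t_series(3) DERIV_ident)
       (auto intro!: derivative_eq_intros simp: inverse_eq_divide)
  then show ?thesis by (simp add: L_def[abs_def] h_def mult_ac)
qed

lemma exp_L:
  assumes "z \<notin> \<real>\<^sub>\<le>\<^sub>0"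
  shows "exp (L z) = f z"
proof -
  have "(\<lambda>n. \<Prod>k\<le>n. weierstrass_factor 2 (z / - of_real (lam k))) \<longlonglongrightarrow> W z"
    unfolding W_eq wp.f_def by (rule convergent_prod_LIMSEQ[OF wp.convergent])
  moreover have "weierstrass_factor 2 (z / - of_real (lam k)) = exp (t k z)" for k
  proof -
    have "t k z = Ln (1 + z / of_real (lam k)) + (- z / of_real (lam k) + z\<^sup>2 / (2 * (of_real (lam k))\<^sup>2))"
      by (simp add: t_def)
    then show ?thesis
      unfolding weierstrass_factor_2 using exp_Ln[OF slit_plus(3)[OF assms lam_pos(1)[of k]]]
      by (simp only: exp_add)
  qed
  then have "(\<Prod>k\<le>n. weierstrass_factor 2 (z / - of_real (lam k))) = exp (\<Sum>k\<le>n. t k z)" for n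
    by (simp add: exp_sum)
  moreover have "(\<lambda>n. exp (\<Sum>k\<le>n. t k z)) \<longlonglongrightarrow> exp (T z)"
    using t_series(1)[OF assms] by (intro tendsto_exp) (simp add: sums_def_le)
  ultimately have "W z = exp (T z)"
    using LIMSEQ_unique by fastforce
  moreover have "exp (of_nat r * Ln z) = z ^ r"
    using assms exp_Ln[of z] by (cases "z = 0") (auto simp: exp_of_nat_mult)
  ultimately show ?thesis
    by (simp add: L_def f_eq exp_add)
qed

lemma f_deriv:
  assumes "z \<notin> \<real>\<^sub>\<le>\<^sub>0"
  shows "(f has_field_derivative f z * h z) (at z)"
proof -
  have "((\<lambda>z. exp (L z)) has_field_derivative exp (L z) * h z) (at z)"
    by (intro DERIV_fun_exp L_deriv assms)
  then show ?thesis
    using has_field_derivative_transform_within_open[of "\<lambda>z. exp (L z)" "exp (L z) * h z" z "- \<real>\<^sub>\<le>\<^sub>0" f] 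
      exp_L assms by (auto simp: open_Compl)
qed

lemma f_nonzero: "z \<notin> \<real>\<^sub>\<le>\<^sub>0 \<Longrightarrow> f z \<noteq> 0"
  using exp_L[of z] by (metis exp_not_eq_zero)

end

context genus2 begin

lemma of_real_pos_slit [simp]: "x > 0 \<Longrightarrow> complex_of_real x \<notin> \<real>\<^sub>\<le>\<^sub>0"
  by (simp add: nonpos_Reals_of_real_iff)

lemma upper_slit: "Im z > 0 \<Longrightarrow> z \<notin> \<real>\<^sub>\<le>\<^sub>0"
  by (auto simp: complex_nonpos_Reals_iff)

definition fr :: "real \<Rightarrow> real" where "fr = on_reals f"

definition hr :: "real \<Rightarrow> real" where
  "hr x = real r / x + 2 * a * x + b + (\<Sum>k. x^2 / (lam k ^ 2 * (x + lam k)))"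

lemma dt_real: "dt k (of_real x) = of_real (x^2 / (lam k ^ 2 * (x + lam k)))"
  by (simp add: dt_def)

lemma dt_real_summable:
  assumes "x > 0" shows "summable (\<lambda>k. x^2 / (lam k ^ 2 * (x + lam k)))"
proof -
  have "summable (\<lambda>k. complex_of_real (x^2 / (lam k ^ 2 * (x + lam k))))"
    using t_series(2)[of "of_real x"] assms unfolding dt_real by (auto simp: sums_iff)
  then show ?thesis by (simp only: summable_complex_of_real)
qed

lemma dT_real:
  assumes "x > 0" shows "dT (of_real x) = of_real (\<Sum>k. x^2 / (lam k ^ 2 * (x + lam k)))"
  unfolding dT_def dt_real using suminf_of_real[OF dt_real_summable[OF assms], where 'a=complex] by simp

lemma h_real: "x > 0 \<Longrightarrow> h (of_real x) = of_real (hr x)"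
  by (simp add: h_def hr_def dT_real)

lemma L_real: assumes "x > 0" shows "L (of_real x) \<in> \<real>"
proof -
  have "t k (of_real x) = of_real (ln (1 + x / lam k) - x / lam k + x^2 / (2 * lam k ^ 2))" for k
  proof -
    have "1 + x / lam k > 0" using assms by (simp add: add_pos_nonneg)
    then have "Ln (of_real (1 + x / lam k)) = of_real (ln (1 + x / lam k))" by (rule Ln_of_real)
    then show ?thesis by (simp add: t_def)
  qed
  then have "Im (t k (of_real x)) = 0" for k by simp
  moreover have "(\<lambda>k. Im (t k (of_real x))) sums Im (T (of_real x))"
    by (rule sums_Im[OF t_series(1)[OF of_real_pos_slit[OF assms]]])
  ultimately have "Im (T (of_real x)) = 0" by (metis (no_types, lifting) sums_0 sums_unique2)
  then have "T (of_real x) \<in> \<real>" by (simp add: complex_is_Real_iff)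
  moreover have "Ln (of_real x) \<in> \<real>" using assms by (simp add: Ln_of_real)
  ultimately show ?thesis by (auto simp: L_def)
qed

lemma f_real: assumes "x > 0" shows "f (of_real x) = of_real (fr x)" "fr x > 0"
proof -
  obtain l where l: "L (of_real x) = of_real l" using L_real[OF assms] by (auto elim: Reals_cases)
  have "f (of_real x) = of_real (exp l)"
    using exp_L[of "of_real x"] assms by (simp add: l exp_of_real)
  then show "f (of_real x) = of_real (fr x)" "fr x > 0"
    by (auto simp: fr_def on_reals_def)
qed

lemma fr_deriv: assumes "x > 0" shows "(fr has_real_derivative fr x * hr x) (at x)"
proof -
  have "(f has_field_derivative of_real (fr x * hr x)) (at (of_real x))"
    using f_deriv[of "of_real x"] assms by (simp add: f_real h_real)
  then have "((\<lambda>x. f (of_real x)) has_vector_derivative of_real (fr x * hr x)) (at x)"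
    by (rule has_vector_derivative_real_field)
  then have "((\<lambda>x. Re (f (of_real x))) has_vector_derivative Re (of_real (fr x * hr x))) (at x)"
    by (rule bounded_linear.has_vector_derivative[OF bounded_linear_Re])
  then show ?thesis
    by (simp add: has_real_derivative_iff_has_vector_derivative fr_def on_reals_def[abs_def])
qed

lemma fr_continuous: "A \<subseteq> {0<..} \<Longrightarrow> continuous_on A fr"
  by (meson DERIV_continuous continuous_at_imp_continuous_on fr_deriv greaterThan_iff subsetD)

lemma hr_continuous: "continuous_on {0<..} hr"
proof -
  have "isCont hr x" if "x > 0" for x
  proof -
    have "(L has_field_derivative h w) (at w)" if "w \<in> - \<real>\<^sub>\<le>\<^sub>0" for w using L_deriv that by auto
    then have "L holomorphic_on (- \<real>\<^sub>\<le>\<^sub>0)" "\<And>w. w \<in> - \<real>\<^sub>\<le>\<^sub>0 \<Longrightarrow> deriv L w = h w"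
      by (auto simp: holomorphic_on_def DERIV_imp_deriv field_differentiable_def intro: has_field_derivative_at_within)
    then have "h holomorphic_on (- \<real>\<^sub>\<le>\<^sub>0)"
      using holomorphic_deriv[of L "- \<real>\<^sub>\<le>\<^sub>0"] holomorphic_cong[OF refl, of "- \<real>\<^sub>\<le>\<^sub>0" "deriv L" h]
      by (simp add: open_Compl)
    then have "continuous_on (- \<real>\<^sub>\<le>\<^sub>0) h" by (rule holomorphic_on_imp_continuous_on)
    moreover have "isCont complex_of_real x" by simp
    ultimately have "isCont (\<lambda>x. h (of_real x)) x"
      using of_real_pos_slit[OF that]
      by (intro continuous_at_compose[unfolded o_def, of x complex_of_real h])
         (auto simp: continuous_on_eq_continuous_at open_Compl)
    then have "isCont (\<lambda>x. Re (h (of_real x))) x" by (rule isCont_Re)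
    moreover have "\<forall>\<^sub>F y in nhds x. y \<in> {0<..}" using that by (intro eventually_nhds_in_open) auto
    then have "\<forall>\<^sub>F y in nhds x. Re (h (of_real y)) = hr y"
      by eventually_elim (simp add: h_real)
    ultimately show ?thesis 
      using isCont_cong[of "\<lambda>x. Re (h (of_real x))" hr x] by blast
  qed
  then show ?thesis by (intro continuous_at_imp_continuous_on) auto
qed

lemma hr_convex:
  assumes "x > 0" "y > 0" "0 \<le> u" "u \<le> 1"
  shows "hr ((1-u) * x + u * y) \<le> (1-u) * hr x + u * hr y"
proof -
  have inv: "1 / ((1-u) * x + u * y) \<le> (1-u) * (1/x) + u * (1/y)" if "x > 0" "y > 0" for x y
  proof -
    have "convex_on {0<..} (inverse :: real \<Rightarrow> real)"
      using convex_on_inverse[of "{0<..}"] by auto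
    from convex_onD[OF this, of u x y] show ?thesis using assms(3,4) that by (simp add: inverse_eq_divide)
  qed
  define z where "z = (1-u) * x + u * y"
  have z: "z > 0" unfolding z_def using assms
    by (cases "u = 0") (auto intro: add_nonneg_pos)
  define g where "g = (\<lambda>k x. x^2 / (lam k ^ 2 * (x + lam k)))"
  have g_eq: "g k x = (x - lam k) / lam k ^ 2 + 1 / (x + lam k)" if "x > 0" for k x
  proof -
    have "x + lam k > 0" using that by (simp add: add_pos_pos)
    then show ?thesis by (simp add: g_def divide_simps) (simp add: algebra_simps power2_eq_square)
  qed
  have gle: "g k z \<le> (1-u) * g k x + u * g k y" for k
  proof -
    have "z + lam k = (1-u) * (x + lam k) + u * (y + lam k)" by (simp add: z_def algebra_simps)
    then have "1 / (z + lam k) \<le> (1-u) * (1 / (x + lam k)) + u * (1 / (y + lam k))"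
      using inv[of "x + lam k" "y + lam k"] assms by (simp add: add_pos_pos)
    moreover have "(z - lam k) / lam k ^ 2 = (1-u) * ((x - lam k) / lam k ^ 2) + u * ((y - lam k) / lam k ^ 2)"
      by (simp add: z_def field_simps)
    ultimately show ?thesis unfolding g_eq[OF z] g_eq[OF assms(1)] g_eq[OF assms(2)]
      by (simp add: algebra_simps)
  qed
  have "(\<Sum>k. g k z) \<le> (\<Sum>k. (1-u) * g k x + u * g k y)"
    by (intro suminf_le gle summable_add summable_mult)
       (auto simp: g_def intro!: dt_real_summable assms z)
  also have "\<dots> = (1-u) * (\<Sum>k. g k x) + u * (\<Sum>k. g k y)"
  proof -
    have "summable (\<lambda>k. g k x)" "summable (\<lambda>k. g k y)"
      using dt_real_summable assms(1,2) by (auto simp: g_def)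
    then have "(\<lambda>k. (1-u) * g k x + u * g k y) sums ((1-u) * (\<Sum>k. g k x) + u * (\<Sum>k. g k y))"
      by (intro sums_add sums_mult summable_sums)
    then show ?thesis by (rule sums_unique[symmetric])
  qed
  finally have 1: "(\<Sum>k. g k z) \<le> (1-u) * (\<Sum>k. g k x) + u * (\<Sum>k. g k y)" .
  have 2: "real r / z \<le> (1-u) * (real r / x) + u * (real r / y)"
  proof -
    have "real r * (1 / z) \<le> real r * ((1-u) * (1/x) + u * (1/y))"
      using inv[OF assms(1,2)] by (intro mult_left_mono) (auto simp: z_def)
    also have "\<dots> = (1-u) * (real r / x) + u * (real r / y)" 
      by (simp only: distrib_left times_divide_eq_right mult_1_right mult_ac)
    finally show ?thesis by simp
  qed
  have 3: "2 * a * z + b = (1-u) * (2 * a * x + b) + u * (2 * a * y + b)"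
    by (simp add: z_def algebra_simps)
  have hr: "hr x = real r / x + (2 * a * x + b) + (\<Sum>k. g k x)" for x
    by (simp add: hr_def g_def)
  have "hr z \<le> ((1-u) * (real r / x) + u * (real r / y)) + ((1-u) * (2 * a * x + b) + u * (2 * a * y + b))
      + ((1-u) * (\<Sum>k. g k x) + u * (\<Sum>k. g k y))"
    unfolding hr 3 using 1 2 by linarith
  also have "\<dots> = (1-u) * hr x + u * hr y"
    unfolding hr by (simp only: distrib_left)
  finally show ?thesis by (simp add: z_def)
qed

lemma hr_at_0: "\<exists>\<delta>>0. \<forall>x. 0 < x \<and> x < \<delta> \<longrightarrow> hr x > 0"
proof -
  define \<delta> where "\<delta> = 1 / (2 * \<bar>a\<bar> + \<bar>b\<bar> + 1)"
  have d: "0 < \<delta>" "\<delta> \<le> 1" by (auto simp: \<delta>_def divide_simps)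
  have "hr x > 0" if "0 < x" "x < \<delta>" for x
  proof -
    have "(\<Sum>k. x^2 / (lam k ^ 2 * (x + lam k))) \<ge> 0"
      using that by (intro suminf_nonneg dt_real_summable) auto
    moreover have "1 / x > 2 * \<bar>a\<bar> + \<bar>b\<bar> + 1"
    proof -
      have pos: "2 * \<bar>a\<bar> + \<bar>b\<bar> + 1 > 0" by linarith
      have "x * (2 * \<bar>a\<bar> + \<bar>b\<bar> + 1) < \<delta> * (2 * \<bar>a\<bar> + \<bar>b\<bar> + 1)"
        using that pos by (intro mult_strict_right_mono) auto
      also have "\<dots> = 1" using pos by (simp add: \<delta>_def)
      finally show ?thesis using that by (simp only: pos_less_divide_eq mult.commute[of x])
    qed
    moreover have "real r / x \<ge> 1 / x" using that r_pos by (intro divide_right_mono) auto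
    moreover have "2 * a * x \<ge> - (2 * \<bar>a\<bar>)"
    proof -
      have "\<bar>2 * a * x\<bar> \<le> 2 * \<bar>a\<bar> * 1"
        unfolding abs_mult using that d by (intro mult_mono) auto
      then show ?thesis by linarith
    qed
    ultimately show ?thesis unfolding hr_def by linarith
  qed
  then show ?thesis using d by blast
qed

lemma ex_alpha:
  assumes G: "f \<in> class_G" and min: "local_min_on {0<..} (on_reals f) \<beta>"
  shows "\<exists>\<alpha>. 0 < \<alpha> \<and> \<alpha> < \<beta> \<and> hr \<alpha> = 0 \<and> hr \<beta> = 0"
proof -
  have b0: "\<beta> > 0" and mi: "\<forall>\<^sub>F y in at \<beta>. fr \<beta> \<le> fr y"
    using min at_within_open[of \<beta> "{0<..}"] by (auto simp: local_min_on_def fr_def)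
  obtain d where d: "d > 0" "\<And>y. y \<noteq> \<beta> \<Longrightarrow> \<bar>y - \<beta>\<bar> < d \<Longrightarrow> fr \<beta> \<le> fr y"
    using mi by (auto simp: eventually_at dist_real_def)
  have "fr \<beta> * hr \<beta> = 0"
    using DERIV_local_min[OF fr_deriv[OF b0] d(1)] d(2) by (metis abs_minus_commute order_refl)
  then have hb: "hr \<beta> = 0" using f_real(2)[OF b0] by simp
  obtain p q where pq: "0 \<le> p" "p < q" "strict_antimono_on {p<..<q} fr"
    using G by (auto simp: class_G_def fr_def)
  define x where "x = p + (q - p) / 3"
  define y where "y = p + 2 * (q - p) / 3"
  have xy: "p < x" "x < y" "y < q" using pq by (auto simp: x_def y_def field_simps)
  then have "fr y < fr x" using pq by (auto simp: monotone_on_def)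
  moreover obtain c where c: "x < c" "c < y" "fr y - fr x = (y - x) * (fr c * hr c)"
    using MVT2[of x y fr "\<lambda>x. fr x * hr x"] fr_deriv xy pq by auto
  ultimately have "fr c * hr c < 0" using xy by (smt (verit) mult_nonneg_nonneg)
  moreover have c0: "c > 0" using c xy pq by auto
  ultimately have hc: "hr c < 0" using f_real(2)[OF c0] by (simp add: mult_less_0_iff)
  have "c < \<beta>"
  proof (rule ccontr)
    assume "\<not> c < \<beta>"
    then have cb: "\<beta> < c" using hb hc by (cases "c = \<beta>") auto
    have neg: "hr s < 0" if "\<beta> < s" "s < c" for s
    proof -
      define u where "u = (s - \<beta>) / (c - \<beta>)"
      have u: "0 < u" "u < 1" using that cb by (auto simp: u_def)
      have "u * (c - \<beta>) = s - \<beta>" using cb by (simp add: u_def)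
      then have "(1-u) * \<beta> + u * c = s" by (simp add: algebra_simps)
      then have "hr s \<le> (1-u) * 0 + u * hr c"
        using hr_convex[of \<beta> c u] u b0 c0 hb by simp
      then show ?thesis using u hc by (smt (verit) mult_pos_neg)
    qed
    define s where "s = \<beta> + min d (c - \<beta>) / 2"
    have s: "\<beta> < s" "s < c" "\<bar>s - \<beta>\<bar> < d" using d cb by (auto simp: s_def min_def field_simps)
    obtain e where e: "\<beta> < e" "e < s" "fr s - fr \<beta> = (s - \<beta>) * (fr e * hr e)"
      using MVT2[of \<beta> s fr "\<lambda>x. fr x * hr x"] fr_deriv s b0 by auto
    have "fr e * hr e < 0" using neg[of e] e s f_real(2)[of e] b0 by (simp add: mult_pos_neg)
    then have "fr s < fr \<beta>" using e s by (smt (verit) mult_pos_neg)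
    then show False using d(2)[of s] s by auto
  qed
  obtain \<delta> where dl: "\<delta> > 0" "\<And>x. 0 < x \<Longrightarrow> x < \<delta> \<Longrightarrow> hr x > 0" using hr_at_0 by blast
  define e where "e = min \<delta> c / 2"
  have e: "0 < e" "e < \<delta>" "e < c" using dl c0 by (auto simp: e_def)
  have "continuous_on {e..c} hr" using e by (intro continuous_on_subset[OF hr_continuous]) auto
  then obtain \<alpha> where "e \<le> \<alpha>" "\<alpha> \<le> c" "hr \<alpha> = 0"
    using IVT2'[of hr c 0 e] dl(2)[of e] e hc by auto
  then show ?thesis using e \<open>c < \<beta>\<close> hb by (intro exI[of _ \<alpha>]) auto
qed

end

section \<open>The logarithmic derivative on the upper half plane\<close>

locale genus2_zeros = genus2 +
  fixes \<alpha> \<beta> :: real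
  assumes al0: "0 < \<alpha>" and ab: "\<alpha> < \<beta>" and h_al: "hr \<alpha> = 0" and h_be: "hr \<beta> = 0"
begin

lemma be0: "0 < \<beta>" using al0 ab by simp

definition P :: "complex \<Rightarrow> complex" where
  "P z = z * h z / ((z - of_real \<alpha>) * (z - of_real \<beta>))"

text \<open>Up to the constant \<open>2 a\<close>, \<open>P\<close> is the sum of the second divided differences at \<open>z\<close>, \<open>\<alpha>\<close>, \<open>\<beta>\<close>
  of the terms \<open>z dt k z\<close> of \<open>z h z\<close>; these are the \<open>q k z\<close>.\<close>
definition q :: "nat \<Rightarrow> complex \<Rightarrow> complex" where
  "q k z = 1 / of_real (lam k)^2
     - of_real (lam k / ((\<alpha> + lam k) * (\<beta> + lam k))) / (z + of_real (lam k))"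

lemma divided_difference:
  fixes z l A B :: complex
  assumes "l \<noteq> 0" "z + l \<noteq> 0" "A + l \<noteq> 0" "B + l \<noteq> 0" "A \<noteq> B"
  shows "z * (z^2 / (l^2 * (z + l))) - (A * (A^2 / (l^2 * (A + l))) * (z - B) - B * (B^2 / (l^2 * (B + l))) * (z - A)) / (A - B)
    = (z - A) * (z - B) * (1 / l^2 - l / ((A + l) * (B + l)) / (z + l))"
proof -
  have e: "x * (x^2 / (l^2 * (x + l))) = (x^2 - l * x + l^2) / l^2 - l / (x + l)" if "x + l \<noteq> 0" for x
    using that assms(1) by (simp add: divide_simps) (simp add: algebra_simps power2_eq_square)
  have "A - B \<noteq> 0" using assms by simp
  then show ?thesis unfolding e[OF assms(2)] e[OF assms(3)] e[OF assms(4)]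
    using assms by (simp add: divide_simps) algebra
qed

lemma q_sums_aux:
  assumes s: "(\<lambda>k. z * dt k z) sums s" and nz: "\<And>k. z + of_real (lam k) \<noteq> 0"
    and z: "z \<noteq> of_real \<alpha>" "z \<noteq> of_real \<beta>"
  shows "(\<lambda>k. q k z) sums ((of_nat r + of_real b * z + 2 * of_real a * z^2 + s)
            / ((z - of_real \<alpha>) * (z - of_real \<beta>)) - 2 * of_real a)"
proof -
  define A where "A = complex_of_real \<alpha>"
  define B where "B = complex_of_real \<beta>"
  have AB: "A - B \<noteq> 0" "A \<noteq> B" "A \<noteq> 0" "B \<noteq> 0" using ab al0 by (auto simp: A_def B_def)
  have hA: "of_nat r + of_real b * A + 2 * of_real a * A^2 + A * dT A = 0"
  proof -
    have "h A = 0" using h_real[OF al0] by (simp add: A_def h_al)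
    then have "A * h A = 0" by simp
    then show ?thesis using AB by (simp add: h_def algebra_simps power2_eq_square)
  qed
  have hB: "of_nat r + of_real b * B + 2 * of_real a * B^2 + B * dT B = 0"
  proof -
    have "h B = 0" using h_real[OF be0] by (simp add: B_def h_be)
    then have "B * h B = 0" by simp
    then show ?thesis using AB by (simp add: h_def algebra_simps power2_eq_square)
  qed
  have sA: "(\<lambda>k. A * dt k A) sums (A * dT A)" and sB: "(\<lambda>k. B * dt k B) sums (B * dT B)"
    using al0 be0 by (auto intro!: sums_mult t_series(2) simp: A_def B_def)
  have "(\<lambda>k. (z * dt k z - (A * dt k A * (z - B) - B * dt k B * (z - A)) / (A - B)) / ((z - A) * (z - B)))
      sums ((s - (A * dT A * (z - B) - B * dT B * (z - A)) / (A - B)) / ((z - A) * (z - B)))"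
    by (intro sums_divide sums_diff sums_mult2 s sA sB)
  moreover have "(z * dt k z - (A * dt k A * (z - B) - B * dt k B * (z - A)) / (A - B)) / ((z - A) * (z - B)) = q k z" for k
  proof -
    have l: "complex_of_real (lam k) \<noteq> 0" "A + of_real (lam k) \<noteq> 0" "B + of_real (lam k) \<noteq> 0"
      using al0 be0 lam_pos(1)[of k] unfolding A_def B_def of_real_add[symmetric] of_real_eq_0_iff
      by linarith+
    have "z * dt k z - (A * dt k A * (z - B) - B * dt k B * (z - A)) / (A - B) = (z - A) * (z - B) * q k z"
      unfolding dt_def q_def using divided_difference[OF l(1) nz[of k] l(2,3) AB(2)]
      by (simp add: A_def B_def)
    then show ?thesis using z by (simp add: A_def B_def)
  qed
  moreover have "(s - (A * dT A * (z - B) - B * dT B * (z - A)) / (A - B)) / ((z - A) * (z - B)) =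
      (of_nat r + of_real b * z + 2 * of_real a * z^2 + s) / ((z - A) * (z - B)) - 2 * of_real a"
  proof -
    have e: "A * dT A = - (of_nat r + of_real b * A + 2 * of_real a * A^2)"
      "B * dT B = - (of_nat r + of_real b * B + 2 * of_real a * B^2)"
      using hA hB by (auto simp: eq_neg_iff_add_eq_0 algebra_simps)
    have e: "s - (A * dT A * (z - B) - B * dT B * (z - A)) / (A - B) =
        (of_nat r + of_real b * z + 2 * of_real a * z^2 + s) - 2 * of_real a * ((z - A) * (z - B))"
      unfolding e using AB(1) by (simp add: divide_simps) (simp add: algebra_simps power2_eq_square)
    have "(z - A) * (z - B) \<noteq> 0" using z by (simp add: A_def B_def)
    then have "(y - c * ((z - A) * (z - B))) / ((z - A) * (z - B)) = y / ((z - A) * (z - B)) - c" for y c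
      unfolding diff_divide_distrib by simp
    then show ?thesis unfolding e .
  qed
  ultimately show ?thesis by (simp add: A_def B_def)
qed

lemma q_sums:
  assumes "z \<notin> \<real>\<^sub>\<le>\<^sub>0" "z \<noteq> of_real \<alpha>" "z \<noteq> of_real \<beta>"
  shows "(\<lambda>k. q k z) sums (P z - 2 * of_real a)"
proof -
  have "z \<noteq> 0" using assms by auto
  then have "of_nat r + of_real b * z + 2 * of_real a * z^2 + z * dT z = z * h z"
    by (simp add: h_def algebra_simps power2_eq_square)
  then show ?thesis
    using q_sums_aux[OF sums_mult[OF t_series(2)[OF assms(1)], of z]] slit_plus[OF assms(1)] assms(2,3)
    by (simp add: P_def)
qed

lemma q_sums_0: "(\<lambda>k. q k 0) sums (of_real (r / (\<alpha> * \<beta>)) - 2 * of_real a)"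
  using q_sums_aux[of 0 0] al0 be0 by (simp add: dt_def)

lemma Im_P_pos:
  assumes "Im z > 0" shows "Im (P z) > 0"
proof -
  have "z \<noteq> of_real \<alpha>" "z \<noteq> of_real \<beta>" using assms by auto
  then have s: "(\<lambda>k. Im (q k z)) sums Im (P z - 2 * of_real a)"
    using sums_Im[OF q_sums[OF upper_slit[OF assms]]] by simp
  have "Im (q k z) > 0" for k
  proof -
    have "Im (1 / of_real (lam k)^2) = 0" by (simp add: of_real_power[symmetric] del: of_real_power)
    moreover have "Im (of_real c / (z + of_real (lam k))) < 0" if "c > 0" for c
    proof -
      have "(Re z + lam k)\<^sup>2 + (Im z)\<^sup>2 > 0" using assms by (simp add: sum_power2_gt_zero_iff)
      then show ?thesis using that assms
        by (simp add: Im_divide power2_eq_square divide_neg_pos)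
    qed
    moreover have "lam k / ((\<alpha> + lam k) * (\<beta> + lam k)) > 0"
      using al0 be0 by (simp add: add_pos_pos)
    ultimately show ?thesis unfolding q_def minus_complex.simps by fastforce
  qed
  then have "0 < (\<Sum>k. Im (q k z))"
    using s by (intro suminf_pos) (auto simp: sums_iff)
  then show ?thesis using s by (simp add: sums_iff)
qed

lemma P_real_ge:
  assumes "x > 0" "x \<noteq> \<alpha>" "x \<noteq> \<beta>"
  shows "x * hr x / ((x - \<alpha>) * (x - \<beta>)) \<ge> r / (\<alpha> * \<beta>)"
proof -
  have "complex_of_real x \<noteq> of_real \<alpha>" "complex_of_real x \<noteq> of_real \<beta>" using assms by auto
  note s1 = sums_Re[OF q_sums[OF of_real_pos_slit[OF assms(1)] this]]
  note s2 = sums_Re[OF q_sums_0]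
  have "Re (q k 0) \<le> Re (q k (of_real x))" for k
  proof -
    define c where "c = lam k / ((\<alpha> + lam k) * (\<beta> + lam k))"
    have c: "c > 0" using al0 be0 by (simp add: c_def add_pos_pos)
    have "q k (of_real y) = of_real (1 / lam k ^ 2 - c / (y + lam k))" for y
      by (simp add: q_def c_def)
    from this[of x] this[of 0] have "Re (q k (of_real x)) = 1 / lam k ^ 2 - c / (x + lam k)"
      "Re (q k 0) = 1 / lam k ^ 2 - c / lam k" by (simp_all del: of_real_diff)
    moreover have "c / (x + lam k) \<le> c / lam k" using c assms by (intro divide_left_mono) (auto intro!: mult_pos_pos add_pos_pos)
    ultimately show ?thesis by simp
  qed
  then have "Re (of_real (r / (\<alpha> * \<beta>)) - 2 * of_real a) \<le> Re (P (of_real x) - 2 * of_real a)"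
    by (rule sums_le[OF _ s2 s1])
  moreover have "P (of_real x) = of_real (x * hr x / ((x - \<alpha>) * (x - \<beta>)))"
    by (simp add: P_def h_real assms)
  ultimately show ?thesis by simp
qed

lemma hr_ge:
  assumes "x > 0"
  shows "(x < \<alpha> \<or> \<beta> < x) \<Longrightarrow> hr x \<ge> r / (\<alpha> * \<beta>) * ((x - \<alpha>) * (x - \<beta>)) / x"
    and "\<alpha> < x \<Longrightarrow> x < \<beta> \<Longrightarrow> hr x < 0"
    and "(x < \<alpha> \<or> \<beta> < x) \<Longrightarrow> hr x > 0"
proof -
  have c: "r / (\<alpha> * \<beta>) > 0" using r_pos al0 be0 by simp
  show "\<alpha> < x \<Longrightarrow> x < \<beta> \<Longrightarrow> hr x < 0"
  proof -
    assume x: "\<alpha> < x" "x < \<beta>"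
    then have "(x - \<alpha>) * (x - \<beta>) < 0" by (simp add: mult_less_0_iff)
    moreover have "x * hr x / ((x - \<alpha>) * (x - \<beta>)) > 0" using P_real_ge[of x] x assms c by auto
    ultimately have "x * hr x < 0" by (auto simp: zero_less_divide_iff)
    then show ?thesis using assms by (simp add: mult_less_0_iff)
  qed
  show 1: "hr x \<ge> r / (\<alpha> * \<beta>) * ((x - \<alpha>) * (x - \<beta>)) / x" if x: "x < \<alpha> \<or> \<beta> < x"
  proof -
    have "(x - \<alpha>) * (x - \<beta>) > 0" using x ab by (auto simp: zero_less_mult_iff)
    moreover have "x * hr x / ((x - \<alpha>) * (x - \<beta>)) \<ge> r / (\<alpha> * \<beta>)" using P_real_ge[of x] x assms ab by auto
    ultimately have "x * hr x \<ge> r / (\<alpha> * \<beta>) * ((x - \<alpha>) * (x - \<beta>))" by (simp add: pos_le_divide_eq)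
    then show ?thesis using assms by (simp only: pos_divide_le_eq mult.commute)
  qed
  show "hr x > 0" if x: "x < \<alpha> \<or> \<beta> < x"
  proof -
    have "(x - \<alpha>) * (x - \<beta>) > 0" using x ab by (auto simp: zero_less_mult_iff)
    then have "r / (\<alpha> * \<beta>) * ((x - \<alpha>) * (x - \<beta>)) / x > 0"
      by (intro divide_pos_pos[OF mult_pos_pos[OF c]] assms)
    then show ?thesis using 1[OF x] by linarith
  qed
qed

definition m :: real where "m = fr \<beta>"

lemma m_pos: "m > 0" unfolding m_def by (rule f_real(2)[OF be0])

lemma fr_strict_mono:
  assumes "\<beta> \<le> x" "x < y" shows "fr x < fr y"
proof -
  have "fr x < fr y"
  proof (rule DERIV_pos_imp_increasing_open[OF assms(2)])
    show "\<exists>d. (fr has_real_derivative d) (at s) \<and> 0 < d" if "x < s" "s < y" for s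
      using fr_deriv[of s] hr_ge(3)[of s] f_real(2)[of s] that assms be0
      by (intro exI[of _ "fr s * hr s"]) auto
    show "continuous_on {x..y} fr" using assms be0 by (intro fr_continuous) auto
  qed
  then show ?thesis .
qed

lemma fr_ge_m:
  assumes "\<alpha> \<le> x" shows "fr x \<ge> m"
proof (cases x \<beta> rule: linorder_cases)
  case less
  have "fr \<beta> < fr x"
  proof (rule DERIV_neg_imp_decreasing_open[OF less])
    show "\<exists>d. (fr has_real_derivative d) (at s) \<and> 0 > d" if "x < s" "s < \<beta>" for s
      using fr_deriv[of s] hr_ge(2)[of s] f_real(2)[of s] that assms al0
      by (intro exI[of _ "fr s * hr s"]) (auto simp: mult_pos_neg)
    show "continuous_on {x..\<beta>} fr" using assms al0 by (intro fr_continuous) auto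
  qed
  then show ?thesis by (simp add: m_def)
next
  case greater
  then show ?thesis using fr_strict_mono[of \<beta> x] by (simp add: m_def)
qed (simp add: m_def)

lemma fr_exp_growth: "\<exists>c>0. \<exists>x0. \<forall>x\<ge>x0. fr x \<ge> c * exp x"
proof -
  define c where "c = r / (\<alpha> * \<beta>)"
  have c: "c > 0" using r_pos al0 be0 by (simp add: c_def)
  define x0 where "x0 = 2 * \<beta> + 4 / c"
  have x0: "x0 > 0" "2 * \<beta> < x0" using c be0 by (auto simp: x0_def add_pos_pos)
  have h1: "hr x \<ge> 1" if "x \<ge> x0" for x
  proof -
    have x: "x > 2 * \<beta>" "x \<ge> 4 / c" "x > 0"
      using that x0 be0 unfolding x0_def by linarith+
    have "1 * x \<le> c * ((x/2) * (x/2))" using x c by (simp add: field_simps)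
    also have "\<dots> \<le> c * ((x - \<alpha>) * (x - \<beta>))"
      using x c ab by (intro mult_left_mono mult_mono) auto
    finally have "1 \<le> c * ((x - \<alpha>) * (x - \<beta>)) / x" using x by (subst pos_le_divide_eq) auto
    also have "\<dots> \<le> hr x" using hr_ge(1)[of x] x be0 by (simp add: c_def)
    finally show ?thesis .
  qed
  define k where "k = fr x0 * exp (- x0)"
  have k: "k > 0" using f_real(2)[OF x0(1)] by (simp add: k_def)
  have "fr x \<ge> k * exp x" if "x \<ge> x0" for x
  proof -
    have "fr x0 * exp (- x0) \<le> fr x * exp (- x)"
    proof (rule DERIV_nonneg_imp_nondecreasing[OF that])
      fix s assume s: "x0 \<le> s" "s \<le> x"
      have "((\<lambda>x. fr x * exp (- x)) has_real_derivative (fr s * hr s * exp (-s) - fr s * exp (-s))) (at s)"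
        using x0 s by (auto intro!: derivative_eq_intros fr_deriv)
      moreover have "fr s * hr s * exp (-s) - fr s * exp (-s) = fr s * exp (-s) * (hr s - 1)"
        by (simp add: algebra_simps)
      moreover have "\<dots> \<ge> 0" using h1[OF s(1)] f_real(2)[of s] x0 s by simp
      ultimately show "\<exists>y. ((\<lambda>x. fr x * exp (- x)) has_real_derivative y) (at s) \<and> 0 \<le> y" by auto
    qed
    then show ?thesis by (simp add: k_def exp_minus field_simps)
  qed
  then show ?thesis using k by blast
qed

lemma fr_at_top: "filterlim fr at_top at_top"
proof -
  obtain c x0 where c: "c > 0" "\<And>x. x \<ge> x0 \<Longrightarrow> fr x \<ge> c * exp x" using fr_exp_growth by blast
  have "filterlim (\<lambda>x::real. c * exp x) at_top at_top"
    using c(1) by (intro filterlim_tendsto_pos_mult_at_top[OF tendsto_const _ exp_at_top]) auto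
  then show ?thesis
    by (rule filterlim_at_top_mono) (use c in \<open>auto simp: eventually_at_top_linorder\<close>)
qed

lemma fr_inj: "inj_on fr {\<beta><..}"
  by (intro linorder_inj_onI) (auto dest: fr_strict_mono[OF less_imp_le])

lemma fr_surj: assumes "y > m" shows "\<exists>x>\<beta>. fr x = y"
proof -
  obtain X where X: "\<And>x. x \<ge> X \<Longrightarrow> fr x \<ge> y"
    using fr_at_top by (auto simp: filterlim_at_top eventually_at_top_linorder)
  define x1 where "x1 = max X (\<beta> + 1)"
  have "\<exists>x\<ge>\<beta>. x \<le> x1 \<and> fr x = y"
    using be0 assms X[of x1] by (intro IVT' fr_continuous) (auto simp: x1_def m_def)
  then obtain x where "x \<ge> \<beta>" "fr x = y" by blast
  moreover from this have "x \<noteq> \<beta>" using assms by (auto simp: m_def)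
  ultimately show ?thesis by (intro exI[of _ x]) auto
qed

definition finv0 :: "real \<Rightarrow> real" where "finv0 = the_inv_into {\<beta><..} fr"

lemma finv0: assumes "y > m" shows "finv0 y > \<beta>" "fr (finv0 y) = y"
proof -
  obtain x where x: "x > \<beta>" "fr x = y" using fr_surj assms by blast
  then have "finv0 y = x" unfolding finv0_def by (metis fr_inj greaterThan_iff the_inv_into_f_eq)
  then show "finv0 y > \<beta>" "fr (finv0 y) = y" using x by auto
qed

lemma finv0_fr: "x > \<beta> \<Longrightarrow> finv0 (fr x) = x"
  unfolding finv0_def by (rule the_inv_into_f_f[OF fr_inj]) auto

lemma finv0_sublinear: "((\<lambda>y. finv0 y / y) \<longlongrightarrow> 0) at_top"
proof -
  obtain c x0 where c: "c > 0" "\<And>x. x \<ge> x0 \<Longrightarrow> fr x \<ge> c * exp x" using fr_exp_growth by blast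
  show ?thesis
  proof (rule tendstoI)
    fix e :: real assume e: "e > 0"
    have "((\<lambda>x::real. x / exp x) \<longlongrightarrow> 0) at_top"
      using tendsto_power_div_exp_0[of 1] by simp
    then have "\<forall>\<^sub>F x::real in at_top. dist (x / exp x) 0 < c * e"
      by (rule tendstoD) (use c(1) e in simp)
    then obtain x1 where x1: "\<And>x. x \<ge> x1 \<Longrightarrow> \<bar>x / exp x\<bar> < c * e"
      by (auto simp: eventually_at_top_linorder)
    define X where "X = Max {x0, x1, \<beta> + 1}"
    have X: "X \<ge> x0" "X \<ge> x1" "X > \<beta>" by (auto simp: X_def)
    have "\<bar>finv0 y / y\<bar> < e" if y: "y > fr X" for y
    proof -
      have ym: "y > m" using y fr_ge_m[of X] X ab by auto
      define x where "x = finv0 y"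
      have x: "x > \<beta>" "fr x = y" using finv0[OF ym] by (auto simp: x_def)
      have "x > X"
        using fr_strict_mono[of x X] x y by (metis less_eq_real_def not_less not_less_iff_gr_or_eq)
      then have xx: "x \<ge> x0" "x \<ge> x1" "x > 0" using X x be0 by auto
      have "x / y \<le> x / (c * exp x)" using c(2)[OF xx(1)] x xx c(1) m_pos ym
        by (intro divide_left_mono) auto
      also have "\<dots> < e" using x1[OF xx(2)] xx c(1) by (simp add: field_simps)
      finally show ?thesis using xx ym m_pos by (simp add: x_def)
    qed
    then show "\<forall>\<^sub>F y in at_top. dist (finv0 y / y) 0 < e"
      by (intro eventually_mono[OF eventually_gt_at_top[of "fr X"]]) (simp add: dist_real_def)
  qed
qed

end

section \<open>The argument of the product\<close>

lemma arctan_ge: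
  assumes "0 \<le> t" shows "t / (1 + t^2) \<le> arctan t"
proof -
  have "arctan 0 - 0 / (1 + 0^2) \<le> arctan t - t / (1 + t^2)"
  proof (rule DERIV_nonneg_imp_nondecreasing[OF assms])
    fix x :: real
    have pos: "1 + x^2 > 0" by (smt (verit) zero_le_power2)
    then have "((\<lambda>t. arctan t - t / (1 + t^2)) has_real_derivative
       (inverse (1 + x^2) - (1 * (1 + x^2) - x * (2 * x)) / ((1 + x^2) * (1 + x^2)))) (at x)"
      by (auto intro!: derivative_eq_intros)
    moreover have "inverse (1 + x^2) - (1 * (1 + x^2) - x * (2 * x)) / ((1 + x^2) * (1 + x^2)) = 2 * x^2 / (1 + x^2)^2"
      using pos by (simp add: divide_simps power2_eq_square)
    ultimately show "\<exists>y. ((\<lambda>t. arctan t - t / (1 + t^2)) has_real_derivative y) (at x) \<and> 0 \<le> y"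
      by (intro exI[of _ "2 * x^2 / (1 + x^2)^2"]) simp
  qed
  then show ?thesis by simp
qed

lemma arctan_shift_ge:
  assumes "0 < X" "X < l" "0 < y" "y \<le> X / 4"
  shows "y / l + X * y / l^2 \<le> arctan (y / (l - X))"
proof -
  define xi where "xi = X / l"
  define u where "u = y / l"
  define s where "s = u / (1 - xi)"
  have l: "l > 0" using assms by simp
  have xi: "0 < xi" "xi < 1" using assms l by (auto simp: xi_def)
  have u: "0 < u" "u \<le> xi / 4" using assms l by (auto simp: xi_def u_def field_simps)
  have s: "0 < s" using u xi by (simp add: s_def)
  have s_eq: "y / (l - X) = s" using l assms by (simp add: s_def u_def xi_def field_simps)
  have us: "u * (1 + xi) = s * (1 - xi^2)"
    using xi by (simp add: s_def field_simps power2_eq_square)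
  have lhs: "y / l + X * y / l^2 = u * (1 + xi)"
    using l by (simp add: u_def xi_def field_simps power2_eq_square)
  have "u * (1 + xi) \<le> arctan s"
  proof (cases "s \<le> xi")
    case True
    have "s^2 \<le> xi^2" using True s by (intro power_mono) auto
    then have "s * (1 - xi^2) \<le> s * (1 - s^2)" using s by (intro mult_left_mono) auto
    also have "\<dots> \<le> s / (1 + s^2)"
    proof -
      have p: "1 + s^2 > 0" by (smt (verit) zero_le_power2)
      have "(1 - s^2) * (1 + s^2) \<le> 1" by (simp add: algebra_simps)
      then have "1 - s^2 \<le> 1 / (1 + s^2)" using p by (simp add: pos_le_divide_eq)
      from mult_left_mono[OF this, of s] show ?thesis using s by simp
    qed
    also have "\<dots> \<le> arctan s" using s by (intro arctan_ge) auto
    finally show ?thesis by (simp add: us)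
  next
    case False
    have "u * (1 + xi) \<le> (xi / 4) * 2" using u xi by (intro mult_mono) auto
    also have "\<dots> \<le> xi / (1 + xi^2)"
    proof -
      have "xi^2 \<le> 1" using xi by (simp add: power_le_one)
      then have "xi / 2 \<le> xi / (1 + xi^2)" using xi by (intro divide_left_mono) (auto intro!: add_pos_nonneg)
      then show ?thesis by simp
    qed
    also have "\<dots> \<le> arctan xi" using xi by (intro arctan_ge) auto
    also have "\<dots> \<le> arctan s" using False by (simp add: arctan_le_iff)
    finally show ?thesis .
  qed
  then show ?thesis by (simp only: lhs s_eq)
qed

context genus2 begin

lemma Im_t:
  assumes "Im z > 0"
  shows "Im (t k z) = Im (Ln (1 + z / of_real (lam k))) - Im z / lam k + Re z * Im z / lam k ^ 2"
proof -
  have "z^2 / (2 * of_real (lam k)^2) = z^2 / of_real (2 * lam k ^ 2)" by simp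
  then have "Im (z^2 / (2 * of_real (lam k)^2)) = Re z * Im z / lam k ^ 2"
    by (simp only: Im_divide_of_real) (simp add: power2_eq_square)
  then show ?thesis by (simp add: t_def)
qed

lemma Im_t_ge:
  assumes z: "Im z > 0" "Re z < 0" "Im z \<le> - Re z / 4"
  shows "- Re z < lam k \<Longrightarrow> Im (t k z) \<ge> 0"
    and "lam k \<le> - Re z \<Longrightarrow> Im (t k z) \<ge> pi / 2 - Im z / lam k - (- Re z * Im z) / lam k ^ 2"
proof -
  define v where "v = 1 + z / of_real (lam k)"
  have Rev: "Re v = 1 + Re z / lam k" and Imv: "Im v = Im z / lam k" by (auto simp: v_def)
  have Imp: "Im v > 0" using z by (simp add: Imv)
  have v0: "v \<noteq> 0" using Imp by auto
  show "Im (t k z) \<ge> 0" if k: "- Re z < lam k"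
  proof -
    have "Re v > 0" using k lam_pos[of k] by (simp add: Rev field_simps)
    then have "Im (Ln v) = arctan (Im v / Re v)" using arg_conv_arctan[of v] Arg_eq_Im_Ln[OF v0] by simp
    also have "Im v / Re v = Im z / (lam k - (- Re z))"
    proof -
      have "Re v = (lam k - (- Re z)) / lam k" using lam_pos[of k] by (simp add: Rev field_simps)
      then show ?thesis using lam_pos[of k] by (simp add: Imv)
    qed
    also have "arctan \<dots> \<ge> Im z / lam k + (- Re z) * Im z / lam k ^ 2"
      using arctan_shift_ge[of "- Re z" "lam k" "Im z"] z k by simp
    finally show ?thesis using Im_t[OF z(1)] by (simp add: v_def)
  qed
  show "Im (t k z) \<ge> pi / 2 - Im z / lam k - (- Re z * Im z) / lam k ^ 2" if k: "lam k \<le> - Re z"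
  proof -
    have "\<not> 0 < Re v" using k lam_pos[of k] by (simp add: Rev field_simps)
    then have "\<not> \<bar>Im (Ln v)\<bar> < pi / 2" using Re_Ln_pos_lt[OF v0] by simp
    moreover have "0 < Im (Ln v)" using Im_Ln_pos_lt[OF v0] Imp by simp
    ultimately have "Im (Ln v) \<ge> pi / 2" by linarith
    then show ?thesis using Im_t[OF z(1)] by (simp add: v_def)
  qed
qed

lemma Im_T_sums: "Im z > 0 \<Longrightarrow> (\<lambda>k. Im (t k z)) sums Im (T z)"
  by (rule sums_Im[OF t_series(1)[OF upper_slit]])

lemma Im_L: "Im z > 0 \<Longrightarrow> Im (L z) = r * Im (Ln z) + 2 * a * Re z * Im z + b * Im z + Im (T z)"
  by (simp add: L_def power2_eq_square)

lemma Im_L_near_negative: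
  assumes x: "x < 0" and e: "e > 0"
  shows "\<forall>\<^sub>F z in at (of_real x) within {z. Im z > 0}. Im (L z) \<ge> r * pi - e"
proof -
  let ?F = "at (complex_of_real x) within {z. Im z > 0}"
  define A where "A = 1 / lam 0 + 2 * \<bar>x\<bar> / lam 0 ^ 2"
  have A: "A > 0" unfolding A_def by (intro add_pos_nonneg) auto
  have Re: "(Re \<longlongrightarrow> x) ?F" and Im: "(Im \<longlongrightarrow> 0) ?F"
    using tendsto_Re[OF tendsto_ident_at, of "complex_of_real x"] tendsto_Im[OF tendsto_ident_at, of "complex_of_real x"]
    by auto
  have "((\<lambda>z. r * (pi + Im (Ln (- z))) + 2 * a * Re z * Im z + b * Im z) \<longlongrightarrow> r * (pi + Im (Ln (- of_real x))) + 2 * a * x * 0 + b * 0) ?F"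
    using x by (intro tendsto_intros Re Im) auto
  moreover have "Im (Ln (- of_real x)) = 0"
    using x Ln_of_real[of "-x"] by simp
  ultimately have "((\<lambda>z. r * (pi + Im (Ln (- z))) + 2 * a * Re z * Im z + b * Im z) \<longlongrightarrow> r * pi) ?F" by simp
  then have 1: "\<forall>\<^sub>F z in ?F. r * (pi + Im (Ln (- z))) + 2 * a * Re z * Im z + b * Im z > r * pi - e"
    using e by (intro order_tendstoD) auto
  have 2: "\<forall>\<^sub>F z in ?F. Re z < x / 2" using x by (intro order_tendstoD(2)[OF Re]) auto
  have 3: "\<forall>\<^sub>F z in ?F. Re z > 2 * x" using x by (intro order_tendstoD(1)[OF Re]) auto
  have 4: "\<forall>\<^sub>F z in ?F. Im z < min (\<bar>x\<bar> / 8) (1 / A)" using x A by (intro order_tendstoD(2)[OF Im]) auto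
  have 5: "\<forall>\<^sub>F z in ?F. Im z > 0" by (simp add: eventually_at_filter)
  from 1 2 3 4 5 show ?thesis
  proof eventually_elim
    case (elim z)
    have z: "Im z > 0" "Re z < 0" "Im z \<le> - Re z / 4" using elim x by auto
    have "Im (t k z) \<ge> 0" for k
    proof (cases "- Re z < lam k")
      case False
      have l0: "lam 0 \<le> lam k" by (rule lam_mono) simp
      have "Im z / lam k + (- Re z * Im z) / lam k ^ 2 \<le> Im z / lam 0 + (2 * \<bar>x\<bar> * Im z) / lam 0 ^ 2"
        using elim x z l0 by (intro add_mono frac_le mult_mono power_mono mult_nonneg_nonneg) auto
      also have "\<dots> = Im z * A" by (simp add: A_def algebra_simps)
      also have "\<dots> \<le> 1" using elim(4) A by (simp add: field_simps)
      finally show ?thesis using Im_t_ge(2)[OF z, of k] False pi_ge_two by linarith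
    qed (use Im_t_ge(1)[OF z] in auto)
    then have "Im (T z) \<ge> 0" using sums_le[OF _ sums_zero Im_T_sums[OF z(1)]] by auto
    moreover have "Im (Ln z) = pi + Im (Ln (- z))"
      using Ln_minus[of z] z by (cases "z = 0") auto
    ultimately show ?case using elim(1) Im_L[OF z(1)] by simp
  qed
qed

lemma Im_L_far:
  assumes "C \<ge> 0"
  shows "\<exists>R>0. \<forall>z. Im z > 0 \<longrightarrow> Re z \<le> -R \<longrightarrow> Im z * (- Re z) \<le> C \<longrightarrow> Im (L z) \<ge> M"
proof -
  have "\<forall>\<^sub>F k in sequentially. lam k \<ge> max 1 (2 * C)"
    using lam_at_top unfolding filterlim_at_top by blast
  then obtain K where K: "\<And>k. k \<ge> K \<Longrightarrow> lam k \<ge> max 1 (2 * C)" by (auto simp: eventually_sequentially)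
  define D where "D = K * (2 * C / lam 0 ^ 2) + 2 * \<bar>a\<bar> * C + \<bar>b\<bar> * C"
  obtain N :: nat where N: "real N / 2 \<ge> M + D" using real_arch_simple[of "2 * (M + D)"] by (auto simp: field_simps)
  define R where "R = Max {1, 2 * (C + 1), lam (K + N)}"
  have R: "R \<ge> 1" "R \<ge> 2 * (C + 1)" "R \<ge> lam (K + N)" by (auto simp: R_def)
  have "Im (L z) \<ge> M" if z: "Im z > 0" "Re z \<le> -R" "Im z * (- Re z) \<le> C" for z
  proof -
    define X where "X = - Re z"
    have X: "X \<ge> R" "X > 0" "X \<ge> 1" using z R by (auto simp: X_def)
    have yX: "Im z * X \<le> C" using z by (simp add: X_def)
    have yC: "Im z \<le> C" 
      using mult_left_mono[OF X(3), of "Im z"] yX z(1) by linarith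
    have "4 * C \<le> X * X"
    proof -
      have "4 * C \<le> (2 * (C + 1)) * (2 * (C + 1))" using assms by (simp add: algebra_simps)
      also have "\<dots> \<le> X * X" using X R assms by (intro mult_mono) auto
      finally show ?thesis .
    qed
    then have "Im z * X * 4 \<le> X * X" using yX by simp
    then have z4: "Im z \<le> - Re z / 4" using X by (simp add: X_def[symmetric] field_simps)
    have zz: "Im z > 0" "Re z < 0" "Im z \<le> - Re z / 4" using z X z4 by (auto simp: X_def)
    have small: "Im (t k z) \<ge> pi / 2 - 2 * C / lam k ^ 2" if k: "lam k \<le> X" for k
    proof -
      have "Im z / lam k = (Im z * lam k) / lam k ^ 2" by (simp add: power2_eq_square)
      also have "\<dots> \<le> C / lam k ^ 2" 
      proof (rule divide_right_mono)
        show "Im z * lam k \<le> C" using mult_left_mono[OF k, of "Im z"] yX z(1) by linarith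
      qed simp
      finally have "Im z / lam k \<le> C / lam k ^ 2" .
      moreover have "- Re z * Im z / lam k ^ 2 \<le> C / lam k ^ 2"
        using yX by (intro divide_right_mono) (auto simp: X_def mult_ac)
      moreover have "2 * C / lam k ^ 2 = C / lam k ^ 2 + C / lam k ^ 2" by simp
      ultimately show ?thesis using Im_t_ge(2)[OF zz, of k] k by (simp add: X_def)
    qed
    have big: "2 * C / lam k ^ 2 \<le> 1" if k: "k \<ge> K" for k
    proof -
      have "2 * C \<le> lam k * 1" using K[OF k] by simp
      also have "\<dots> \<le> lam k * lam k" using K[OF k] by (intro mult_left_mono) auto
      finally show ?thesis by (simp add: power2_eq_square)
    qed
    have nn: "Im (t k z) \<ge> 0" if k: "k \<ge> K" for k
    proof (cases "lam k \<le> X")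
      case True
      then show ?thesis using small[OF True] big[OF k] pi_ge_two by linarith
    qed (use Im_t_ge(1)[OF zz, of k] in \<open>auto simp: X_def\<close>)
    have half: "Im (t k z) \<ge> 1/2" if k: "k \<ge> K" "k < K + N" for k
    proof -
      have lk: "lam k \<le> X" using lam_mono[of k "K + N"] k R(3) X(1) by linarith
      have "pi > 3" using pi_gt3 by simp
      then show ?thesis using small[OF lk] big[OF k(1)] by linarith
    qed
    have low: "Im (t k z) \<ge> - (2 * C / lam 0 ^ 2)" for k
    proof (cases "lam k \<le> X")
      case True
      have "2 * C / lam k ^ 2 \<le> 2 * C / lam 0 ^ 2"
        using assms lam_mono[of 0 k] by (intro divide_left_mono power_mono) auto
      then show ?thesis using small[OF True] pi_ge_two by linarith
    next
      case False
      then have "Im (t k z) \<ge> 0" using Im_t_ge(1)[OF zz, of k] by (simp add: X_def)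
      moreover have "2 * C / lam 0 ^ 2 \<ge> 0" using assms by simp
      ultimately show ?thesis by linarith
    qed
    have "(\<Sum>k<K+N. Im (t k z)) = (\<Sum>k<K. Im (t k z)) + (\<Sum>k=K..<K+N. Im (t k z))"
      using sum.atLeastLessThan_concat[of 0 K "K+N" "\<lambda>k. Im (t k z)"] by (simp add: lessThan_atLeast0)
    moreover have "(\<Sum>k<K. Im (t k z)) \<ge> (\<Sum>k<K. - (2 * C / lam 0 ^ 2))" by (intro sum_mono low)
    moreover have "(\<Sum>k=K..<K+N. Im (t k z)) \<ge> (\<Sum>k=K..<K+N. 1/2)" by (intro sum_mono half) auto
    moreover have "(\<Sum>k<K+N. Im (t k z)) \<le> Im (T z)"
      using Im_T_sums[OF z(1)] nn sum_le_suminf[of "\<lambda>k. Im (t k z)" "{..<K+N}"] by (auto simp: sums_iff)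
    ultimately have ImT: "Im (T z) \<ge> real N / 2 - K * (2 * C / lam 0 ^ 2)" by simp
    have "\<bar>2 * a * Re z * Im z\<bar> = 2 * \<bar>a\<bar> * (Im z * X)" using zz by (simp add: abs_mult X_def)
    also have "\<dots> \<le> 2 * \<bar>a\<bar> * C" using yX by (intro mult_left_mono) auto
    finally have 1: "2 * a * Re z * Im z \<ge> - (2 * \<bar>a\<bar> * C)" by linarith
    have "\<bar>b * Im z\<bar> \<le> \<bar>b\<bar> * C" using zz yC by (simp add: abs_mult mult_left_mono)
    then have 2: "b * Im z \<ge> - (\<bar>b\<bar> * C)" by linarith
    have "Im (Ln z) > 0" using Im_Ln_pos_lt[of z] zz by (cases "z = 0") auto
    then have 3: "r * Im (Ln z) \<ge> 0" by simp
    show "Im (L z) \<ge> M" using ImT 1 2 3 N unfolding Im_L[OF z(1)] D_def by linarith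
  qed
  then show ?thesis using R by (intro exI[of _ R]) auto
qed

lemma h_large:
  assumes "\<kappa> \<ge> 0"
  shows "\<exists>R>0. \<forall>z. Im z > 0 \<longrightarrow> Re z \<ge> - \<kappa> * Im z \<longrightarrow> norm z \<ge> R \<longrightarrow> norm (h z) \<ge> 1"
proof -
  obtain K where K: "(\<Sum>k<K. 1 / lam k ^ 2) \<ge> 4 * ((\<kappa> + 2) * (2 * \<bar>a\<bar> + \<bar>b\<bar> + r + 1))"
    using sum_lam2_unbounded by blast
  define R where "R = max 1 (lam K)"
  have "norm (h z) \<ge> 1" if z: "Im z > 0" "Re z \<ge> - \<kappa> * Im z" "norm z \<ge> R" for z
  proof -
    have z0: "z \<noteq> 0" and n1: "norm z \<ge> 1" using z by (auto simp: R_def)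
    define A where "A = dT z / z"
    have sA: "(\<lambda>k. dt k z / z) sums A"
      unfolding A_def by (intro sums_divide t_series(2) upper_slit z)
    have term_eq: "Re (dt k z / z) + (\<kappa> + 1) * Im (dt k z / z) \<ge> (if k < K then 1 / (4 * lam k ^ 2) else 0)" for k
    proof -
      define l where "l = lam k"
      have l: "l > 0" by (simp add: l_def)
      define n where "n = (Re z + l)^2 + (Im z)^2"
      have n: "n > 0" using z by (simp add: n_def sum_power2_gt_zero_iff)
      have nsq: "n = norm (z + of_real l) ^ 2" by (simp add: n_def cmod_power2)
      have zl: "z + of_real l \<noteq> 0" using z by (auto simp: complex_eq_iff)
      have "dt k z / z = z / (z + of_real l) / of_real (l^2)"
        using z0 zl l by (simp add: dt_def l_def power2_eq_square)
      moreover have "Re (z / (z + of_real l)) = (norm z ^ 2 + l * Re z) / n"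
        by (simp add: Re_divide n_def cmod_power2) (simp add: power2_eq_square algebra_simps)
      moreover have "Im (z / (z + of_real l)) = l * Im z / n"
        by (simp add: Im_divide n_def algebra_simps)
      ultimately have "Re (dt k z / z) + (\<kappa> + 1) * Im (dt k z / z) = 
          ((norm z ^ 2 + l * Re z) / n + (\<kappa> + 1) * (l * Im z / n)) / l^2"
        by (simp only: Re_divide_of_real Im_divide_of_real add_divide_distrib times_divide_eq_right)
      also have "\<dots> = (norm z ^ 2 + l * (Re z + (\<kappa> + 1) * Im z)) / n / l^2"
        by (simp only: add_divide_distrib[symmetric] times_divide_eq_right distrib_left mult_ac add_ac)
      also have "\<dots> \<ge> norm z ^ 2 / n / l^2"
      proof -
        have "Re z + (\<kappa> + 1) * Im z \<ge> 0" using z by (simp add: algebra_simps)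
        then show ?thesis using l n by (intro divide_right_mono) auto
      qed
      finally have ge: "norm z ^ 2 / n / l^2 \<le> Re (dt k z / z) + (\<kappa> + 1) * Im (dt k z / z)" .
      show ?thesis
      proof (cases "k < K")
        case True
        have "l \<le> norm z" using z(3) lam_mono[of k K] True by (simp add: R_def l_def)
        then have "norm (z + of_real l) \<le> 2 * norm z"
          using norm_triangle_ineq[of z "of_real l"] l by simp
        then have "n \<le> (2 * norm z)^2" unfolding nsq by (intro power_mono) auto
        then have "n \<le> 4 * norm z ^ 2" by (simp add: power_mult_distrib)
        then have "1 / 4 \<le> norm z ^ 2 / n" using n by (simp add: pos_le_divide_eq)
        then have "1 / 4 / l^2 \<le> norm z ^ 2 / n / l^2" by (intro divide_right_mono) auto
        then show ?thesis using ge True by (simp add: l_def)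
      next
        case False
        have "norm z ^ 2 / n / l^2 \<ge> 0" using n by simp
        then show ?thesis using ge False by simp
      qed
    qed
    have s: "(\<lambda>k. Re (dt k z / z) + (\<kappa> + 1) * Im (dt k z / z)) sums (Re A + (\<kappa> + 1) * Im A)"
      by (intro sums_add sums_mult sums_Re[OF sA] sums_Im[OF sA])
    have "(\<Sum>k<K. if k < K then 1 / (4 * lam k ^ 2) else 0) \<le> (\<Sum>k<K. Re (dt k z / z) + (\<kappa> + 1) * Im (dt k z / z))"
      by (intro sum_mono term_eq)
    also have "\<dots> \<le> Re A + (\<kappa> + 1) * Im A"
    proof -
      have "0 \<le> Re (dt k z / z) + (\<kappa> + 1) * Im (dt k z / z)" for k
        using term_eq[of k] by (rule order_trans[rotated]) simp
      then show ?thesis using s sum_le_suminf[OF sums_summable[OF s], of "{..<K}"] by (simp add: sums_iff)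
    qed
    also have "\<dots> \<le> norm A + (\<kappa> + 1) * norm A"
      using assms abs_Re_le_cmod[of A] abs_Im_le_cmod[of A] by (intro add_mono mult_left_mono) auto
    also have "\<dots> = (\<kappa> + 2) * norm A" by (simp add: algebra_simps)
    finally have 1: "(\<Sum>k<K. 1 / (4 * lam k ^ 2)) \<le> (\<kappa> + 2) * norm A" by simp
    have "(\<Sum>k<K. 1 / (4 * lam k ^ 2)) = (\<Sum>k<K. 1 / lam k ^ 2) / 4"
      by (simp add: sum_divide_distrib mult.commute)
    then have "(\<kappa> + 2) * (2 * \<bar>a\<bar> + \<bar>b\<bar> + r + 1) \<le> (\<kappa> + 2) * norm A" using 1 K by simp
    then have nA: "2 * \<bar>a\<bar> + \<bar>b\<bar> + r + 1 \<le> norm A" using assms by simp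
    have hz: "h z / z = A + (of_nat r / z^2 + 2 * of_real a + of_real b / z)"
      using z0 by (simp add: h_def A_def add_divide_distrib power2_eq_square)
    have "norm (of_nat r / z^2 + 2 * of_real a + of_real b / z) \<le> r + 2 * \<bar>a\<bar> + \<bar>b\<bar>"
    proof -
      have i: "norm z ^ 2 \<ge> 1" using n1 by (simp add: one_le_power)
      have "norm (of_nat r / z^2 + 2 * of_real a + of_real b / z) \<le> norm (of_nat r / z^2) + norm (2 * complex_of_real a) + norm (of_real b / z)"
        by (intro norm_triangle_le add_mono order_refl norm_triangle_ineq)
      moreover have "norm (of_nat r / z^2) \<le> r"
        using z0 divide_left_mono[OF i, of "real r"] by (simp add: norm_divide norm_power)
      moreover have "norm (of_real b / z) \<le> \<bar>b\<bar>"
        using z0 divide_left_mono[OF n1, of "\<bar>b\<bar>"] by (simp add: norm_divide)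
      ultimately show ?thesis by (simp add: norm_mult)
    qed
    then have "norm (h z / z) \<ge> 1" unfolding hz
      using nA norm_triangle_ineq4[of "A + (of_nat r / z^2 + 2 * of_real a + of_real b / z)" "of_nat r / z^2 + 2 * of_real a + of_real b / z"] by simp
    then have "norm (h z) \<ge> norm z" using z0 by (simp add: norm_divide pos_le_divide_eq)
    then show ?thesis using n1 by simp
  qed
  then show ?thesis by (intro exI[of _ R]) (auto simp: R_def)
qed

end

section \<open>The inverse in the upper half plane\<close>

definition UH :: "complex set" where "UH = {z. Im z > 0}"

lemma UH_iff [simp]: "z \<in> UH \<longleftrightarrow> Im z > 0" by (simp add: UH_def)

lemma open_UH: "open UH" and convex_UH: "convex UH"
  by (auto simp: UH_def open_halfspace_Im_gt convex_halfspace_Im_gt)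

abbreviation at_UH :: "real \<Rightarrow> complex filter" where
  "at_UH x \<equiv> at (complex_of_real x) within UH"

lemma at_UH_neq_bot: "at_UH x \<noteq> bot"
proof -
  have "complex_of_real x islimpt UH"
    unfolding islimpt_approachable
  proof (intro allI impI)
    fix e :: real assume "e > 0"
    then show "\<exists>w\<in>UH. w \<noteq> of_real x \<and> dist w (of_real x) < e"
      by (intro bexI[of _ "of_real x + \<i> * of_real (e/2)"]) (auto simp: dist_norm norm_mult complex_eq_iff)
  qed
  then show ?thesis by (simp add: trivial_limit_within)
qed

lemma eventually_at_UH:
  "eventually Q (at_UH x) \<longleftrightarrow> (\<exists>d>0. \<forall>w. Im w > 0 \<and> norm (w - of_real x) < d \<longrightarrow> Q w)"
proof -
  have "(w \<in> UH \<and> w \<noteq> of_real x \<and> dist w (of_real x) < d) \<longleftrightarrow> (Im w > 0 \<and> norm (w - of_real x) < d)" for w d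
    by (auto simp: dist_norm)
  then show ?thesis unfolding eventually_at by metis
qed

lemma cut_plane_iff: "w \<in> cut_plane c \<longleftrightarrow> Im w \<noteq> 0 \<or> Re w > c"
proof -
  have "w \<in> complex_of_real ` {..c} \<longleftrightarrow> Im w = 0 \<and> Re w \<le> c"
    by (auto simp: image_iff complex_eq_iff)
  then show ?thesis by (auto simp: cut_plane_def)
qed

lemma UH_subset_cut_plane: "UH \<subseteq> cut_plane c" by (auto simp: cut_plane_iff)

lemma open_cut_plane: "open (cut_plane c)"
proof -
  have "cut_plane c = {w. Im w < 0} \<union> {w. Im w > 0} \<union> {w. Re w > c}"
    by (auto simp: cut_plane_iff)
  then show ?thesis
    by (metis open_Un open_halfspace_Im_gt open_halfspace_Im_lt open_halfspace_Re_gt)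
qed

lemma connected_cut_plane: "connected (cut_plane c)"
proof (rule starlike_imp_connected)
  have "closed_segment (of_real (c + 1)) w \<subseteq> cut_plane c" if w: "w \<in> cut_plane c" for w
  proof
    fix z assume "z \<in> closed_segment (of_real (c + 1)) w"
    then obtain u where u: "0 \<le> u" "u \<le> 1" and z: "z = (1 - u) *\<^sub>R of_real (c + 1) + u *\<^sub>R w"
      by (auto simp: in_segment)
    show "z \<in> cut_plane c"
    proof (cases "Im w = 0")
      case False
      then show ?thesis using u by (cases "u = 0") (auto simp: cut_plane_iff z)
    next
      case True
      then have "Re w > c" using w by (auto simp: cut_plane_iff)
      then have "u * (Re w - c) \<ge> 0" using u by simp
      moreover have "u * (Re w - c) > 0 \<or> u = 0" using u \<open>Re w > c\<close> by auto
      moreover have "Re z - c = (1 - u) + u * (Re w - c)" by (simp add: z algebra_simps)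
      ultimately have "Re z > c" using u by (cases "u = 0") auto
      then show ?thesis by (simp add: cut_plane_iff)
    qed
  qed
  then show "starlike (cut_plane c)"
    unfolding starlike_def by (intro bexI[of _ "of_real (c+1)"]) (auto simp: cut_plane_iff)
qed

lemma of_real_ray_islimpt:
  assumes "c < x" shows "complex_of_real x islimpt (of_real ` {c<..})"
  unfolding islimpt_approachable
proof (intro allI impI)
  fix e :: real assume "e > 0"
  then show "\<exists>w\<in>complex_of_real ` {c<..}. w \<noteq> of_real x \<and> dist w (of_real x) < e"
    using assms by (intro bexI[of _ "of_real (x + e/2)"])
      (auto simp: dist_norm simp del: of_real_add simp flip: of_real_diff)
qed

locale pick_inverse = genus2_zeros +
  fixes p :: "complex \<Rightarrow> complex"
  assumes p_hol: "p holomorphic_on cut_plane m"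
    and Im_p_nonneg: "\<And>w. Im w > 0 \<Longrightarrow> Im (p w) \<ge> 0"
    and p_real: "\<And>y. y > m \<Longrightarrow> p (of_real y) = of_real (finv0 y)"
begin

lemma f_p: assumes "w \<in> cut_plane m" shows "f (p w) = w"
proof -
  have "(\<lambda>w. f (p w) - w) holomorphic_on cut_plane m"
    by (intro holomorphic_intros holomorphic_on_compose_gen[OF p_hol holomorphic_f[of UNIV], unfolded o_def]) auto
  moreover have "complex_of_real (m + 1) islimpt (of_real ` {m<..})" by (rule of_real_ray_islimpt) simp
  ultimately have "f (p w) - w = 0"
    by (intro analytic_continuation[OF _ open_cut_plane connected_cut_plane,
          of "\<lambda>w. f (p w) - w" m "complex_of_real ` {m<..}" "complex_of_real (m + 1)" w])
      (use assms in \<open>auto simp: cut_plane_iff p_real f_real finv0 be0 order_less_trans[OF be0 finv0(1)]\<close>)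
  then show ?thesis by simp
qed

lemma p_isCont: "w \<in> cut_plane m \<Longrightarrow> isCont p w"
  using p_hol open_cut_plane by (metis continuous_on_eq_continuous_at holomorphic_on_imp_continuous_on)

lemma Im_p_pos: assumes "Im w > 0" shows "Im (p w) > 0"
proof (rule ccontr)
  assume "\<not> ?thesis"
  then have 0: "Im (p w) = 0" using Im_p_nonneg[OF assms] by simp
  have "open (p ` UH)"
  proof (rule open_mapping_thm[OF _ open_UH _ open_UH])
    show "p holomorphic_on UH" using p_hol UH_subset_cut_plane holomorphic_on_subset by blast
    show "connected UH" by (rule convex_connected[OF convex_UH])
    show "\<not> p constant_on UH"
    proof
      assume "p constant_on UH"
      then have "p \<i> = p (2 * \<i>)" by (force simp: constant_on_def)
      then have "f (p \<i>) = f (p (2 * \<i>))" by simp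
      then show False using f_p[of \<i>] f_p[of "2 * \<i>"] by (simp add: cut_plane_iff)
    qed
  qed auto
  then obtain e where e: "e > 0" "ball (p w) e \<subseteq> p ` UH"
    using assms by (meson UH_iff image_eqI open_contains_ball)
  have "p w - \<i> * of_real (e/2) \<in> ball (p w) e" using e by (simp add: dist_norm norm_mult)
  then have "p w - \<i> * of_real (e/2) \<in> p ` UH" using e by blast
  then obtain v where "Im v > 0" "p w - \<i> * of_real (e/2) = p v" by auto
  then have "Im (p w - \<i> * of_real (e/2)) \<ge> 0" using Im_p_nonneg[of v] by simp
  then show False using 0 e by simp
qed

lemma p_slit: "Im w > 0 \<Longrightarrow> p w \<notin> \<real>\<^sub>\<le>\<^sub>0"
  by (simp add: Im_p_pos upper_slit)

lemma p_deriv: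
  assumes w: "Im w > 0"
  shows "(p has_field_derivative 1 / (w * h (p w))) (at w)" "h (p w) \<noteq> 0"
proof -
  have wc: "w \<in> cut_plane m" using w by (simp add: cut_plane_iff)
  obtain p' where p': "(p has_field_derivative p') (at w)"
    using p_hol open_cut_plane wc holomorphic_on_open by blast
  have fw: "f (p w) = w" by (rule f_p[OF wc])
  have "((\<lambda>w. f (p w)) has_field_derivative (f (p w) * h (p w)) * p') (at w)"
    by (rule DERIV_chain'[OF p' f_deriv[OF p_slit[OF w]]])
  then have "((\<lambda>w. w) has_field_derivative (w * h (p w)) * p') (at w)"
    using has_field_derivative_transform_within_open[of "\<lambda>w. f (p w)" _ w "cut_plane m" "\<lambda>w. w"] 
      open_cut_plane f_p wc fw by auto
  then have e: "(w * h (p w)) * p' = 1" using DERIV_unique DERIV_ident by blast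
  then show "h (p w) \<noteq> 0" by auto
  have "p' = 1 / (w * h (p w))" using e by (auto simp: divide_simps mult_ac)
  then show "(p has_field_derivative 1 / (w * h (p w))) (at w)" using p' by simp
qed

lemma p_lim_real: "y > m \<Longrightarrow> (p \<longlongrightarrow> of_real (finv0 y)) (at_UH y)"
  using p_isCont[of "of_real y"] p_real[of y]
  by (auto simp: cut_plane_iff isCont_def intro: tendsto_within_subset)

lemma L_p: assumes "Im w > 0" shows "L (p w) = Ln w"
proof -
  define E where "E = (\<lambda>w. L (p w) - Ln w)"
  have "(E has_field_derivative 0) (at w within UH)" if "w \<in> UH" for w
  proof -
    have w: "Im w > 0" using that by simp
    have "(E has_field_derivative h (p w) * (1 / (w * h (p w))) - 1 / w) (at w)"
      unfolding E_def using w upper_slit[OF w]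
      by (intro DERIV_diff DERIV_chain'[OF p_deriv(1) L_deriv] p_slit)
         (auto intro!: derivative_eq_intros simp: inverse_eq_divide)
    moreover have "h (p w) * (1 / (w * h (p w))) - 1 / w = 0" using p_deriv(2)[OF w] by simp
    ultimately show ?thesis by (metis has_field_derivative_at_within)
  qed
  then obtain c where c: "\<And>w. w \<in> UH \<Longrightarrow> E w = c"
    using has_field_derivative_zero_constant[OF convex_UH] by metis
  define y where "y = m + 1"
  have y: "y > m" "y > 0" using m_pos by (auto simp: y_def)
  define x where "x = finv0 y"
  have x: "x > 0" "fr x = y" using finv0[OF y(1)] be0 by (auto simp: x_def)
  have "isCont L (of_real x)" using L_deriv[of "of_real x"] x(1) DERIV_isCont by auto
  then have "((\<lambda>w. L (p w)) \<longlongrightarrow> L (of_real x)) (at_UH y)"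
    using p_lim_real[OF y(1)] unfolding x_def by (rule isCont_tendsto_compose)
  moreover have "(Ln \<longlongrightarrow> Ln (of_real y)) (at_UH y)"
    using y by (intro tendsto_Ln tendsto_ident_at) auto
  ultimately have "(E \<longlongrightarrow> L (of_real x) - Ln (of_real y)) (at_UH y)"
    unfolding E_def by (rule tendsto_diff)
  moreover have "(E \<longlongrightarrow> c) (at_UH y)"
    by (rule tendsto_eventually) (auto simp: c eventually_at_UH intro!: exI[of _ 1])
  ultimately have "c = L (of_real x) - Ln (of_real y)"
    using tendsto_unique[OF at_UH_neq_bot] by blast
  moreover have "L (of_real x) = of_real (ln y)"
  proof -
    obtain l where l: "L (of_real x) = of_real l" using L_real[OF x(1)] by (auto elim: Reals_cases)
    have "of_real (exp l) = complex_of_real y"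
      using exp_L[of "of_real x"] x f_real[OF x(1)] by (simp add: l exp_of_real)
    then have "exp l = y" by (simp only: of_real_eq_iff)
    then show ?thesis using l by auto
  qed
  ultimately have "c = 0" using y by (simp add: Ln_of_real)
  then show ?thesis using c[of w] assms by (simp add: E_def)
qed

definition Phi :: "complex \<Rightarrow> complex" where
  "Phi z = z^2 / 2 - of_real (\<alpha> + \<beta>) * z + of_real (\<alpha> * \<beta>) * Ln z"

lemma Phi_deriv:
  assumes "z \<notin> \<real>\<^sub>\<le>\<^sub>0"
  shows "(Phi has_field_derivative (z - of_real \<alpha>) * (z - of_real \<beta>) / z) (at z)"
proof -
  have z: "z \<noteq> 0" using assms by auto
  have "(Phi has_field_derivative z - of_real (\<alpha> + \<beta>) + of_real (\<alpha> * \<beta>) * (1 / z)) (at z)"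
    unfolding Phi_def[abs_def] using assms
    by (auto intro!: derivative_eq_intros simp: inverse_eq_divide)
  also have "z - of_real (\<alpha> + \<beta>) + of_real (\<alpha> * \<beta>) * (1 / z) = (z - of_real \<alpha>) * (z - of_real \<beta>) / z"
    using z by (simp add: field_simps)
  finally show ?thesis .
qed

lemma Im_Phi: "Im (Phi z) = Im z * (Re z - \<alpha> - \<beta>) + \<alpha> * \<beta> * Im (Ln z)"
  by (simp add: Phi_def power2_eq_square algebra_simps)

lemma Im_Phi_real: "x > 0 \<Longrightarrow> Im (Phi (of_real x)) = 0"
  by (simp add: Im_Phi Ln_of_real)

lemma Phi_h_P:
  assumes "Im z > 0" "h z \<noteq> 0"
  shows "(z - of_real \<alpha>) * (z - of_real \<beta>) / z * (1 / h z) = 1 / P z"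
proof -
  have "z \<noteq> 0" "z \<noteq> of_real \<alpha>" "z \<noteq> of_real \<beta>" using assms by auto
  then show ?thesis using assms by (simp add: P_def)
qed

lemma Im_inverse_P: assumes "Im z > 0" shows "Im (1 / P z) < 0"
proof -
  have "Im (P z) > 0" by (rule Im_P_pos[OF assms])
  moreover from this have "(Re (P z))\<^sup>2 + (Im (P z))\<^sup>2 > 0" by (simp add: sum_power2_gt_zero_iff)
  ultimately show ?thesis by (simp add: Im_divide divide_neg_pos)
qed

lemma ray_decreasing:
  assumes u: "Im u > 0" and s: "0 < s1" "s1 < s2"
  shows "Im (Phi (p (of_real s2 * u))) < Im (Phi (p (of_real s1 * u)))"
proof (rule DERIV_neg_imp_decreasing[OF s(2)])
  fix s assume "s1 \<le> s" "s \<le> s2"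
  then have s0: "s > 0" using s by simp
  define w where "w = of_real s * u"
  have w: "Im w > 0" using s0 u by (simp add: w_def)
  define z where "z = p w"
  have z: "Im z > 0" using Im_p_pos[OF w] by (simp add: z_def)
  have u0: "u \<noteq> 0" using u by auto
  have "((\<lambda>v. Phi (p v)) has_field_derivative (z - of_real \<alpha>) * (z - of_real \<beta>) / z * (1 / (w * h z))) (at w)"
    unfolding z_def by (rule DERIV_chain'[OF p_deriv(1)[OF w] Phi_deriv[OF p_slit[OF w]]])
  moreover have "(z - of_real \<alpha>) * (z - of_real \<beta>) / z * (1 / (w * h z)) = (1 / P z) / w"
  proof -
    have *: "x * (1 / (w * h z)) = (x * (1 / h z)) / w" for x by simp
    have "h z \<noteq> 0" using p_deriv(2)[OF w] by (simp add: z_def)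
    then show ?thesis unfolding * using Phi_h_P[OF z] by simp
  qed
  ultimately have "((\<lambda>v. Phi (p v)) has_field_derivative (1 / P z) / w) (at (of_real s * u))"
    by (simp add: w_def)
  then have "((\<lambda>v. Phi (p (v * u))) has_field_derivative (1 / P z) / w * u) (at (of_real s))"
    by (rule DERIV_chain'[where f="\<lambda>v. v * u" and D=u, rotated]) (auto intro!: derivative_eq_intros)
  also have "(1 / P z) / w * u = (1 / P z) / of_real s" using u0 by (simp add: w_def)
  finally have "((\<lambda>s. Phi (p (of_real s * u))) has_vector_derivative (1 / P z) / of_real s) (at s)"
    by (rule has_vector_derivative_real_field)
  then have "((\<lambda>s. Im (Phi (p (of_real s * u)))) has_vector_derivative Im ((1 / P z) / of_real s)) (at s)"
    by (rule bounded_linear.has_vector_derivative[OF bounded_linear_Im])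
  then have "((\<lambda>s. Im (Phi (p (of_real s * u)))) has_real_derivative Im (1 / P z) / s) (at s)"
    by (simp only: has_real_derivative_iff_has_vector_derivative Im_divide_of_real)
  moreover have "Im (1 / P z) / s < 0" using Im_inverse_P[OF z] s0 by (simp only: divide_neg_pos)
  ultimately show "\<exists>y. ((\<lambda>s. Im (Phi (p (of_real s * u)))) has_real_derivative y) (at s) \<and> y < 0"
    by blast
qed

end

section \<open>Boundary values of the inverse\<close>

context pick_inverse begin

lemma p_limit_f:
  assumes "(p \<longlongrightarrow> z) (at_UH x)" shows "f z = of_real x"
proof -
  have "((\<lambda>w. f (p w)) \<longlongrightarrow> f z) (at_UH x)"
    using isCont_f assms by (rule isCont_tendsto_compose)
  moreover have "((\<lambda>w. f (p w)) \<longlongrightarrow> of_real x) (at_UH x)"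
    by (rule Lim_transform_eventually[OF tendsto_ident_at])
       (auto simp: eventually_at_UH f_p cut_plane_iff intro!: exI[of _ 1])
  ultimately show ?thesis using tendsto_unique[OF at_UH_neq_bot] by blast
qed

lemma p_limit_Im:
  assumes "(p \<longlongrightarrow> z) (at_UH x)" shows "Im z \<ge> 0"
proof (rule tendsto_lowerbound[OF tendsto_Im[OF assms] _ at_UH_neq_bot])
  show "\<forall>\<^sub>F w in at_UH x. 0 \<le> Im (p w)"
    using Im_p_nonneg by (auto simp: eventually_at_UH intro!: exI[of _ 1])
qed

lemma connected_half_disc: "connected (UH \<inter> ball (of_real x) d)"
  by (intro convex_connected convex_Int convex_UH convex_ball)

lemma p_cluster_limit:
  assumes cl: "\<And>\<rho> d. \<rho> > 0 \<Longrightarrow> d > 0 \<Longrightarrow> \<exists>w. Im w > 0 \<and> norm (w - of_real x) < d \<and> norm (p w - z) < \<rho>"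
  shows "(p \<longlongrightarrow> z) (at_UH x)"
proof -
  have fz: "f z = of_real x"
  proof (rule ccontr)
    assume "f z \<noteq> of_real x"
    define e where "e = norm (f z - of_real x)"
    have e: "e > 0" using \<open>f z \<noteq> of_real x\<close> by (simp add: e_def)
    obtain d where d: "d > 0" "\<And>v. norm (v - z) < d \<Longrightarrow> norm (f v - f z) < e/2"
      using isCont_f[of z] e unfolding continuous_at_eps_delta dist_norm by (metis half_gt_zero)
    obtain w where w: "Im w > 0" "norm (w - of_real x) < e/2" "norm (p w - z) < d"
      using cl[of d "e/2"] d e by auto
    have "norm (f (p w) - f z) < e/2" using d w by blast
    then have "norm (w - f z) < e/2" using f_p[of w] w by (simp add: cut_plane_iff)
    then have "e < e/2 + e/2"
      using w(2) norm_triangle_ineq[of "f z - w" "w - of_real x"] by (simp add: e_def norm_minus_commute)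
    then show False by simp
  qed
  show ?thesis
  proof (rule tendstoI)
    fix e :: real assume e: "e > 0"
    obtain \<rho>0 where r0: "\<rho>0 > 0" "\<And>v. v \<in> ball z \<rho>0 - {z} \<Longrightarrow> f v - of_real x \<noteq> 0"
    proof -
      have "f 0 - of_real x \<noteq> 0 \<or> f 1 - of_real x \<noteq> 0"
        using f_real(1)[of 1] f_real(2)[of 1] by auto
      then obtain b0 where "f b0 - of_real x \<noteq> 0" by blast
      moreover have "(\<lambda>v. f v - of_real x) holomorphic_on UNIV"
        by (intro holomorphic_intros holomorphic_f)
      ultimately obtain r where "0 < r" "\<And>v. v \<in> ball z r - {z} \<Longrightarrow> f v - of_real x \<noteq> 0"
        by - (rule isolated_zeros[of "\<lambda>v. f v - of_real x" UNIV z b0]; use fz in auto)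
      then show ?thesis by (rule that)
    qed
    define \<rho> where "\<rho> = min e \<rho>0 / 2"
    have r: "0 < \<rho>" "\<rho> < e" "\<rho> < \<rho>0" using e r0 by (auto simp: \<rho>_def)
    have ne: "f v \<noteq> of_real x" if "v \<in> sphere z \<rho>" for v
      using r0(2)[of v] that r by (auto simp: dist_commute)
    have "\<exists>s\<in>sphere z \<rho>. \<forall>v\<in>sphere z \<rho>. norm (f s - of_real x) \<le> norm (f v - of_real x)"
      using r by (intro continuous_attains_inf continuous_intros continuous_on_f) auto
    then obtain s where s: "s \<in> sphere z \<rho>" "\<And>v. v \<in> sphere z \<rho> \<Longrightarrow> norm (f s - of_real x) \<le> norm (f v - of_real x)"
      by blast
    define d where "d = norm (f s - of_real x)"
    have d: "d > 0" using ne[OF s(1)] by (simp add: d_def)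
    have conn: "connected (p ` (UH \<inter> ball (of_real x) d))"
      by (intro connected_continuous_image connected_half_disc holomorphic_on_imp_continuous_on
            holomorphic_on_subset[OF p_hol]) (use UH_subset_cut_plane in auto)
    obtain w0 where w0: "Im w0 > 0" "norm (w0 - of_real x) < d" "norm (p w0 - z) < \<rho>"
      using cl[OF r(1) d] by auto
    have sub: "p ` (UH \<inter> ball (of_real x) d) \<subseteq> ball z \<rho>"
    proof (rule ccontr)
      assume "\<not> ?thesis"
      moreover have "p w0 \<in> p ` (UH \<inter> ball (of_real x) d) \<inter> ball z \<rho>"
        using w0 by (auto simp: dist_norm norm_minus_commute)
      ultimately have "p ` (UH \<inter> ball (of_real x) d) \<inter> frontier (ball z \<rho>) \<noteq> {}"
        by (intro connected_Int_frontier[OF conn]) auto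
      then obtain w where "w \<in> UH \<inter> ball (of_real x) d" "p w \<in> frontier (ball z \<rho>)"
        by blast
      then have w: "Im w > 0" "norm (w - of_real x) < d" "p w \<in> sphere z \<rho>"
        using frontier_ball[OF r(1), of z] by (auto simp: dist_norm norm_minus_commute)
      have "d \<le> norm (f (p w) - of_real x)" using s(2)[OF w(3)] by (simp add: d_def)
      then show False using w f_p[of w] by (simp add: cut_plane_iff)
    qed
    show "\<forall>\<^sub>F w in at_UH x. dist (p w) z < e"
      unfolding eventually_at_UH
    proof (intro exI[of _ d] conjI allI impI)
      fix w assume "0 < Im w \<and> norm (w - of_real x) < d"
      then have "w \<in> UH \<inter> ball (of_real x) d" by (simp add: dist_norm norm_minus_commute)
      then have "p w \<in> ball z \<rho>" using sub by blast
      then show "dist (p w) z < e" using r by (simp add: dist_commute)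
    qed (rule d)
  qed
qed

lemma p_dichotomy:
  "filterlim p at_infinity (at_UH x) \<or> (\<exists>z. (p \<longlongrightarrow> z) (at_UH x))"
proof (rule disjCI)
  assume nl: "\<not> (\<exists>z. (p \<longlongrightarrow> z) (at_UH x))"
  show "filterlim p at_infinity (at_UH x)"
  proof (rule ccontr)
    assume "\<not> ?thesis"
    then obtain B where B: "\<not> (\<forall>\<^sub>F w in at_UH x. norm (p w) \<ge> B)"
      by (auto simp: filterlim_at_infinity[OF order_refl])
    have "\<exists>w. Im w > 0 \<and> norm (w - of_real x) < 1 / Suc n \<and> norm (p w) \<le> B" for n
      using B unfolding eventually_at_UH by (metis divide_pos_pos le_cases of_nat_0_less_iff zero_less_Suc zero_less_one)
    then obtain w where w: "\<And>n. Im (w n) > 0" "\<And>n. norm (w n - of_real x) < 1 / Suc n" "\<And>n. norm (p (w n)) \<le> B"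
      by metis
    have "\<forall>n. p (w n) \<in> cball 0 B" using w by auto
    then obtain z \<sigma> where z: "strict_mono \<sigma>" "((\<lambda>n. p (w n)) \<circ> \<sigma>) \<longlonglongrightarrow> z"
      using compact_cball[of "0::complex" B] unfolding compact_def by metis
    have "(p \<longlongrightarrow> z) (at_UH x)"
    proof (rule p_cluster_limit)
      fix \<rho> d :: real assume rd: "\<rho> > 0" "d > 0"
      have "\<forall>\<^sub>F n in sequentially. norm (p (w (\<sigma> n)) - z) < \<rho>"
        using tendstoD[OF z(2) rd(1)] by (simp add: dist_norm)
      moreover have "\<forall>\<^sub>F n in sequentially. 1 / Suc n < d"
        using order_tendstoD(2)[OF LIMSEQ_Suc[OF lim_1_over_n] rd(2)] by simp
      ultimately have "\<forall>\<^sub>F n in sequentially. norm (p (w (\<sigma> n)) - z) < \<rho> \<and> 1 / Suc n < d"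
        by (rule eventually_conj)
      then obtain n where n: "norm (p (w (\<sigma> n)) - z) < \<rho>" "1 / Suc n < d"
        by (auto simp: eventually_sequentially)
      have "1 / real (Suc (\<sigma> n)) \<le> 1 / Suc n"
        using seq_suble[OF z(1), of n] by (intro divide_left_mono) auto
      then have "norm (w (\<sigma> n) - of_real x) < d" using w(2)[of "\<sigma> n"] n(2) by linarith
      then show "\<exists>w. Im w > 0 \<and> norm (w - of_real x) < d \<and> norm (p w - z) < \<rho>"
        using w(1) n(1) by blast
    qed
    then show False using nl by blast
  qed
qed

lemma p_lim_m: "(p \<longlongrightarrow> of_real \<beta>) (at_UH m)"
proof (rule p_cluster_limit)
  fix \<rho> d :: real assume rd: "\<rho> > 0" "d > 0"
  have "isCont fr \<beta>" using fr_deriv[OF be0] DERIV_isCont by blast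
  then obtain e where e: "e > 0" "\<And>x. \<bar>x - \<beta>\<bar> < e \<Longrightarrow> \<bar>fr x - m\<bar> < d/2"
    using rd unfolding continuous_at_eps_delta dist_real_def m_def by (metis half_gt_zero)
  define x where "x = \<beta> + min e \<rho> / 2"
  have x: "x > \<beta>" "\<bar>x - \<beta>\<bar> < e" "\<bar>x - \<beta>\<bar> < \<rho>" using e rd by (auto simp: x_def)
  define y where "y = fr x"
  have y: "y > m" "\<bar>y - m\<bar> < d/2" 
    using fr_strict_mono[of \<beta> x] x(1) e(2)[OF x(2)] by (auto simp: y_def m_def)
  have "(p \<longlongrightarrow> of_real x) (at_UH y)" using p_lim_real[OF y(1)] finv0_fr[OF x(1)] by (simp add: y_def)
  then have "\<forall>\<^sub>F w in at_UH y. dist (p w) (of_real x) < \<rho> - \<bar>x - \<beta>\<bar>"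
    using x by (intro tendstoD) auto
  then obtain d' where d': "d' > 0" "\<And>w. Im w > 0 \<Longrightarrow> norm (w - of_real y) < d' \<Longrightarrow> dist (p w) (of_real x) < \<rho> - \<bar>x - \<beta>\<bar>"
    unfolding eventually_at_UH by blast
  define w where "w = of_real y + \<i> * of_real (min d' d / 2)"
  have w: "Im w > 0" "norm (w - of_real y) < d'" "norm (w - of_real y) \<le> d / 2" using d' rd by (auto simp: w_def norm_mult)
  have "norm (w - of_real m) \<le> norm (w - of_real y) + norm (of_real y - complex_of_real m)"
    using norm_triangle_ineq[of "w - of_real y" "of_real y - of_real m"] by simp
  also have "norm (of_real y - complex_of_real m) = \<bar>y - m\<bar>" by (metis norm_of_real of_real_diff)
  finally have "norm (w - of_real m) < d" using w y by linarith
  moreover have "norm (p w - of_real \<beta>) < \<rho>"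
  proof -
    have "norm (p w - of_real \<beta>) \<le> norm (p w - of_real x) + norm (of_real x - complex_of_real \<beta>)"
      using norm_triangle_ineq[of "p w - of_real x" "of_real x - of_real \<beta>"] by simp
    also have "norm (of_real x - complex_of_real \<beta>) = \<bar>x - \<beta>\<bar>" by (metis norm_of_real of_real_diff)
    finally show ?thesis using d'(2)[OF w(1,2)] by (simp add: dist_norm)
  qed
  ultimately show "\<exists>w. Im w > 0 \<and> norm (w - of_real m) < d \<and> norm (p w - of_real \<beta>) < \<rho>"
    using w(1) by blast
qed

lemma p_limit_negative:
  assumes lim: "(p \<longlongrightarrow> of_real z) (at_UH x)" and z: "z < 0"
  shows "x < 0 \<and> r = 1"
proof -
  have fl: "filterlim p (at_UH z) (at_UH x)"
    unfolding filterlim_at using lim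
    by (auto simp: eventually_at_UH Im_p_pos intro!: exI[of _ 1]) (metis Im_complex_of_real Im_p_pos less_irrefl)
  have ev: "\<forall>\<^sub>F w in at_UH x. Im (Ln w) \<ge> r * pi - e" if "e > 0" for e
  proof -
    have "\<forall>\<^sub>F v in at_UH z. r * pi - e \<le> Im (L v)"
      using Im_L_near_negative[OF z that] by (simp add: UH_def)
    then have "\<forall>\<^sub>F w in at_UH x. r * pi - e \<le> Im (L (p w))"
      using fl by (rule eventually_compose_filterlim)
    then show ?thesis unfolding eventually_at_UH by (metis L_p)
  qed
  have r1: "1 * pi \<le> r * pi" using r_pos by (intro mult_right_mono) auto
  have "x < 0"
  proof (rule ccontr)
    assume "\<not> x < 0"
    obtain d where d: "d > 0" "\<And>w. Im w > 0 \<Longrightarrow> norm (w - of_real x) < d \<Longrightarrow> Im (Ln w) \<ge> r * pi - 1"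
      using ev[of 1] unfolding eventually_at_UH by auto
    define w where "w = of_real x + \<i> * of_real (d/2)"
    have w: "Im w > 0" "norm (w - of_real x) < d" "Re w \<ge> 0" "w \<noteq> 0"
      using d \<open>\<not> x < 0\<close> by (auto simp: w_def norm_mult complex_eq_iff)
    have "\<bar>Im (Ln w)\<bar> \<le> pi/2" using Re_Ln_pos_le[OF w(4)] w(3) by simp
    then show False using d(2)[OF w(1,2)] r1 pi_gt3 by linarith
  qed
  moreover have "r = 1"
  proof (rule ccontr)
    assume "r \<noteq> 1"
    then have r2: "2 * pi \<le> r * pi" using r_pos by (intro mult_right_mono) auto
    obtain d where d: "d > 0" "\<And>w. Im w > 0 \<Longrightarrow> norm (w - of_real x) < d \<Longrightarrow> Im (Ln w) \<ge> r * pi - 1"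
      using ev[of 1] unfolding eventually_at_UH by auto
    define w where "w = of_real x + \<i> * of_real (d/2)"
    have w: "Im w > 0" "norm (w - of_real x) < d" "w \<noteq> 0"
      using d by (auto simp: w_def norm_mult complex_eq_iff)
    have "Im (Ln w) \<le> pi" using Im_Ln_le_pi[OF w(3)] .
    then show False using d(2)[OF w(1,2)] r2 pi_gt3 by linarith
  qed
  ultimately show ?thesis by blast
qed

lemma p_not_infinite_interval:
  assumes "x1 < x2"
  shows "\<exists>x. x1 < x \<and> x < x2 \<and> (\<exists>z. (p \<longlongrightarrow> z) (at_UH x))"
proof (rule ccontr)
  assume "\<not> ?thesis"
  then have inf: "filterlim p at_infinity (at_UH x)" if "x1 < x" "x < x2" for x
    using p_dichotomy that by blast
  define c where "c = complex_of_real ((x1 + x2) / 2)"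
  define R where "R = (x2 - x1) / 2"
  have R: "R > 0" using assms by (simp add: R_def)
  define S where "S = ball c R"
  have re: "x1 < Re w \<and> Re w < x2" if "w \<in> S" for w
  proof -
    have "\<bar>Re (w - c)\<bar> < R" using that abs_Re_le_cmod[of "w - c"] 
      by (auto simp: S_def dist_norm norm_minus_commute)
    then show ?thesis by (auto simp: c_def R_def field_simps abs_less_iff)
  qed
  define g where "g = (\<lambda>w. if Im w > 0 then 1 / p w else 0)"
  have p0: "p w \<noteq> 0" if "Im w > 0" for w using Im_p_pos[OF that] by auto
  have hol1: "g holomorphic_on UH"
  proof -
    have "(\<lambda>w. 1 / p w) holomorphic_on UH"
      by (intro holomorphic_intros holomorphic_on_subset[OF p_hol]) (use UH_subset_cut_plane p0 in auto)
    then show ?thesis by (rule holomorphic_transform) (simp add: g_def)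
  qed
  have hol2: "g holomorphic_on {w. Im w < 0}"
    by (rule holomorphic_transform[of "\<lambda>_. 0"]) (auto simp: g_def)
  have cont: "continuous_on S g"
  proof -
    have "isCont g w" if w: "w \<in> S" for w
    proof (cases "Im w" "0::real" rule: linorder_cases)
      case less
      then show ?thesis
        using holomorphic_on_imp_continuous_on[OF hol2] open_halfspace_Im_lt[of 0]
        by (auto simp: continuous_on_eq_continuous_at)
    next
      case greater
      then show ?thesis
        using holomorphic_on_imp_continuous_on[OF hol1] open_UH
        by (auto simp: continuous_on_eq_continuous_at)
    next
      case equal
      define x where "x = Re w"
      have wx: "w = of_real x" using equal by (simp add: x_def complex_eq_iff)
      have "filterlim p at_infinity (at_UH x)" using inf re[OF w] by (simp add: x_def)
      then have "((\<lambda>w. inverse (p w)) \<longlongrightarrow> 0) (at_UH x)"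
        by (rule filterlim_compose[OF tendsto_inverse_0])
      show ?thesis unfolding continuous_at_eps_delta
      proof (intro allI impI)
        fix e :: real assume "e > 0"
        then obtain d where d: "d > 0" "\<And>v. Im v > 0 \<Longrightarrow> norm (v - of_real x) < d \<Longrightarrow> norm (inverse (p v)) < e"
          using tendstoD[OF \<open>((\<lambda>w. inverse (p w)) \<longlongrightarrow> 0) (at_UH x)\<close>, of e]
          by (auto simp: eventually_at_UH)
        show "\<exists>d>0. \<forall>v. dist v w < d \<longrightarrow> dist (g v) (g w) < e"
          using d \<open>e > 0\<close> equal by (intro exI[of _ d]) (auto simp: g_def wx dist_norm inverse_eq_divide)
      qed
    qed
    then show ?thesis by (simp add: continuous_at_imp_continuous_on)
  qed
  have "g holomorphic_on S"
  proof (rule holomorphic_on_paste_across_line[where d = \<i> and k = 0])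
    have "\<i> \<bullet> z = Im z" for z by (simp add: inner_complex_def)
    then show "g holomorphic_on S \<inter> {z. \<i> \<bullet> z < 0}" "g holomorphic_on S \<inter> {z. 0 < \<i> \<bullet> z}"
      using holomorphic_on_subset[OF hol1] holomorphic_on_subset[OF hol2] by (auto simp: UH_def)
  qed (use cont in \<open>auto simp: S_def\<close>)
  moreover have "c - \<i> * of_real (R/2) islimpt (S \<inter> {w. Im w < 0})"
  proof (rule interior_limit_point)
    have "open (S \<inter> {w. Im w < 0})" by (simp add: S_def open_Int open_halfspace_Im_lt)
    moreover have "norm (\<i> * of_real (R/2)) < R" using R by (simp only: norm_mult norm_of_real) simp
    then have "c - \<i> * of_real (R/2) \<in> S" by (simp add: S_def dist_norm)
    moreover have "Im (c - \<i> * of_real (R/2)) < 0" using R by (simp add: c_def)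
    ultimately show "c - \<i> * of_real (R/2) \<in> interior (S \<inter> {w. Im w < 0})"
      by (simp only: interior_open) blast
  qed
  moreover have pt: "c + \<i> * of_real (R/2) \<in> S" "c - \<i> * of_real (R/2) \<in> S"
  proof -
    have "norm (\<i> * of_real (R/2)) < R" using R by (simp only: norm_mult norm_of_real) simp
    then show "c + \<i> * of_real (R/2) \<in> S" "c - \<i> * of_real (R/2) \<in> S" by (simp_all add: S_def dist_norm)
  qed
  moreover have "g w = 0" if "w \<in> S \<inter> {w. Im w < 0}" for w using that by (simp add: g_def)
  moreover have "open S" "connected S" by (auto simp: S_def)
  ultimately have "g (c + \<i> * of_real (R/2)) = 0"
    by - (rule analytic_continuation[of g S "S \<inter> {w. Im w < 0}" "c - \<i> * of_real (R/2)"]; blast)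
  moreover have "Im (c + \<i> * of_real (R/2)) > 0" using R by (simp add: c_def)
  ultimately show False using p0 by (auto simp: g_def split: if_splits)
qed

end

lemma boundary_limit_continuous_on:
  assumes lim: "\<And>s. s \<in> S \<Longrightarrow> (p \<longlongrightarrow> k s) (at_UH s)"
  shows "continuous_on S (k :: real \<Rightarrow> complex)"
  unfolding continuous_on_iff
proof (intro ballI allI impI)
  fix s and e :: real assume s: "s \<in> S" and e: "e > 0"
  obtain d where d: "d > 0" "\<And>w. Im w > 0 \<Longrightarrow> norm (w - of_real s) < d \<Longrightarrow> dist (p w) (k s) < e/2"
    using tendstoD[OF lim[OF s], of "e/2"] e by (auto simp: eventually_at_UH)
  have "dist (k s') (k s) < e" if s': "s' \<in> S" "dist s' s < d" for s'
  proof -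
    have "\<forall>\<^sub>F w in at_UH s'. dist (p w) (k s) \<le> e/2"
      unfolding eventually_at_UH
    proof (intro exI[of _ "d - dist s' s"] conjI allI impI)
      fix w assume w: "0 < Im w \<and> norm (w - of_real s') < d - dist s' s"
      have "norm (w - of_real s) \<le> norm (w - of_real s') + norm (of_real s' - complex_of_real s)"
        using norm_triangle_ineq[of "w - of_real s'" "of_real s' - of_real s"] by simp
      also have "norm (of_real s' - complex_of_real s) = dist s' s"
        by (metis norm_of_real of_real_diff dist_real_def)
      finally show "dist (p w) (k s) \<le> e/2" using d(2)[of w] w by fastforce
    qed (use s' in simp)
    moreover have "((\<lambda>w. dist (p w) (k s)) \<longlongrightarrow> dist (k s') (k s)) (at_UH s')"
      by (intro tendsto_intros lim s')
    ultimately have "dist (k s') (k s) \<le> e/2"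
      using tendsto_upperbound at_UH_neq_bot by blast
    then show ?thesis using e by simp
  qed
  then show "\<exists>d>0. \<forall>x'\<in>S. dist x' s < d \<longrightarrow> dist (k x') (k s) < e" using d by blast
qed

lemma ray_filterlim:
  assumes "s > 0"
  shows "filterlim (\<lambda>\<tau>. of_real s * (of_real \<sigma> + \<i> * of_real \<tau>)) (at_UH (s * \<sigma>)) (at_right 0)"
  unfolding filterlim_at
proof
  have "((\<lambda>\<tau>. of_real s * (of_real \<sigma> + \<i> * of_real \<tau>)) \<longlongrightarrow> of_real s * (of_real \<sigma> + \<i> * of_real 0)) (at_right 0)"
    by (intro tendsto_intros)
  then show "((\<lambda>\<tau>. of_real s * (of_real \<sigma> + \<i> * of_real \<tau>)) \<longlongrightarrow> of_real (s * \<sigma>)) (at_right 0)" by simp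
  show "\<forall>\<^sub>F \<tau> in at_right 0. of_real s * (of_real \<sigma> + \<i> * of_real \<tau>) \<in> UH \<and>
     of_real s * (of_real \<sigma> + \<i> * of_real \<tau>) \<noteq> complex_of_real (s * \<sigma>)"
    using eventually_at_right_less[of 0] by eventually_elim (use assms in \<open>auto simp: complex_eq_iff\<close>)
qed

context pick_inverse begin

lemma h_nonzero: assumes "Im z > 0" shows "h z \<noteq> 0"
  using Im_P_pos[OF assms] by (auto simp: P_def)

lemma local_extension:
  assumes lim: "(p \<longlongrightarrow> z) (at_UH x)" and z: "Im z > 0"
  obtains e g where "e > 0" "g holomorphic_on ball (of_real x) e" "g (of_real x) = z"
    "\<And>w. w \<in> ball (of_real x) e \<Longrightarrow> Im w > 0 \<Longrightarrow> g w = p w"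
    "\<And>w. w \<in> ball (of_real x) e \<Longrightarrow> Im (g w) > 0 \<and> f (g w) = w"
    "\<And>s. \<bar>s - x\<bar> < e \<Longrightarrow> (p \<longlongrightarrow> g (of_real s)) (at_UH s)"
proof -
  have fz: "f z = of_real x" by (rule p_limit_f[OF lim])
  have "deriv f z = f z * h z" using f_deriv[OF upper_slit[OF z]] by (rule DERIV_imp_deriv)
  then have dz: "deriv f z \<noteq> 0" using f_nonzero[OF upper_slit[OF z]] h_nonzero[OF z] by simp
  have zU: "z \<in> UH" using z by simp
  obtain \<rho> where r: "\<rho> > 0" "ball z \<rho> \<subseteq> UH" "inj_on f (ball z \<rho>)"
    by (rule has_complex_derivative_locally_injective[OF holomorphic_f zU open_UH dz])
  obtain g where g: "g holomorphic_on (f ` ball z \<rho>)" "\<And>v. v \<in> ball z \<rho> \<Longrightarrow> g (f v) = v"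
    using holomorphic_has_inverse[OF holomorphic_f open_ball r(3)] by metis
  have "open (f ` ball z \<rho>)"
    by (rule open_mapping_thm3[OF holomorphic_f open_ball r(3)])
  moreover have "of_real x \<in> f ` ball z \<rho>" using r fz by (metis centre_in_ball image_eqI)
  ultimately obtain e1 where e1: "e1 > 0" "ball (of_real x) e1 \<subseteq> f ` ball z \<rho>"
    by (meson open_contains_ball)
  obtain e2 where e2: "e2 > 0" "\<And>w. Im w > 0 \<Longrightarrow> norm (w - of_real x) < e2 \<Longrightarrow> dist (p w) z < \<rho>"
    using tendstoD[OF lim r(1)] by (auto simp: eventually_at_UH)
  define e where "e = min e1 e2"
  have e: "e > 0" "ball (of_real x) e \<subseteq> f ` ball z \<rho>" using e1 e2 by (auto simp: e_def)
  have gp: "g w = p w" if "w \<in> ball (of_real x) e" "Im w > 0" for w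
  proof -
    have "p w \<in> ball z \<rho>" using e2(2)[of w] that by (simp add: e_def dist_commute dist_norm norm_minus_commute)
    then show ?thesis using g(2)[of "p w"] f_p[of w] that by (simp add: cut_plane_iff)
  qed
  have hol: "g holomorphic_on ball (of_real x) e" by (rule holomorphic_on_subset[OF g(1) e(2)])
  show thesis
  proof (rule that[of e g])
    show "g (of_real x) = z" using g(2)[of z] r fz by simp
    show "Im (g w) > 0 \<and> f (g w) = w" if wb: "w \<in> ball (of_real x) e" for w
    proof -
      obtain v where v: "v \<in> ball z \<rho>" "w = f v" using wb e(2) by blast
      then have "g w = v" using g(2) by simp
      then show ?thesis using v r(2) by auto
    qed
    show "(p \<longlongrightarrow> g (of_real s)) (at_UH s)" if s: "\<bar>s - x\<bar> < e" for s
    proof -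
      have sb: "of_real s \<in> ball (complex_of_real x) e"
        using s by (simp add: dist_norm abs_minus_commute flip: of_real_diff)
      then have "isCont g (of_real s)"
        using hol by (meson continuous_on_eq_continuous_at holomorphic_on_imp_continuous_on open_ball)
      then have "(g \<longlongrightarrow> g (of_real s)) (at_UH s)"
        unfolding isCont_def by (rule tendsto_within_subset) auto
      moreover have "\<forall>\<^sub>F w in at_UH s. g w = p w"
      proof -
        have "\<forall>\<^sub>F w in at_UH s. w \<in> ball (of_real x) e"
          using sb by (intro topological_tendstoD[OF tendsto_ident_at]) auto
        moreover have "\<forall>\<^sub>F w in at_UH s. Im w > 0" by (auto simp: eventually_at_UH intro!: exI[of _ 1])
        ultimately show ?thesis by eventually_elim (rule gp)
      qed
      ultimately show ?thesis by (rule Lim_transform_eventually)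
    qed
  qed (use e hol gp in auto)
qed

lemma isCont_Phi: "z \<notin> \<real>\<^sub>\<le>\<^sub>0 \<Longrightarrow> isCont Phi z"
  using Phi_deriv DERIV_isCont by blast

lemma Im_Phi_limit:
  assumes "(p \<longlongrightarrow> z) (at_UH x)" "z \<notin> \<real>\<^sub>\<le>\<^sub>0"
  shows "((\<lambda>w. Im (Phi (p w))) \<longlongrightarrow> Im (Phi z)) (at_UH x)"
  using isCont_tendsto_compose[OF isCont_Phi[OF assms(2)] assms(1)] by (rule tendsto_Im)

text \<open>
  Otherwise \<open>Im (\<Phi> \<circ> p)\<close> has boundary value \<open>0\<close> at \<open>x\<close> and beyond \<open>m\<close>, hence in between, whereas
  just left of \<open>m\<close> the boundary values of \<open>p\<close> are not real and the monotonicity is strict.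
\<close>
lemma no_positive_limit:
  assumes x: "0 < x" "x < m" and z: "z > 0" and lim: "(p \<longlongrightarrow> of_real z) (at_UH x)"
  shows False
proof -
  define y where "y = m + 1"
  define \<eta> where "\<eta> = (\<beta> - \<alpha>) / 2"
  have eta: "\<eta> > 0" using ab by (simp add: \<eta>_def)
  obtain d where d: "d > 0" "\<And>w. Im w > 0 \<Longrightarrow> norm (w - of_real m) < d \<Longrightarrow> dist (p w) (of_real \<beta>) < \<eta>"
    using tendstoD[OF p_lim_m eta] by (auto simp: eventually_at_UH)
  define s0 where "s0 = (max x (m - d) + m) / 2"
  have s0: "x < s0" "s0 < m" "m - d < s0" using x d by (auto simp: s0_def)
  have near: "\<forall>\<^sub>F w in at_UH s0. dist (p w) (of_real \<beta>) \<le> \<eta>"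
    unfolding eventually_at_UH
  proof (intro exI[of _ "d - (m - s0)"] conjI allI impI)
    fix w assume w: "0 < Im w \<and> norm (w - of_real s0) < d - (m - s0)"
    have "norm (w - of_real m) \<le> norm (w - of_real s0) + norm (of_real s0 - complex_of_real m)"
      using norm_triangle_ineq[of "w - of_real s0" "of_real s0 - of_real m"] by simp
    also have "norm (of_real s0 - complex_of_real m) = m - s0" using s0 by (simp flip: of_real_diff)
    finally show "dist (p w) (of_real \<beta>) \<le> \<eta>" using d(2)[of w] w by fastforce
  qed (use s0 in simp)
  obtain z0 where z0: "(p \<longlongrightarrow> z0) (at_UH s0)"
  proof -
    have "\<not> filterlim p at_infinity (at_UH s0)"
    proof
      assume "filterlim p at_infinity (at_UH s0)"
      then have "\<forall>\<^sub>F w in at_UH s0. norm (p w) \<ge> \<eta> + \<beta> + 1"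
        using eta be0 by (auto simp: filterlim_at_infinity[OF order_refl])
      with near have "\<forall>\<^sub>F w in at_UH s0. False"
      proof eventually_elim
        case (elim w)
        have "norm (p w) \<le> norm (p w - of_real \<beta>) + norm (complex_of_real \<beta>)"
          using norm_triangle_ineq[of "p w - of_real \<beta>" "of_real \<beta>"] by simp
        then show False using elim be0 by (simp add: dist_norm)
      qed
      then show False using at_UH_neq_bot by (simp add: eventually_False)
    qed
    then show ?thesis using p_dichotomy that by blast
  qed
  have z0b: "dist z0 (of_real \<beta>) \<le> \<eta>"
    by (rule tendsto_upperbound[OF tendsto_dist[OF z0 tendsto_const] near at_UH_neq_bot])
  have fz0: "f z0 = of_real s0" by (rule p_limit_f[OF z0])
  have Imz0: "Im z0 > 0"
  proof (rule ccontr)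
    assume "\<not> ?thesis"
    then have "Im z0 = 0" using p_limit_Im[OF z0] by simp
    then obtain v where v: "z0 = of_real v" by (metis complex_is_Real_iff Reals_cases)
    have "\<bar>v - \<beta>\<bar> \<le> \<eta>" using z0b by (simp add: v dist_of_real dist_real_def)
    then have "\<beta> - v \<le> (\<beta> - \<alpha>) / 2" unfolding \<eta>_def by linarith
    then have "\<alpha> \<le> v" using ab by (simp add: field_simps)
    then have "v > 0" "fr v \<ge> m" using al0 fr_ge_m by auto
    then show False using fz0 s0 f_real(1)[of v] by (simp add: v)
  qed
  obtain e g where e: "e > 0" and g: "g holomorphic_on ball (of_real s0) e" "g (of_real s0) = z0"
    "\<And>w. w \<in> ball (of_real s0) e \<Longrightarrow> Im (g w) > 0 \<and> f (g w) = w"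
    "\<And>s. \<bar>s - s0\<bar> < e \<Longrightarrow> (p \<longlongrightarrow> g (of_real s)) (at_UH s)"
    using local_extension[OF z0 Imz0] by metis
  define e' where "e' = Min {e, s0 - x, m - s0}"
  have e': "e' > 0" "e' \<le> e" "e' \<le> s0 - x" "e' \<le> m - s0" using e s0 by (auto simp: e'_def)
  have zero: "Im (Phi (g (of_real s))) = 0" if s: "\<bar>s - s0\<bar> < e'" for s
  proof -
    have sx: "x < s" "s < m" "s > 0" using s e' x by auto
    have gs: "Im (g (of_real s)) > 0"
      using g(3)[of "of_real s"] s e' by (simp add: dist_norm abs_minus_commute flip: of_real_diff)
    define U where "U = (\<lambda>\<tau>. complex_of_real 1 + \<i> * of_real \<tau>)"
    have L: "((\<lambda>\<tau>. Im (Phi (p (of_real t * U \<tau>)))) \<longlongrightarrow> Im (Phi v)) (at_right 0)"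
      if "t > 0" "(p \<longlongrightarrow> v) (at_UH t)" "v \<notin> \<real>\<^sub>\<le>\<^sub>0" for t v
      using filterlim_compose[OF Im_Phi_limit[OF that(2,3)], of "\<lambda>\<tau>. of_real t * U \<tau>" "at_right 0"] 
        ray_filterlim[OF that(1), of 1] by (simp add: U_def)
    have "finv0 y > 0" using finv0[of y] be0 by (simp add: y_def)
    then have Ly: "((\<lambda>\<tau>. Im (Phi (p (of_real y * U \<tau>)))) \<longlongrightarrow> 0) (at_right 0)"
      using L[of y "of_real (finv0 y)"] p_lim_real[of y] m_pos Im_Phi_real[of "finv0 y"] by (simp add: y_def)
    have Lx: "((\<lambda>\<tau>. Im (Phi (p (of_real x * U \<tau>)))) \<longlongrightarrow> 0) (at_right 0)"
      using L[OF x(1) lim] z Im_Phi_real[of z] by simp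
    have Ls: "((\<lambda>\<tau>. Im (Phi (p (of_real s * U \<tau>)))) \<longlongrightarrow> Im (Phi (g (of_real s)))) (at_right 0)"
      using L[OF sx(3) g(4)] s e' upper_slit[OF gs] by simp
    have ev: "\<forall>\<^sub>F \<tau> in at_right 0. \<tau> > (0::real)" by (rule eventually_at_right_less)
    have "((\<lambda>\<tau>. Im (Phi (p (of_real s * U \<tau>)))) \<longlongrightarrow> 0) (at_right 0)"
    proof (rule tendsto_sandwich[OF _ _ Ly Lx])
      show "\<forall>\<^sub>F \<tau> in at_right 0. Im (Phi (p (of_real y * U \<tau>))) \<le> Im (Phi (p (of_real s * U \<tau>)))"
        using ev by eventually_elim (use ray_decreasing[of "U _" s y] sx in \<open>auto simp: U_def y_def intro: less_imp_le\<close>)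
      show "\<forall>\<^sub>F \<tau> in at_right 0. Im (Phi (p (of_real s * U \<tau>))) \<le> Im (Phi (p (of_real x * U \<tau>)))"
        using ev by eventually_elim (use ray_decreasing[of "U _" x s] sx x in \<open>auto simp: U_def intro: less_imp_le\<close>)
    qed
    then show ?thesis using tendsto_unique[OF _ Ls] by simp
  qed
  have cb: "of_real s0 \<in> ball (complex_of_real s0) e" using e by simp
  obtain g' where g': "(g has_field_derivative g') (at (of_real s0))"
    using g(1) cb holomorphic_on_open open_ball by blast
  have h0: "h z0 \<noteq> 0" by (rule h_nonzero[OF Imz0])
  have "((\<lambda>w. f (g w)) has_field_derivative (f z0 * h z0) * g') (at (of_real s0))"
    using DERIV_chain'[OF g', of f "f z0 * h z0"] f_deriv[OF upper_slit[OF Imz0]] g(2) by simp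
  then have "((\<lambda>w. w) has_field_derivative (f z0 * h z0) * g') (at (complex_of_real s0))"
    using has_field_derivative_transform_within_open[of "\<lambda>w. f (g w)" _ "of_real s0" "ball (of_real s0) e" "\<lambda>w. w"] g(3) cb
    by auto
  then have e1: "(of_real s0 * h z0) * g' = 1" using DERIV_unique[OF _ DERIV_ident] fz0 by auto
  have g'_eq: "g' = (1 / h z0) / of_real s0" using e1 h0 x s0 by (auto simp: field_simps)
  have "((\<lambda>w. Phi (g w)) has_field_derivative (z0 - of_real \<alpha>) * (z0 - of_real \<beta>) / z0 * g') (at (of_real s0))"
    by (rule DERIV_chain'[OF g', of Phi]) (use Phi_deriv[OF upper_slit[OF Imz0]] g(2) in simp)
  also have "(z0 - of_real \<alpha>) * (z0 - of_real \<beta>) / z0 * g' = (1 / P z0) / of_real s0"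
  proof -
    have *: "v * ((1 / h z0) / of_real s0) = (v * (1 / h z0)) / of_real s0" for v by simp
    show ?thesis unfolding g'_eq by (simp only: * Phi_h_P[OF Imz0 h0])
  qed
  finally have "((\<lambda>s. Phi (g (of_real s))) has_vector_derivative (1 / P z0) / of_real s0) (at s0)"
    by (rule has_vector_derivative_real_field)
  then have "((\<lambda>s. Im (Phi (g (of_real s)))) has_vector_derivative Im ((1 / P z0) / of_real s0)) (at s0)"
    by (rule bounded_linear.has_vector_derivative[OF bounded_linear_Im])
  then have D: "((\<lambda>s. Im (Phi (g (of_real s)))) has_real_derivative Im (1 / P z0) / s0) (at s0)"
    by (simp only: has_real_derivative_iff_has_vector_derivative Im_divide_of_real)
  have "((\<lambda>_. 0) has_real_derivative Im (1 / P z0) / s0) (at s0)"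
    by (rule has_field_derivative_transform_within[OF D e'(1)]) (auto simp: zero dist_real_def)
  then have "Im (1 / P z0) / s0 = 0" using DERIV_unique DERIV_const by blast
  then show False using Im_inverse_P[OF Imz0] s0 x by simp
qed

text \<open>
  Comparison with a farther point on the ray bounds \<open>Im (\<Phi> \<circ> p)\<close> from below near \<open>x\<close>. So \<open>p\<close> could tend
  to infinity near the negative axis only where \<open>Im z |Re z|\<close> is bounded, and there \<open>Im L\<close> exceeds \<open>\<pi>\<close>;
  in the remaining sector \<open>|h|\<close> is at least \<open>1\<close>, so \<open>p'\<close> is bounded near \<open>x\<close>.
\<close>
lemma p_not_infinite:
  assumes x: "x < m" "x \<noteq> 0"
  shows "\<not> filterlim p at_infinity (at_UH x)"
proof
  assume inf: "filterlim p at_infinity (at_UH x)"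
  have "\<exists>y. y / x > 1 \<and> (\<exists>z. (p \<longlongrightarrow> z) (at_UH y))"
  proof (cases "x > 0")
    case True
    then show ?thesis using p_lim_real[of "m + 1"] x by (intro exI[of _ "m+1"]) (auto simp: field_simps)
  next
    case False
    obtain y where "x - 1 < y" "y < x" "\<exists>z. (p \<longlongrightarrow> z) (at_UH y)"
      using p_not_infinite_interval[of "x - 1" x] by auto
    then show ?thesis using False x by (intro exI[of _ y]) (auto simp: divide_simps)
  qed
  then obtain y zy where y: "y / x > 1" "(p \<longlongrightarrow> zy) (at_UH y)" by blast
  define q where "q = y / x"
  have q: "q > 1" "q * x = y" using y x by (auto simp: q_def)
  define B where "B = norm zy + 1"
  define C where "C = B * (B + \<alpha> + \<beta>) + 2 * (\<alpha> * \<beta> * pi)"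
  have B: "B \<ge> 1" by (simp add: B_def)
  have C: "C \<ge> 0" using B al0 be0 by (auto simp: C_def intro!: add_nonneg_nonneg mult_nonneg_nonneg)
  have "\<forall>\<^sub>F w in at_UH y. norm (p w) < B"
    using order_tendstoD(2)[OF tendsto_norm[OF y(2)], of B] by (simp add: B_def)
  then obtain d where d: "d > 0" "\<And>w. Im w > 0 \<Longrightarrow> norm (w - of_real y) < d \<Longrightarrow> norm (p w) < B"
    by (auto simp: eventually_at_UH)
  have low: "Im (Phi (p w)) \<ge> - (B * (B + \<alpha> + \<beta>) + \<alpha> * \<beta> * pi)" if w: "Im w > 0" "norm (w - of_real x) < d / q" for w
  proof -
    define w' where "w' = of_real q * w"
    have "norm (w' - of_real y) = norm (of_real q * (w - of_real x))"
      by (simp add: w'_def algebra_simps flip: q(2))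
    also have "\<dots> = q * norm (w - of_real x)" using q by (simp add: norm_mult)
    also have "\<dots> < d" using w q by (simp add: field_simps)
    finally have w': "norm (p w') < B" using d(2)[of w'] q w by (simp add: w'_def)
    define v where "v = p w'"
    have "\<bar>Im v * (Re v - \<alpha> - \<beta>)\<bar> \<le> B * (B + \<alpha> + \<beta>)"
      unfolding abs_mult
    proof (intro mult_mono)
      show "\<bar>Im v\<bar> \<le> B" using w' abs_Im_le_cmod[of v] by (simp add: v_def)
      show "\<bar>Re v - \<alpha> - \<beta>\<bar> \<le> B + \<alpha> + \<beta>" using w' abs_Re_le_cmod[of v] al0 be0 by (simp add: v_def)
    qed (use B in auto)
    moreover have "0 \<le> Im (Ln v)"
      using Im_Ln_pos_le[of v] Im_p_pos[of w'] w q by (cases "v = 0") (auto simp: v_def w'_def)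
    then have "0 \<le> \<alpha> * \<beta> * Im (Ln v)" using al0 be0 by simp
    moreover have "\<alpha> * \<beta> * pi \<ge> 0" using al0 be0 by simp
    ultimately have "Im (Phi v) \<ge> - (B * (B + \<alpha> + \<beta>) + \<alpha> * \<beta> * pi)"
      unfolding Im_Phi by linarith
    moreover have "Im (Phi (p (of_real q * w))) < Im (Phi (p (of_real 1 * w)))"
      by (rule ray_decreasing) (use w q in auto)
    ultimately show ?thesis by (simp add: v_def w'_def)
  qed
  obtain R1 where R1: "R1 > 0" "\<And>z. Im z > 0 \<Longrightarrow> Re z \<le> -R1 \<Longrightarrow> Im z * (- Re z) \<le> C \<Longrightarrow> Im (L z) \<ge> 4"
    using Im_L_far[OF C, of 4] by blast
  obtain R2 where R2: "R2 > 0" "\<And>z. Im z > 0 \<Longrightarrow> Re z \<ge> - 1 * Im z \<Longrightarrow> norm z \<ge> R2 \<Longrightarrow> norm (h z) \<ge> 1"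
    using h_large[of 1] by auto
  have "max (2 * R1) R2 > 0" using R1 by simp
  then have "\<forall>\<^sub>F w in at_UH x. norm (p w) \<ge> max (2 * R1) R2"
    using inf unfolding filterlim_at_infinity[OF order_refl] by blast
  then obtain d1 where d1: "d1 > 0" "\<And>w. Im w > 0 \<Longrightarrow> norm (w - of_real x) < d1 \<Longrightarrow> norm (p w) \<ge> max (2 * R1) R2"
    by (auto simp: eventually_at_UH)
  define \<delta> where "\<delta> = min d1 (min (d / q) (\<bar>x\<bar> / 2))"
  have "d / q > 0" using d q by simp
  then have dl: "\<delta> > 0" "\<delta> \<le> d1" "\<delta> \<le> d / q" "\<delta> \<le> \<bar>x\<bar> / 2"
    using d1(1) x unfolding \<delta>_def by linarith+
  have hb: "norm (h (p w)) \<ge> 1" if w: "Im w > 0" "norm (w - of_real x) < \<delta>" for w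
  proof -
    define z where "z = p w"
    have z: "Im z > 0" using Im_p_pos w by (simp add: z_def)
    have nz: "norm z \<ge> 2 * R1" "norm z \<ge> R2" using d1(2)[of w] w dl by (auto simp: z_def)
    have ImL: "Im (L z) \<le> pi" using L_p[of w] Im_Ln_le_pi[of w] w by (cases "w = 0") (auto simp: z_def)
    have ImLn: "Im (Ln z) \<le> pi" using Im_Ln_le_pi[of z] z by (cases "z = 0") auto
    have Rez: "Re z > - R1"
    proof (rule ccontr)
      assume "\<not> ?thesis"
      then have neg: "Re z \<le> - R1" by simp
      have "Im (Phi z) \<ge> - (B * (B + \<alpha> + \<beta>) + \<alpha> * \<beta> * pi)"
        using low[of w] w dl by (simp add: z_def)
      moreover have "\<alpha> * \<beta> * Im (Ln z) \<le> \<alpha> * \<beta> * pi" using ImLn al0 be0 by (intro mult_left_mono) auto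
      ultimately have "Im z * (\<alpha> + \<beta> - Re z) \<le> C" unfolding Im_Phi C_def by (simp add: algebra_simps)
      moreover have "Im z * (- Re z) \<le> Im z * (\<alpha> + \<beta> - Re z)" using z al0 be0 by (intro mult_left_mono) auto
      ultimately have "Im (L z) \<ge> 4" using R1(2)[OF z neg] by linarith
      then show False using ImL pi_less_4 by linarith
    qed
    have "Re z \<ge> - 1 * Im z"
    proof (cases "Re z \<ge> 0")
      case False
      have "norm z \<le> \<bar>Re z\<bar> + \<bar>Im z\<bar>" by (rule cmod_le)
      then show ?thesis using nz False Rez z R1(1) by simp
    qed (use z in simp)
    then show ?thesis using R2(2)[OF z] nz by (simp add: z_def)
  qed
  define D where "D = UH \<inter> ball (of_real x) \<delta>"
  define w0 where "w0 = of_real x + \<i> * of_real (\<delta>/2)"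
  have w0: "w0 \<in> D" using dl by (auto simp: D_def w0_def dist_norm norm_mult)
  have bd: "norm (p w) \<le> norm (p w0) + (2 / \<bar>x\<bar>) * (2 * \<delta>)" if w: "w \<in> D" for w
  proof -
    have "norm (p w - p w0) \<le> (2 / \<bar>x\<bar>) * norm (w - w0)"
    proof (rule field_differentiable_bound[of D p "\<lambda>w. 1 / (w * h (p w))"])
      show "convex D" unfolding D_def by (intro convex_Int convex_UH convex_ball)
      fix v assume "v \<in> D"
      then have v: "Im v > 0" "norm (v - of_real x) < \<delta>" by (auto simp: D_def dist_norm norm_minus_commute)
      show "(p has_field_derivative 1 / (v * h (p v))) (at v within D)"
        using p_deriv(1)[OF v(1)] has_field_derivative_at_within by blast
      have "norm v \<ge> \<bar>x\<bar> / 2"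
        using norm_triangle_ineq2[of "of_real x" "of_real x - v"] v(2) dl by (simp add: norm_minus_commute)
      then have "\<bar>x\<bar> / 2 * 1 \<le> norm v * norm (h (p v))" using hb[OF v] by (intro mult_mono) auto
      then have "1 / (norm v * norm (h (p v))) \<le> 1 / (\<bar>x\<bar> / 2)"
        using x by (intro divide_left_mono) (auto intro: mult_pos_pos)
      then show "norm (1 / (v * h (p v))) \<le> 2 / \<bar>x\<bar>" by (simp add: norm_divide norm_mult)
    qed (use w w0 in auto)
    also have "norm (w - w0) \<le> 2 * \<delta>"
      using w w0 norm_triangle_ineq4[of "w - of_real x" "w0 - of_real x"]
      by (auto simp: D_def dist_norm norm_minus_commute)
    then have "(2 / \<bar>x\<bar>) * norm (w - w0) \<le> (2 / \<bar>x\<bar>) * (2 * \<delta>)" by (intro mult_left_mono) auto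
    finally show ?thesis using norm_triangle_sub[of "p w" "p w0"] by linarith
  qed
  define M where "M = norm (p w0) + (2 / \<bar>x\<bar>) * (2 * \<delta>) + 1"
  have "M > 0" using dl by (auto simp: M_def intro!: add_nonneg_pos)
  then have "\<forall>\<^sub>F w in at_UH x. norm (p w) \<ge> M"
    using inf by (auto simp: filterlim_at_infinity[OF order_refl])
  moreover have "\<forall>\<^sub>F w in at_UH x. w \<in> D"
    using dl by (auto simp: eventually_at_UH D_def dist_norm norm_minus_commute)
  ultimately have "\<forall>\<^sub>F w in at_UH x. False"
  proof eventually_elim
    case (elim w) then show False using bd[of w] by (simp add: M_def)
  qed
  then show False using at_UH_neq_bot by (simp add: eventually_False)
qed

end

lemma eventually_at_UH_nearby:
  assumes "\<forall>\<^sub>F w in at_UH x. Q w"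
  shows "\<exists>d>0. \<forall>s. \<bar>s - x\<bar> < d \<longrightarrow> (\<forall>\<^sub>F w in at_UH s. Q w)"
proof -
  obtain d where d: "d > 0" "\<And>w. Im w > 0 \<Longrightarrow> norm (w - of_real x) < d \<Longrightarrow> Q w"
    using assms by (auto simp: eventually_at_UH)
  have "\<forall>\<^sub>F w in at_UH s. Q w" if "\<bar>s - x\<bar> < d" for s
    unfolding eventually_at_UH
  proof (intro exI[of _ "d - \<bar>s - x\<bar>"] conjI allI impI)
    fix w assume w: "0 < Im w \<and> norm (w - of_real s) < d - \<bar>s - x\<bar>"
    have "norm (w - of_real x) \<le> norm (w - of_real s) + norm (of_real s - complex_of_real x)"
      using norm_triangle_ineq[of "w - of_real s" "of_real s - of_real x"] by simp
    also have "norm (of_real s - complex_of_real x) = \<bar>s - x\<bar>" by (metis norm_of_real of_real_diff)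
    finally show "Q w" using d(2)[of w] w by linarith
  qed (use that in simp)
  then show ?thesis using d(1) by blast
qed

context pick_inverse begin

lemma limit_upper_pos:
  assumes x: "0 < x" "x < m" and lim: "(p \<longlongrightarrow> z) (at_UH x)"
  shows "Im z > 0"
proof (rule ccontr)
  assume "\<not> ?thesis"
  then have "Im z = 0" using p_limit_Im[OF lim] by simp
  then obtain v where v: "z = of_real v" by (metis complex_is_Real_iff Reals_cases)
  have "v \<noteq> 0" using p_limit_f[OF lim] x v by auto
  moreover have "\<not> v < 0" using p_limit_negative[of v x] lim x v by auto
  moreover have "\<not> v > 0" using no_positive_limit[OF x, of v] lim v by auto
  ultimately show False by linarith
qed

lemma real_limit_negative:
  assumes x: "x < 0" and lim: "(p \<longlongrightarrow> z) (at_UH x)" and z: "Im z = 0"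
  shows "z = of_real (Re z)" "Re z < 0"
proof -
  show zr: "z = of_real (Re z)" using z by (simp add: complex_eq_iff)
  have fz: "f z = of_real x" by (rule p_limit_f[OF lim])
  have "\<not> Re z > 0"
  proof
    assume "Re z > 0"
    then show False using f_real[of "Re z"] zr fz x by (metis of_real_eq_iff not_less_iff_gr_or_eq order.strict_trans)
  qed
  moreover have "Re z \<noteq> 0"
  proof
    assume "Re z = 0"
    then have "z = 0" using zr by simp
    then show False using fz x by auto
  qed
  ultimately show "Re z < 0" by linarith
qed

lemma r1_deriv_0: assumes "r = 1" shows "deriv f 0 \<noteq> 0"
proof -
  define G where "G = (\<lambda>z. exp (of_real a * z ^ 2 + of_real b * z) * W z)"
  have "G holomorphic_on UNIV" unfolding G_def by (intro holomorphic_intros holomorphic_W)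
  then obtain G' where G': "(G has_field_derivative G') (at 0)"
    using holomorphic_on_open[of UNIV G] by auto
  have "((\<lambda>z. z * G z) has_field_derivative 1 * G 0 + G' * 0) (at 0)"
    by (rule DERIV_mult[OF DERIV_ident G'])
  moreover have "f = (\<lambda>z. z * G z)" using assms by (auto simp: f_eq G_def)
  moreover have "G 0 = 1" by (simp add: G_def)
  ultimately have "deriv f 0 = 1" by (simp add: DERIV_imp_deriv)
  then show ?thesis by simp
qed

lemma no_zero_limit_at_0:
  assumes r1: "r = 1" and lim: "(p \<longlongrightarrow> 0) (at_UH 0)" shows False
proof -
  obtain \<rho> where \<rho>: "\<rho> > 0" "inj_on f (ball 0 \<rho>)"
    using has_complex_derivative_locally_injective[OF holomorphic_f UNIV_I open_UNIV r1_deriv_0[OF r1]] by metis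
  have "\<forall>\<^sub>F w in at_UH 0. norm (p w) < \<rho> / 2"
    using order_tendstoD(2)[OF tendsto_norm[OF lim], of "\<rho>/2"] \<rho> by simp
  then obtain d where d: "d > 0" "\<And>s. \<bar>s\<bar> < d \<Longrightarrow> \<forall>\<^sub>F w in at_UH s. norm (p w) < \<rho> / 2"
    using eventually_at_UH_nearby[of "\<lambda>w. norm (p w) < \<rho>/2" 0] by auto
  have "min d m > 0" using d m_pos by simp
  then obtain e where e: "e > 0" "\<And>v. norm v < e \<Longrightarrow> norm (f v) < min d m"
    using isCont_f[of 0] unfolding continuous_at_eps_delta dist_norm by (metis diff_zero f_0)
  define z1 where "z1 = min e \<rho> / 2"
  have z1: "z1 > 0" "z1 < e" "z1 < \<rho>" using e \<rho> by (auto simp: z1_def)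
  define s where "s = fr z1"
  have fs: "f (of_real z1) = of_real s" "s > 0" using f_real[OF z1(1)] by (auto simp: s_def)
  have s: "s < d" "s < m" using e(2)[of "of_real z1"] z1 fs by auto
  obtain k where k: "(p \<longlongrightarrow> k) (at_UH s)"
    using p_dichotomy[of s] p_not_infinite[of s] s fs by auto
  have "norm k \<le> \<rho> / 2"
    by (rule tendsto_upperbound[OF tendsto_norm[OF k] _ at_UH_neq_bot])
       (use d(2)[of s] s fs in \<open>auto elim: eventually_mono\<close>)
  then have "k \<in> ball 0 \<rho>" "of_real z1 \<in> ball (0::complex) \<rho>" using \<rho> z1 by auto
  moreover have "f k = f (of_real z1)" using p_limit_f[OF k] fs by simp
  ultimately have "k = of_real z1" using \<rho>(2) by (auto dest: inj_onD)
  then show False using no_positive_limit[OF fs(2) s(2) z1(1)] k by simp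
qed

text \<open>
  If the limit at \<open>x < 0\<close> is real, then \<open>Im (\<Phi> \<circ> p) \<ge> \<alpha> \<beta> \<pi>\<close> on \<open>(x, 0)\<close>, which forces the limits there
  to stay real and negative. They cannot cross a zero of \<open>f\<close>, so they are bounded, and \<open>p\<close> has a
  finite limit at \<open>0\<close>; this is impossible by the behaviour of \<open>p\<close> on \<open>(0, m)\<close>.
\<close>
lemma limit_upper_neg:
  assumes x: "x < 0" and lim: "(p \<longlongrightarrow> z) (at_UH x)"
  shows "Im z > 0"
proof (rule ccontr)
  assume "\<not> ?thesis"
  then have Imz: "Im z = 0" using p_limit_Im[OF lim] by simp
  note zr = real_limit_negative[OF x lim Imz]
  have r1: "r = 1" using p_limit_negative[of "Re z" x] lim zr by auto
  have "\<exists>v. (p \<longlongrightarrow> v) (at_UH s)" if "s \<in> {x..<0}" for s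
    using p_dichotomy[of s] p_not_infinite[of s] m_pos that by auto
  then obtain k where k: "\<And>s. s \<in> {x..<0} \<Longrightarrow> (p \<longlongrightarrow> k s) (at_UH s)" by metis
  have kx: "k x = z" using tendsto_unique[OF at_UH_neq_bot k lim] x by simp
  have kc: "continuous_on {x..<0} k" using k by (rule boundary_limit_continuous_on)
  have fk: "f (k s) = of_real s" if "s \<in> {x..<0}" for s using p_limit_f[OF k[OF that]] .
  define U where "U = (\<lambda>\<tau>. complex_of_real (-1) + \<i> * of_real \<tau>)"
  have Ux: "((\<lambda>\<tau>. Im (Phi (p (of_real (-x) * U \<tau>)))) \<longlongrightarrow> \<alpha> * \<beta> * pi) (at_right 0)"
  proof -
    have fl: "filterlim (\<lambda>\<tau>. of_real (-x) * U \<tau>) (at_UH x) (at_right 0)"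
      using ray_filterlim[of "-x" "-1"] x by (simp add: U_def)
    have "((\<lambda>w. Im (p w) * (Re (p w) - \<alpha> - \<beta>) + \<alpha> * \<beta> * (pi + Im (Ln (- p w)))) \<longlongrightarrow>
        Im z * (Re z - \<alpha> - \<beta>) + \<alpha> * \<beta> * (pi + Im (Ln (- z)))) (at_UH x)"
      using zr by (intro tendsto_intros tendsto_Re tendsto_Im lim) (auto simp: complex_nonpos_Reals_iff)
    moreover have "Im (Ln (- z)) = 0"
      using Ln_of_real[of "- Re z"] zr by (metis Im_complex_of_real neg_0_less_iff_less of_real_minus)
    ultimately have "((\<lambda>w. Im (p w) * (Re (p w) - \<alpha> - \<beta>) + \<alpha> * \<beta> * (pi + Im (Ln (- p w)))) \<longlongrightarrow> \<alpha> * \<beta> * pi) (at_UH x)"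
      by (simp add: Imz)
    moreover have "\<forall>\<^sub>F w in at_UH x. Im (p w) * (Re (p w) - \<alpha> - \<beta>) + \<alpha> * \<beta> * (pi + Im (Ln (- p w))) = Im (Phi (p w))"
      unfolding eventually_at_UH
    proof (intro exI[of _ 1] conjI allI impI)
      fix w assume "0 < Im w \<and> norm (w - of_real x) < 1"
      then have "Im (p w) > 0" using Im_p_pos by blast
      then show "Im (p w) * (Re (p w) - \<alpha> - \<beta>) + \<alpha> * \<beta> * (pi + Im (Ln (- p w))) = Im (Phi (p w))"
        unfolding Im_Phi using Ln_minus[of "p w"] by (cases "p w = 0") auto
    qed simp
    ultimately have "((\<lambda>w. Im (Phi (p w))) \<longlongrightarrow> \<alpha> * \<beta> * pi) (at_UH x)" by (rule Lim_transform_eventually)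
    then show ?thesis by (rule filterlim_compose[OF _ fl])
  qed
  have dicho: "Re (k s) > \<alpha> + \<beta> \<or> (Im (k s) = 0 \<and> Re (k s) < 0)" if s: "s \<in> {x..<0}" for s
  proof (cases "Im (k s) = 0")
    case True
    then show ?thesis using real_limit_negative[OF _ k[OF s] True] s by auto
  next
    case False
    then have Ik: "Im (k s) > 0" using p_limit_Im[OF k[OF s]] by simp
    then have "s \<noteq> x" using kx Imz by auto
    then have sx: "x < s" "s < 0" using s by auto
    have fl: "filterlim (\<lambda>\<tau>. of_real (-s) * U \<tau>) (at_UH s) (at_right 0)"
      using ray_filterlim[of "-s" "-1"] sx by (simp add: U_def)
    have Us: "((\<lambda>\<tau>. Im (Phi (p (of_real (-s) * U \<tau>)))) \<longlongrightarrow> Im (Phi (k s))) (at_right 0)"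
      by (rule filterlim_compose[OF Im_Phi_limit[OF k[OF s] upper_slit[OF Ik]] fl])
    have "\<alpha> * \<beta> * pi \<le> Im (Phi (k s))"
    proof (rule tendsto_le[OF _ Us Ux])
      show "\<forall>\<^sub>F \<tau> in at_right 0. Im (Phi (p (of_real (-x) * U \<tau>))) \<le> Im (Phi (p (of_real (-s) * U \<tau>)))"
        using eventually_at_right_less[of "0::real"]
      proof eventually_elim
        case (elim \<tau>)
        have "Im (Phi (p (of_real (-x) * U \<tau>))) < Im (Phi (p (of_real (-s) * U \<tau>)))"
          by (rule ray_decreasing) (use elim sx in \<open>auto simp: U_def\<close>)
        then show ?case by simp
      qed
    qed simp
    moreover have "\<alpha> * \<beta> * Im (Ln (k s)) < \<alpha> * \<beta> * pi"
      using Im_Ln_pos_lt[of "k s"] Ik al0 be0 by (cases "k s = 0") auto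
    ultimately have "0 < Im (k s) * (Re (k s) - \<alpha> - \<beta>)" unfolding Im_Phi by linarith
    then show ?thesis using Ik by (simp add: zero_less_mult_iff)
  qed
  have Rec: "continuous_on {x..s} (\<lambda>s. Re (k s))" if "s < 0" for s
    using that by (intro continuous_on_Re continuous_on_subset[OF kc]) auto
  have neg: "Re (k s) < 0" if s: "s \<in> {x..<0}" for s
  proof (rule ccontr)
    assume "\<not> ?thesis"
    then have "\<exists>t\<ge>x. t \<le> s \<and> Re (k t) = 0"
      using s zr kx by (intro IVT' Rec) auto
    then obtain t where t: "x \<le> t" "t \<le> s" "Re (k t) = 0" by blast
    then show False using dicho[of t] s al0 be0 by auto
  qed
  have kreal: "Im (k s) = 0" if s: "s \<in> {x..<0}" for s
    using dicho[OF s] neg[OF s] al0 be0 by auto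
  have kr: "k s = of_real (Re (k s))" if s: "s \<in> {x..<0}" for s
    using kreal[OF s] by (simp add: complex_eq_iff)
  have "\<forall>\<^sub>F K in sequentially. lam K \<ge> - Re z + 1"
    using lam_at_top unfolding filterlim_at_top by blast
  then obtain K where K: "lam K \<ge> - Re z + 1" by (auto simp: eventually_sequentially)
  have low: "Re (k s) > - lam K" if s: "s \<in> {x..<0}" for s
  proof (rule ccontr)
    assume "\<not> ?thesis"
    then have "\<exists>t\<ge>x. t \<le> s \<and> Re (k t) = - lam K"
      using s K kx by (intro IVT2' Rec) auto
    then obtain t where t: "x \<le> t" "t \<le> s" "Re (k t) = - lam K" by blast
    then have "k t = - of_real (lam K)" using kr[of t] s by simp
    then show False using fk[of t] t s by simp
  qed
  have kn: "norm (k s) < lam K" if s: "s \<in> {x..<0}" for s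
    using kr[OF s] low[OF s] neg[OF s] by (metis abs_of_neg minus_less_iff norm_of_real)
  have "\<not> filterlim p at_infinity (at_UH 0)"
  proof
    assume "filterlim p at_infinity (at_UH 0)"
    then have "\<forall>\<^sub>F w in at_UH 0. norm (p w) \<ge> lam K"
      using lam_pos(1)[of K] unfolding filterlim_at_infinity[OF order_refl] by blast
    then obtain d where d: "d > 0" "\<And>s. \<bar>s\<bar> < d \<Longrightarrow> \<forall>\<^sub>F w in at_UH s. norm (p w) \<ge> lam K"
      using eventually_at_UH_nearby[of "\<lambda>w. norm (p w) \<ge> lam K" 0] by auto
    define s where "s = - min d (-x) / 2"
    have s: "s \<in> {x..<0}" "\<bar>s\<bar> < d" using d x by (auto simp: s_def)
    have "norm (k s) \<ge> lam K"
      by (rule tendsto_lowerbound[OF tendsto_norm[OF k[OF s(1)]] d(2)[OF s(2)] at_UH_neq_bot])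
    then show False using kn[OF s(1)] by simp
  qed
  then obtain z0 where z0: "(p \<longlongrightarrow> z0) (at_UH 0)" using p_dichotomy[of 0] by blast
  define k' where "k' = (\<lambda>s. if s = 0 then z0 else k s)"
  have "continuous_on {x..0} k'"
    by (rule boundary_limit_continuous_on[of _ p]) (use z0 k in \<open>auto simp: k'_def\<close>)
  then have "(k' \<longlongrightarrow> k' 0) (at 0 within {x..0})" using x by (simp add: continuous_on_def)
  then have lim0: "(k' \<longlongrightarrow> z0) (at 0 within {x..0})" by (simp add: k'_def)
  have nb: "at 0 within {x..0} \<noteq> bot"
    using x by (simp add: at_within_Icc_at_left trivial_limit_at_left_real)
  have ev: "\<forall>\<^sub>F s in at 0 within {x..0}. s \<in> {x..<0}"
    by (auto simp: eventually_at_filter)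
  have "Im z0 = 0"
  proof (rule tendsto_unique[OF nb tendsto_Im[OF lim0]])
    show "((\<lambda>s. Im (k' s)) \<longlongrightarrow> 0) (at 0 within {x..0})"
      by (rule tendsto_eventually) (use ev in eventually_elim, auto simp: k'_def kreal)
  qed
  moreover have "Re z0 \<le> 0"
    by (rule tendsto_upperbound[OF tendsto_Re[OF lim0] _ nb])
       (rule eventually_mono[OF ev], use neg in \<open>force simp: k'_def\<close>)
  ultimately have z0r: "z0 = of_real (Re z0)" "Re z0 \<le> 0" by (auto simp: complex_eq_iff)
  have "(p \<longlongrightarrow> of_real (Re z0)) (at_UH 0)" using z0 by (subst (asm) z0r(1))
  then have "\<not> Re z0 < 0" using p_limit_negative by blast
  then have "Re z0 = 0" using z0r(2) by linarith
  then have "z0 = 0" using z0r(1) by (metis of_real_0)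
  then show False using no_zero_limit_at_0[OF r1] z0 by simp
qed

theorem boundary_limit:
  assumes "x < m" "x \<noteq> 0"
  shows "\<exists>z. (p \<longlongrightarrow> z) (at_UH x) \<and> Im z > 0"
proof -
  obtain z where z: "(p \<longlongrightarrow> z) (at_UH x)" using p_dichotomy p_not_infinite[OF assms] by blast
  then show ?thesis using limit_upper_pos[of x z] limit_upper_neg[of x z] assms by (cases "x > 0") auto
qed

end

section \<open>Herglotz representation with two exceptional boundary points\<close>

text \<open>
  The sets \<open>Y k\<close> and \<open>Z k\<close> shrink to two exceptional points, where the masses \<open>A\<close> and \<open>B\<close> may be left
  behind in the limit. They come from a subsequence chosen before the kernel \<open>K\<close>, hence do not
  depend on \<open>K\<close>.
\<close>
lemma concentration_limit:
  fixes u :: "nat \<Rightarrow> real \<Rightarrow> real" and v :: "real \<Rightarrow> real" and X Y Z :: "nat \<Rightarrow> real set"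
  assumes M: "finite_measure M"
    and meas: "\<And>k. X k \<in> sets M" "\<And>k. Y k \<in> sets M" "\<And>k. Z k \<in> sets M"
    and part: "\<And>k. space M = X k \<union> Y k \<union> Z k" "\<And>k. X k \<inter> Y k = {}" "\<And>k. X k \<inter> Z k = {}" "\<And>k. Y k \<inter> Z k = {}"
    and u_int: "\<And>k. integrable M (u k)" and u_nn: "\<And>k x. x \<in> space M \<Longrightarrow> 0 \<le> u k x"
    and mass: "\<And>k. integral\<^sup>L M (u k) = m0"
    and v_meas: "v \<in> borel_measurable M" and v_nn: "\<And>x. x \<in> space M \<Longrightarrow> 0 \<le> v x"
    and close: "\<And>k x. x \<in> X k \<Longrightarrow> \<bar>u k x - v x\<bar> \<le> \<eta> k" and eta: "\<eta> \<longlonglongrightarrow> 0" "\<And>k. 0 \<le> \<eta> k" "\<And>k. \<eta> k \<le> 1"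
    and cover: "AE x in M. \<forall>\<^sub>F k in sequentially. x \<in> X k"
  shows "integrable M v"
    and "\<exists>A B. A \<ge> 0 \<and> B \<ge> 0 \<and> (\<forall>(K :: real \<Rightarrow> complex) cY cZ C R.
          K \<in> borel_measurable M \<longrightarrow> (\<forall>x\<in>space M. norm (K x) \<le> C) \<longrightarrow>
          (\<forall>k. \<forall>x\<in>Y k. norm (K x - cY) \<le> C * \<eta> k) \<longrightarrow> (\<forall>k. \<forall>x\<in>Z k. norm (K x - cZ) \<le> C * \<eta> k) \<longrightarrow>
          (\<lambda>k. \<integral>x. of_real (u k x) * K x \<partial>M) \<longlonglongrightarrow> R \<longrightarrow>
          R = (\<integral>x. of_real (v x) * K x \<partial>M) + of_real A * cY + of_real B * cZ)"
proof -
  interpret finite_measure M by (rule M)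
  note [measurable] = meas v_meas
  have um[measurable]: "u k \<in> borel_measurable M" for k using u_int by blast
  have sub: "X k \<subseteq> space M" "Y k \<subseteq> space M" "Z k \<subseteq> space M" for k
    using part(1) by blast+
  have m0: "m0 \<ge> 0" using mass[of 0] u_nn by (metis Bochner_Integration.integral_nonneg)
  define V where "V = measure M (space M)"
  have V: "V \<ge> 0" by (simp add: V_def)
  have vX_int: "integrable M (\<lambda>x. indicator (X k) x * v x)" for k
  proof (rule Bochner_Integration.integrable_bound[of M "\<lambda>x. u k x + 1"])
    show "integrable M (\<lambda>x. u k x + 1)" using u_int by simp
    show "AE x in M. norm (indicator (X k) x * v x) \<le> norm (u k x + 1)"
    proof (rule AE_I2)
      fix x assume x: "x \<in> space M"
      show "norm (indicator (X k) x * v x) \<le> norm (u k x + 1)"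
        using close[of x k] eta(3)[of k] u_nn[OF x] v_nn[OF x] by (auto simp: indicator_def abs_le_iff)
    qed
  qed simp
  have vX_le: "(\<integral>x. indicator (X k) x * v x \<partial>M) \<le> m0 + V" for k
  proof -
    have "(\<integral>x. indicator (X k) x * v x \<partial>M) \<le> (\<integral>x. u k x + 1 \<partial>M)"
    proof (rule integral_mono[OF vX_int])
      fix x assume x: "x \<in> space M"
      show "indicator (X k) x * v x \<le> u k x + 1"
        using close[of x k] eta(3)[of k] u_nn[OF x] v_nn[OF x] by (auto simp: indicator_def abs_le_iff)
    qed (use u_int in simp)
    also have "\<dots> = m0 + V" using u_int mass by (simp add: V_def)
    finally show ?thesis .
  qed
  show v_int: "integrable M v"
  proof (rule integrableI_bounded)
    have "(\<integral>\<^sup>+x. ennreal (v x) \<partial>M) \<le> (\<integral>\<^sup>+x. liminf (\<lambda>k. ennreal (indicator (X k) x * v x)) \<partial>M)"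
    proof (rule nn_integral_mono_AE)
      show "AE x in M. ennreal (v x) \<le> liminf (\<lambda>k. ennreal (indicator (X k) x * v x))"
        using cover
      proof eventually_elim
        case (elim x)
        show ?case
          by (rule Liminf_bounded) (use elim in eventually_elim, simp)
      qed
    qed
    also have "\<dots> \<le> liminf (\<lambda>k. \<integral>\<^sup>+x. ennreal (indicator (X k) x * v x) \<partial>M)"
      by (rule nn_integral_liminf) simp
    also have "\<dots> \<le> liminf (\<lambda>k::nat. ennreal (m0 + V))"
    proof (rule Liminf_mono, rule always_eventually, rule allI)
      fix k
      have "(\<integral>\<^sup>+x. ennreal (indicator (X k) x * v x) \<partial>M) = ennreal (\<integral>x. indicator (X k) x * v x \<partial>M)"
        by (rule nn_integral_eq_integral[OF vX_int]) (auto intro!: AE_I2 mult_nonneg_nonneg v_nn)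
      also have "\<dots> \<le> ennreal (m0 + V)" using vX_le by (rule ennreal_leI)
      finally show "(\<integral>\<^sup>+x. ennreal (indicator (X k) x * v x) \<partial>M) \<le> ennreal (m0 + V)" .
    qed
    also have "\<dots> = ennreal (m0 + V)" by (simp add: Liminf_const)
    also have "\<dots> < \<infinity>" by simp
    finally have "(\<integral>\<^sup>+x. ennreal (v x) \<partial>M) < \<infinity>" .
    moreover have "(\<integral>\<^sup>+x. ennreal (norm (v x)) \<partial>M) = (\<integral>\<^sup>+x. ennreal (v x) \<partial>M)"
      by (rule nn_integral_cong) (simp add: v_nn)
    ultimately show "(\<integral>\<^sup>+x. ennreal (norm (v x)) \<partial>M) < \<infinity>" by simp
  qed simp
  define a where "a = (\<lambda>k. \<integral>x. indicator (Y k) x * u k x \<partial>M)"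
  define b where "b = (\<lambda>k. \<integral>x. indicator (Z k) x * u k x \<partial>M)"
  have ind_int: "integrable M (\<lambda>x. indicator S x * u k x)" if "S \<in> sets M" for S k
    using integrable_mult_indicator[OF that u_int[of k]] by simp
  have ab: "a k \<in> {0..m0}" "b k \<in> {0..m0}" for k
  proof -
    have "(\<integral>x. indicator S x * u k x \<partial>M) \<in> {0..m0}" if S: "S \<in> sets M" for S
    proof -
      have "(\<integral>x. indicator S x * u k x \<partial>M) \<le> integral\<^sup>L M (u k)"
        by (rule integral_mono[OF ind_int[OF S] u_int]) (auto simp: indicator_def u_nn)
      moreover have "0 \<le> (\<integral>x. indicator S x * u k x \<partial>M)"
        by (rule Bochner_Integration.integral_nonneg) (auto simp: indicator_def u_nn)
      ultimately show ?thesis using mass by simp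
    qed
    then show "a k \<in> {0..m0}" "b k \<in> {0..m0}" using meas by (auto simp: a_def b_def)
  qed
  have "compact ({0..m0} \<times> {0..m0})" by (intro compact_Times compact_Icc)
  then have "\<exists>l\<in>{0..m0} \<times> {0..m0}. \<exists>\<sigma>. strict_mono \<sigma> \<and> ((\<lambda>k. (a k, b k)) \<circ> \<sigma>) \<longlonglongrightarrow> l"
    unfolding compact_def by (elim allE[of _ "\<lambda>k. (a k, b k)"]) (use ab in auto)
  then obtain l \<sigma> where \<sigma>: "l \<in> {0..m0} \<times> {0..m0}" "strict_mono \<sigma>" "((\<lambda>k. (a k, b k)) \<circ> \<sigma>) \<longlonglongrightarrow> l"
    by blast
  define A where "A = fst l"
  define B where "B = snd l"
  have AB: "A \<ge> 0" "B \<ge> 0" "(\<lambda>k. a (\<sigma> k)) \<longlonglongrightarrow> A" "(\<lambda>k. b (\<sigma> k)) \<longlonglongrightarrow> B"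
  proof -
    show "A \<ge> 0" "B \<ge> 0" using \<sigma>(1) unfolding A_def B_def by (simp_all add: mem_Times_iff)
    show "(\<lambda>k. a (\<sigma> k)) \<longlonglongrightarrow> A" using tendsto_fst[OF \<sigma>(3)] unfolding A_def by (simp add: o_def)
    show "(\<lambda>k. b (\<sigma> k)) \<longlonglongrightarrow> B" using tendsto_snd[OF \<sigma>(3)] unfolding B_def by (simp add: o_def)
  qed
  have "R = (\<integral>x. of_real (v x) * K x \<partial>M) + of_real A * cY + of_real B * cZ"
    if Km[measurable]: "K \<in> borel_measurable M" and KC: "\<forall>x\<in>space M. norm (K x) \<le> C"
      and KY: "\<forall>k. \<forall>x\<in>Y k. norm (K x - cY) \<le> C * \<eta> k" and KZ: "\<forall>k. \<forall>x\<in>Z k. norm (K x - cZ) \<le> C * \<eta> k"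
      and R: "(\<lambda>k. \<integral>x. of_real (u k x) * K x \<partial>M) \<longlonglongrightarrow> R" for K :: "real \<Rightarrow> complex" and cY cZ C R
  proof -
    define C' where "C' = max C 0"
    have C': "C' \<ge> 0" "C \<le> C'" by (auto simp: C'_def)
    have KC': "norm (K x) \<le> C'" if "x \<in> space M" for x using KC that C' by force
    have int_gen: "integrable M (\<lambda>x. complex_of_real (g x) * G x)"
      if "integrable M g" "G \<in> borel_measurable M" "\<And>x. x \<in> space M \<Longrightarrow> norm (G x) \<le> D"
      for g :: "real \<Rightarrow> real" and G :: "real \<Rightarrow> complex" and D
    proof (rule Bochner_Integration.integrable_bound[of M "\<lambda>x. D * norm (g x)"])
      show "integrable M (\<lambda>x. D * norm (g x))" using that(1) by auto
      show "(\<lambda>x. complex_of_real (g x) * G x) \<in> borel_measurable M" using that(1,2) by measurable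
      show "AE x in M. norm (complex_of_real (g x) * G x) \<le> norm (D * norm (g x))"
      proof (rule AE_I2)
        fix x assume "x \<in> space M"
        then have "norm (G x) \<le> \<bar>D\<bar>" using that(3) by force
        then show "norm (complex_of_real (g x) * G x) \<le> norm (D * norm (g x))"
          by (simp add: norm_mult abs_mult mult.commute[of "\<bar>D\<bar>"] mult_left_mono)
      qed
    qed
    have Kind: "(\<lambda>x. indicator S x * K x) \<in> borel_measurable M" "\<And>x. x \<in> space M \<Longrightarrow> norm (indicator S x * K x) \<le> C'"
      if "S \<in> sets M" for S
      using that KC' C' by (auto simp: indicator_def)
    define I where "I = (\<lambda>S k. \<integral>x. of_real (u k x) * (indicator S x * K x) \<partial>M)"
    have split: "(\<integral>x. of_real (u k x) * K x \<partial>M) = I (X k) k + I (Y k) k + I (Z k) k" for k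
    proof -
      have "(\<integral>x. of_real (u k x) * K x \<partial>M) = (\<integral>x. of_real (u k x) * (indicator (X k) x * K x) + 
          of_real (u k x) * (indicator (Y k) x * K x) + of_real (u k x) * (indicator (Z k) x * K x) \<partial>M)"
      proof (rule Bochner_Integration.integral_cong[OF refl])
        fix x assume "x \<in> space M"
        then have "x \<in> X k \<and> x \<notin> Y k \<and> x \<notin> Z k \<or> x \<notin> X k \<and> x \<in> Y k \<and> x \<notin> Z k \<or> x \<notin> X k \<and> x \<notin> Y k \<and> x \<in> Z k"
          using part(1)[of k] part(2)[of k] part(3)[of k] part(4)[of k] by blast
        then show "of_real (u k x) * K x = of_real (u k x) * (indicator (X k) x * K x) +
            of_real (u k x) * (indicator (Y k) x * K x) + of_real (u k x) * (indicator (Z k) x * K x)"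
          by (elim disjE) simp_all
      qed
      also have "\<dots> = I (X k) k + I (Y k) k + I (Z k) k"
      proof -
        have i: "integrable M (\<lambda>x. of_real (u k x) * (indicator S x * K x))" if "S \<in> sets M" for S
          by (rule int_gen[OF u_int Kind[OF that]])
        show ?thesis unfolding I_def
          by (simp only: Bochner_Integration.integral_add Bochner_Integration.integrable_add i meas)
      qed
      finally show ?thesis .
    qed
    have arc: "norm (I S k - of_real (\<integral>x. indicator S x * u k x \<partial>M) * c) \<le> C' * \<eta> k * m0"
      if S: "S \<in> sets M" "\<And>x. x \<in> S \<Longrightarrow> norm (K x - c) \<le> C * \<eta> k" for S k c
    proof -
      have "I S k - of_real (\<integral>x. indicator S x * u k x \<partial>M) * c =
          (\<integral>x. of_real (u k x) * (indicator S x * K x) - of_real (indicator S x * u k x) * c \<partial>M)"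
      proof -
        have "of_real (\<integral>x. indicator S x * u k x \<partial>M) * c = (\<integral>x. of_real (indicator S x * u k x) * c \<partial>M)"
          by (simp only: integral_complex_of_real[symmetric] integral_mult_left_zero)
        moreover have "integrable M (\<lambda>x. of_real (indicator S x * u k x) * c)"
          using ind_int[OF S(1), of k] by (intro integrable_mult_left integrable_of_real)
        ultimately show ?thesis unfolding I_def
          by (simp only: Bochner_Integration.integral_diff[OF int_gen[OF u_int Kind[OF S(1)]]])
      qed
      also have "norm \<dots> \<le> (\<integral>x. C' * \<eta> k * u k x \<partial>M)"
      proof (rule Bochner_Integration.integral_norm_bound_integral)
        show "integrable M (\<lambda>x. of_real (u k x) * (indicator S x * K x) - of_real (indicator S x * u k x) * c)"
          using int_gen[OF u_int Kind[OF S(1)], of k] ind_int[OF S(1), of k]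
          by (intro Bochner_Integration.integrable_diff integrable_mult_left integrable_of_real)
        show "integrable M (\<lambda>x. C' * \<eta> k * u k x)" using u_int by simp
        fix x assume x: "x \<in> space M"
        have "C * \<eta> k \<le> C' * \<eta> k" using C' eta(2) by (intro mult_right_mono) auto
        then have "norm (K x - c) \<le> C' * \<eta> k" if "x \<in> S" using S(2)[OF that] by linarith
        then have "u k x * norm (K x - c) \<le> u k x * (C' * \<eta> k)" if "x \<in> S"
          using that u_nn[OF x] by (intro mult_left_mono) auto
        moreover have "norm (complex_of_real (u k x) * K x - of_real (u k x) * c) = u k x * norm (K x - c)"
          using u_nn[OF x, of k] by (metis abs_of_nonneg norm_mult norm_of_real right_diff_distrib)
        moreover have "0 \<le> u k x * (C' * \<eta> k)" using u_nn[OF x] C' eta(2) by simp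
        ultimately show "norm (of_real (u k x) * (indicator S x * K x) - of_real (indicator S x * u k x) * c) \<le> C' * \<eta> k * u k x"
          by (auto simp: indicator_def mult_ac)
      qed
      also have "\<dots> = C' * \<eta> k * m0" using mass by simp
      finally show ?thesis .
    qed
    have e0: "(\<lambda>k. C' * \<eta> (\<sigma> k) * m0) \<longlonglongrightarrow> 0"
      using LIMSEQ_subseq_LIMSEQ[OF eta(1) \<sigma>(2)] by (auto simp: o_def intro!: tendsto_eq_intros)
    have limY: "(\<lambda>k. I (Y (\<sigma> k)) (\<sigma> k)) \<longlonglongrightarrow> of_real A * cY"
    proof -
      have "(\<lambda>k. I (Y (\<sigma> k)) (\<sigma> k) - of_real (a (\<sigma> k)) * cY) \<longlonglongrightarrow> 0"
        by (rule Lim_null_comparison[OF _ e0]) (use arc[OF meas(2)] KY in \<open>auto simp: a_def\<close>)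
      moreover have "(\<lambda>k. of_real (a (\<sigma> k)) * cY) \<longlonglongrightarrow> of_real A * cY" by (intro tendsto_intros AB)
      ultimately show ?thesis using tendsto_add by fastforce
    qed
    have limZ: "(\<lambda>k. I (Z (\<sigma> k)) (\<sigma> k)) \<longlonglongrightarrow> of_real B * cZ"
    proof -
      have "(\<lambda>k. I (Z (\<sigma> k)) (\<sigma> k) - of_real (b (\<sigma> k)) * cZ) \<longlonglongrightarrow> 0"
        by (rule Lim_null_comparison[OF _ e0]) (use arc[OF meas(3)] KZ in \<open>auto simp: b_def\<close>)
      moreover have "(\<lambda>k. of_real (b (\<sigma> k)) * cZ) \<longlonglongrightarrow> of_real B * cZ" by (intro tendsto_intros AB)
      ultimately show ?thesis using tendsto_add by fastforce
    qed
    have limX: "(\<lambda>k. I (X k) k) \<longlonglongrightarrow> (\<integral>x. of_real (v x) * K x \<partial>M)"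
    proof -
      have d1: "(\<lambda>k. \<integral>x. of_real (v x) * (indicator (X k) x * K x) \<partial>M) \<longlonglongrightarrow> (\<integral>x. of_real (v x) * K x \<partial>M)"
      proof (rule integral_dominated_convergence[where w="\<lambda>x. C' * v x"])
        show "integrable M (\<lambda>x. C' * v x)" using v_int by simp
        show "AE x in M. (\<lambda>k. of_real (v x) * (indicator (X k) x * K x)) \<longlonglongrightarrow> of_real (v x) * K x"
          using cover
        proof eventually_elim
          case (elim x)
          show ?case by (rule tendsto_eventually) (use elim in eventually_elim, simp)
        qed
        show "AE x in M. norm (of_real (v x) * (indicator (X k) x * K x)) \<le> C' * v x" for k
        proof (rule AE_I2)
          fix x assume x: "x \<in> space M"
          show "norm (of_real (v x) * (indicator (X k) x * K x)) \<le> C' * v x"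
            using mult_left_mono[OF Kind(2)[OF meas(1) x, of k] v_nn[OF x]] v_nn[OF x] by (simp add: norm_mult mult.commute)
        qed
      qed simp_all
      have d2: "(\<lambda>k. I (X k) k - (\<integral>x. of_real (v x) * (indicator (X k) x * K x) \<partial>M)) \<longlonglongrightarrow> 0"
      proof (rule Lim_null_comparison)
        show "(\<lambda>k. C' * \<eta> k * V) \<longlonglongrightarrow> 0" using eta(1) by (auto intro!: tendsto_eq_intros)
        have "norm (I (X k) k - (\<integral>x. of_real (v x) * (indicator (X k) x * K x) \<partial>M)) \<le> C' * \<eta> k * V" for k
        proof -
          have i: "integrable M (\<lambda>x. of_real (u k x) * (indicator (X k) x * K x))"
            "integrable M (\<lambda>x. of_real (v x) * (indicator (X k) x * K x))"
            using int_gen[OF u_int Kind[OF meas(1)]] int_gen[OF v_int Kind[OF meas(1)]] by auto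
          have "norm (I (X k) k - (\<integral>x. of_real (v x) * (indicator (X k) x * K x) \<partial>M)) =
              norm (\<integral>x. of_real (u k x) * (indicator (X k) x * K x) - of_real (v x) * (indicator (X k) x * K x) \<partial>M)"
            unfolding I_def using i by simp
          also have "\<dots> \<le> (\<integral>x. C' * \<eta> k \<partial>M)"
          proof (rule Bochner_Integration.integral_norm_bound_integral)
            fix x assume x: "x \<in> space M"
            have "\<bar>u k x - v x\<bar> * norm (K x) \<le> \<eta> k * C'" if "x \<in> X k"
              using close[OF that] KC'[OF x] eta(2) by (intro mult_mono) auto
            moreover have "norm (of_real (u k x) * K x - of_real (v x) * K x) = \<bar>u k x - v x\<bar> * norm (K x)"
              by (metis left_diff_distrib norm_mult norm_of_real of_real_diff)
            moreover have "0 \<le> \<eta> k * C'" using eta(2) C' by simp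
            ultimately show "norm (of_real (u k x) * (indicator (X k) x * K x) - of_real (v x) * (indicator (X k) x * K x)) \<le> C' * \<eta> k"
              by (auto simp: indicator_def mult_ac)
          qed (use i in auto)
          also have "\<dots> = C' * \<eta> k * V" by (simp add: V_def)
          finally show ?thesis .
        qed
        then show "\<forall>\<^sub>F k in sequentially. norm (I (X k) k - (\<integral>x. of_real (v x) * (indicator (X k) x * K x) \<partial>M)) \<le> C' * \<eta> k * V"
          by simp
      qed
      show ?thesis using tendsto_add[OF d2 d1] by simp
    qed
    have "(\<lambda>k. I (X (\<sigma> k)) (\<sigma> k) + I (Y (\<sigma> k)) (\<sigma> k) + I (Z (\<sigma> k)) (\<sigma> k)) \<longlonglongrightarrow>
        (\<integral>x. of_real (v x) * K x \<partial>M) + of_real A * cY + of_real B * cZ"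
      using LIMSEQ_subseq_LIMSEQ[OF limX \<sigma>(2)] by (intro tendsto_add limY limZ) (simp add: o_def)
    moreover have "(\<lambda>k. I (X (\<sigma> k)) (\<sigma> k) + I (Y (\<sigma> k)) (\<sigma> k) + I (Z (\<sigma> k)) (\<sigma> k)) \<longlonglongrightarrow> R"
      using LIMSEQ_subseq_LIMSEQ[OF R \<sigma>(2)] by (simp add: o_def split)
    ultimately show ?thesis using LIMSEQ_unique by blast
  qed
  then show "\<exists>A B. A \<ge> 0 \<and> B \<ge> 0 \<and> (\<forall>(K :: real \<Rightarrow> complex) cY cZ C R.
          K \<in> borel_measurable M \<longrightarrow> (\<forall>x\<in>space M. norm (K x) \<le> C) \<longrightarrow>
          (\<forall>k. \<forall>x\<in>Y k. norm (K x - cY) \<le> C * \<eta> k) \<longrightarrow> (\<forall>k. \<forall>x\<in>Z k. norm (K x - cZ) \<le> C * \<eta> k) \<longrightarrow>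
          (\<lambda>k. \<integral>x. of_real (u k x) * K x \<partial>M) \<longlonglongrightarrow> R \<longrightarrow>
          R = (\<integral>x. of_real (v x) * K x \<partial>M) + of_real A * cY + of_real B * cZ)"
    using AB by (intro exI[of _ A] exI[of _ B]) blast
qed

lemma boundary_extension_continuous_on:
  fixes Q k :: "'a::metric_space \<Rightarrow> 'b::metric_space"
  assumes D: "open D" and Q: "continuous_on D Q"
    and lim: "\<And>s. s \<in> S \<Longrightarrow> (Q \<longlongrightarrow> k s) (at s within D)"
    and nb: "\<And>s. s \<in> S \<Longrightarrow> at s within D \<noteq> bot"
    and disj: "D \<inter> S = {}"
  shows "continuous_on (D \<union> S) (\<lambda>w. if w \<in> D then Q w else k w)"
  unfolding continuous_on_iff
proof (intro ballI allI impI)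
  fix s and e :: real assume s: "s \<in> D \<union> S" and e: "e > 0"
  let ?E = "\<lambda>w. if w \<in> D then Q w else k w"
  show "\<exists>d>0. \<forall>x'\<in>D \<union> S. dist x' s < d \<longrightarrow> dist (?E x') (?E s) < e"
  proof (cases "s \<in> D")
    case True
    obtain d1 where d1: "d1 > 0" "\<And>w. dist w s < d1 \<Longrightarrow> w \<in> D"
      using D True by (auto simp: open_dist)
    obtain d2 where d2: "d2 > 0" "\<And>w. w \<in> D \<Longrightarrow> dist w s < d2 \<Longrightarrow> dist (Q w) (Q s) < e"
      using Q True e unfolding continuous_on_iff by blast
    show ?thesis by (intro exI[of _ "min d1 d2"]) (use d1 d2 True in auto)
  next
    case False
    then have sS: "s \<in> S" using s by simp
    obtain d where d: "d > 0" "\<And>w. w \<in> D \<Longrightarrow> w \<noteq> s \<Longrightarrow> dist w s < d \<Longrightarrow> dist (Q w) (k s) < e/2"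
      using tendstoD[OF lim[OF sS], of "e/2"] e by (auto simp: eventually_at)
    have dD: "dist (Q w) (k s) < e/2" if "w \<in> D" "dist w s < d" for w
      using d(2)[OF that(1) _ that(2)] False that by auto
    have dS: "dist (k s') (k s) < e" if s': "s' \<in> S" "dist s' s < d" for s'
    proof -
      have "\<forall>\<^sub>F w in at s' within D. dist (Q w) (k s) \<le> e/2"
        unfolding eventually_at
      proof (intro exI[of _ "d - dist s' s"] conjI ballI impI)
        fix w assume w: "w \<in> D" "w \<noteq> s' \<and> dist w s' < d - dist s' s"
        then have "dist w s < d" using dist_triangle[of w s s'] by simp
        then show "dist (Q w) (k s) \<le> e/2" using dD w by force
      qed (use s' in simp)
      moreover have "((\<lambda>w. dist (Q w) (k s)) \<longlongrightarrow> dist (k s') (k s)) (at s' within D)"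
        by (intro tendsto_intros lim s')
      ultimately have "dist (k s') (k s) \<le> e/2"
        using tendsto_upperbound nb[OF s'(1)] by blast
      then show ?thesis using e by simp
    qed
    show ?thesis
      by (intro exI[of _ d]) (use d(1) dD dS False disj e in \<open>force\<close>)
  qed
qed

lemma schwarz_formula:
  assumes Q: "Q holomorphic_on ball 0 1" and \<rho>: "0 < \<rho>" "\<rho> < 1" and z: "norm z < 1"
  shows "((\<lambda>t. of_real (Im (Q (of_real \<rho> * cis t))) * (cis t / (cis t - z))) has_integral
            - \<i> * of_real pi * (Q (of_real \<rho> * z) - cnj (Q 0))) {0..2 * pi}"
proof -
  define G where "G = (\<lambda>u. Q (of_real \<rho> * u))"
  have sub: "(\<lambda>u. of_real \<rho> * u) ` cball 0 1 \<subseteq> ball (0::complex) 1"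
  proof safe
    fix u :: complex assume "u \<in> cball 0 1"
    then have "\<rho> * norm u \<le> \<rho> * 1" using \<rho> by (intro mult_left_mono) auto
    then have "\<rho> * norm u < 1" using \<rho> by linarith
    then show "of_real \<rho> * u \<in> ball 0 1" using \<rho> by (simp add: norm_mult)
  qed
  have G: "G holomorphic_on cball 0 1"
    unfolding G_def by (intro holomorphic_on_compose_gen[OF _ Q, unfolded o_def] holomorphic_intros sub)
  have cis0: "cis t \<noteq> 0" for t by simp
  have ne1: "cis t - z \<noteq> 0" for t using z by (metis norm_cis eq_iff_diff_eq_0 less_irrefl)
  have ne2: "1 - cnj z * u \<noteq> 0" if "norm u \<le> 1" for u
  proof
    assume "1 - cnj z * u = 0"
    then have "norm (cnj z * u) = 1" by (metis eq_iff_diff_eq_0 norm_one)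
    moreover have "norm z * norm u \<le> norm z * 1" using that by (intro mult_left_mono) auto
    ultimately show False using z by (simp add: norm_mult)
  qed
  have circ: "(F has_contour_integral I) (circlepath 0 1) \<longleftrightarrow> ((\<lambda>t. F (cis t) * \<i> * cis t) has_integral I) {0..2*pi}" for F I
    unfolding circlepath_def using has_contour_integral_part_circlepath_iff[of 0 "2*pi" F I 0 1] by simp
  have "((\<lambda>u. G u / (u - z)) has_contour_integral (2 * of_real pi * \<i> * G z)) (circlepath 0 1)"
    by (rule Cauchy_integral_circlepath_simple[OF G]) (use z in simp)
  then have "((\<lambda>t. G (cis t) / (cis t - z) * \<i> * cis t) has_integral (2 * of_real pi * \<i> * G z)) {0..2*pi}"
    by (simp add: circ)
  from has_integral_mult_right[OF this, of "- \<i>"]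
  have 1: "((\<lambda>t. G (cis t) * (cis t / (cis t - z))) has_integral (2 * of_real pi * G z)) {0..2*pi}"
    by (simp add: mult_ac)
  have "(\<lambda>u. G u / (1 - cnj z * u)) holomorphic_on cball 0 1"
    using ne2 by (intro holomorphic_intros G) auto
  from Cauchy_integral_circlepath_simple[OF this, of 0]
  have "((\<lambda>u. G u / (1 - cnj z * u) / u) has_contour_integral (2 * of_real pi * \<i> * G 0)) (circlepath 0 1)"
    by simp
  then have "((\<lambda>t. G (cis t) / (1 - cnj z * cis t) / cis t * \<i> * cis t) has_integral (2 * of_real pi * \<i> * G 0)) {0..2*pi}"
    by (simp only: circ)
  from has_integral_mult_right[OF this, of "- \<i>"]
  have "((\<lambda>t. G (cis t) / (1 - cnj z * cis t)) has_integral (2 * of_real pi * G 0)) {0..2*pi}"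
    by (simp add: mult_ac)
  from has_integral_linear[OF this bounded_linear_cnj]
  have "((\<lambda>t. cnj (G (cis t)) / (1 - z * cnj (cis t))) has_integral (2 * of_real pi * cnj (G 0))) {0..2*pi}"
    by (simp add: o_def)
  moreover have "cnj (G (cis t)) / (1 - z * cnj (cis t)) = cnj (G (cis t)) * (cis t / (cis t - z))" for t
  proof -
    have "cis t * cnj (cis t) = 1" by (simp add: cis_cnj cis_mult)
    then have "cis t * (1 - z * cnj (cis t)) = cis t - z" by (simp add: algebra_simps)
    then have "1 - z * cnj (cis t) = (cis t - z) / cis t" by (simp add: field_simps)
    then show ?thesis by simp
  qed
  ultimately have 2: "((\<lambda>t. cnj (G (cis t)) * (cis t / (cis t - z))) has_integral (2 * of_real pi * cnj (G 0))) {0..2*pi}"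
    by simp
  have main: "((\<lambda>t. (G (cis t) * (cis t / (cis t - z)) - cnj (G (cis t)) * (cis t / (cis t - z))) * (1 / (2 * \<i>)))
     has_integral ((2 * of_real pi * G z - 2 * of_real pi * cnj (G 0)) * (1 / (2 * \<i>)))) {0..2*pi}"
    by (intro has_integral_mult_left has_integral_diff 1 2)
  have eq1: "(G (cis t) * (cis t / (cis t - z)) - cnj (G (cis t)) * (cis t / (cis t - z))) * (1 / (2 * \<i>)) =
     of_real (Im (G (cis t))) * (cis t / (cis t - z))" for t
  proof -
    have "G (cis t) - cnj (G (cis t)) = of_real (Im (G (cis t))) * (2 * \<i>)"
      by (simp add: complex_eq_iff)
    then have e: "G (cis t) = cnj (G (cis t)) + of_real (Im (G (cis t))) * (2 * \<i>)" by (simp only: diff_eq_eq add.commute)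
    have "((c + y * (2 * \<i>)) * v - c * v) * (1 / (2 * \<i>)) = y * v" for c y v :: complex
      by (simp add: field_simps)
    from this[of "cnj (G (cis t))" "of_real (Im (G (cis t)))" "cis t / (cis t - z)", folded e] show ?thesis .
  qed
  have eq2: "(2 * of_real pi * G z - 2 * of_real pi * cnj (G 0)) * (1 / (2 * \<i>)) = - \<i> * of_real pi * (G z - cnj (G 0))"
    by (simp add: field_simps)
  have "((\<lambda>t. of_real (Im (G (cis t))) * (cis t / (cis t - z))) has_integral - \<i> * of_real pi * (G z - cnj (G 0))) {0..2*pi}"
    using main by (simp only: eq1 eq2)
  then show ?thesis unfolding G_def by (simp only: mult_zero_right)
qed

lemma cis_eq_minus_1_imp: assumes "0 \<le> t" "t \<le> 2 * pi" "cis t = -1" shows "t = pi"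
proof -
  have "cos t = -1" using assms(3) by (metis Re_complex_of_real cis.sel(1) of_real_1 of_real_minus)
  then obtain n :: int where n: "t = of_int (2 * n + 1) * pi"
    using cos_eq_minus1 by (auto simp: mult_ac algebra_simps)
  have e: "of_int (2 * n + 1) = t / pi" using n by simp
  have "of_int (2 * n + 1) \<ge> (0::real)" using assms(1) unfolding e by simp
  moreover have "of_int (2 * n + 1) \<le> (2::real)" using assms(2) unfolding e by (simp add: divide_le_eq)
  ultimately have "2 * n + 1 \<ge> 0" "2 * n + 1 \<le> 2" by linarith+
  then have "n = 0" by presburger
  then show ?thesis using n by simp
qed

lemma cis_eq_1_imp: assumes "0 \<le> t" "t \<le> 2 * pi" "cis t = 1" shows "t = 0 \<or> t = 2 * pi"
proof -
  have "cos t = 1" using assms(3) by (metis Re_complex_of_real cis.sel(1) of_real_1)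
  then obtain n :: int where n: "t = of_int n * (2 * pi)"
    using cos_one_2pi_int by (auto simp: mult_ac)
  have e: "of_int n = t / (2 * pi)" using n by simp
  have "of_int n \<ge> (0::real)" using assms(1) unfolding e by simp
  moreover have "of_int n \<le> (1::real)" using assms(2) unfolding e by simp
  ultimately have "n \<ge> 0" "n \<le> 1" by linarith+
  then have "n = 0 \<or> n = 1" by presburger
  then show ?thesis using n by auto
qed

theorem herglotz_disc:
  assumes Q: "Q holomorphic_on ball 0 1" and nn: "\<And>z. norm z < 1 \<Longrightarrow> Im (Q z) \<ge> 0"
    and lim: "\<And>s. norm s = 1 \<Longrightarrow> s \<noteq> 1 \<Longrightarrow> s \<noteq> -1 \<Longrightarrow> (Q \<longlongrightarrow> q s) (at s within ball 0 1)"
  defines "v \<equiv> \<lambda>t. if t \<in> {0, pi, 2 * pi} then 0 else Im (q (cis t))"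
  shows "set_integrable lborel {0..2 * pi} v"
    and "\<exists>A B. A \<ge> 0 \<and> B \<ge> 0 \<and> (\<forall>z. norm z < 1 \<longrightarrow>
       - \<i> * of_real pi * (Q z - cnj (Q 0)) =
         (LINT t:{0..2*pi}|lborel. of_real (v t) * (cis t / (cis t - z))) + of_real A / (1 - z) + of_real B / (1 + z))"
proof -
  let ?I = "{0..2 * pi}"
  define M where "M = restrict_space lborel ?I"
  have spM: "space M = ?I" by (simp add: M_def)
  have finM: "finite_measure M"
    by (rule finite_measureI) (simp add: M_def emeasure_restrict_space)
  define \<eta> where "\<eta> = (\<lambda>k::nat. 1 / (real k + 2))"
  have eta: "\<eta> \<longlonglongrightarrow> 0" "\<And>k. 0 < \<eta> k" "\<And>k. \<eta> k < 1"
  proof -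
    have "(\<lambda>k. inverse (real (Suc (Suc k)))) \<longlonglongrightarrow> 0"
      by (rule LIMSEQ_Suc[OF LIMSEQ_inverse_real_of_nat])
    then show "\<eta> \<longlonglongrightarrow> 0" by (simp add: \<eta>_def inverse_eq_divide add.commute)
  qed (auto simp: \<eta>_def)
  define Y where "Y = (\<lambda>k. {t\<in>?I. norm (cis t - 1) < \<eta> k})"
  define Z where "Z = (\<lambda>k. {t\<in>?I. norm (cis t + 1) < \<eta> k})"
  define X where "X = (\<lambda>k. {t\<in>?I. norm (cis t - 1) \<ge> \<eta> k \<and> norm (cis t + 1) \<ge> \<eta> k})"
  have YZ: "Y k \<inter> Z k = {}" for k
  proof -
    have False if "norm (cis t - 1) < \<eta> k" "norm (cis t + 1) < \<eta> k" for t
      using norm_triangle_ineq4[of "cis t + 1" "cis t - 1"] that eta(3)[of k] by simp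
    then show ?thesis by (auto simp: Y_def Z_def)
  qed
  have setsM: "X k \<in> sets M" "Y k \<in> sets M" "Z k \<in> sets M" for k
  proof -
    have "closed {t. norm (cis t - 1) \<ge> \<eta> k \<and> norm (cis t + 1) \<ge> \<eta> k}"
      by (intro closed_Collect_conj closed_Collect_le continuous_intros)
    moreover have "open {t. norm (cis t - 1) < \<eta> k}" "open {t. norm (cis t + 1) < \<eta> k}"
      by (intro open_Collect_less continuous_intros)+
    moreover have "X k = ?I \<inter> {t. norm (cis t - 1) \<ge> \<eta> k \<and> norm (cis t + 1) \<ge> \<eta> k}"
      "Y k = ?I \<inter> {t. norm (cis t - 1) < \<eta> k}" "Z k = ?I \<inter> {t. norm (cis t + 1) < \<eta> k}"
      by (auto simp: X_def Y_def Z_def)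
    ultimately show "X k \<in> sets M" "Y k \<in> sets M" "Z k \<in> sets M"
      unfolding M_def by (simp_all add: sets_restrict_space_iff borel_closed borel_open sets.Int)
  qed
  define S where "S = sphere (0::complex) 1 - {1, -1}"
  define E where "E = (\<lambda>w. if w \<in> ball 0 1 then Q w else q w)"
  have Econt: "continuous_on (ball 0 1 \<union> S) E"
    unfolding E_def
  proof (rule boundary_extension_continuous_on)
    show "at s within ball 0 1 \<noteq> bot" if "s \<in> S" for s
    proof -
      have "s \<in> closure (ball 0 1)" using that by (simp add: S_def)
      moreover have "s \<notin> ball 0 1" using that by (simp add: S_def)
      ultimately have "s islimpt ball 0 1" by (simp add: closure_def)
      then show ?thesis by (simp add: trivial_limit_within)
    qed
  qed (use Q lim in \<open>auto simp: S_def holomorphic_on_imp_continuous_on\<close>)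
  have Xcompact: "compact (X k)" for k
  proof -
    have "X k = ?I \<inter> ((\<lambda>t. norm (cis t - 1)) -` {\<eta> k..} \<inter> (\<lambda>t. norm (cis t + 1)) -` {\<eta> k..})"
      by (auto simp: X_def)
    then show ?thesis
      by (auto intro!: compact_Int_closed closed_Int closed_vimage continuous_intros)
  qed
  have cisS: "cis t \<in> S" if "t \<in> X k" for t k
    using that eta(2)[of k] by (auto simp: X_def S_def)
  have approx: "\<exists>\<rho>. 0 < \<rho> \<and> \<rho> < 1 \<and> 1 - \<eta> k \<le> \<rho> \<and> (\<forall>t\<in>X k. \<bar>Im (Q (of_real \<rho> * cis t)) - Im (q (cis t))\<bar> \<le> \<eta> k)" for k
  proof -
    define KK where "KK = (\<lambda>(\<rho>, t). complex_of_real \<rho> * cis t) ` ({1/2..1} \<times> X k)"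
    have "compact KK" unfolding KK_def
      by (intro compact_continuous_image compact_Times compact_Icc Xcompact)
         (auto simp: case_prod_beta intro!: continuous_intros)
    have KKsub: "KK \<subseteq> ball 0 1 \<union> S"
    proof
      fix w assume "w \<in> KK"
      then obtain \<rho> t where w: "w = of_real \<rho> * cis t" "1/2 \<le> \<rho>" "\<rho> \<le> 1" "t \<in> X k" by (auto simp: KK_def)
      show "w \<in> ball 0 1 \<union> S"
      proof (cases "\<rho> = 1")
        case True
        then show ?thesis using cisS w by simp
      next
        case False
        then show ?thesis using w by (simp add: norm_mult)
      qed
    qed
    have "uniformly_continuous_on KK E"
      by (rule compact_uniformly_continuous[OF continuous_on_subset[OF Econt KKsub] \<open>compact KK\<close>])
    then obtain d where d: "d > 0" "\<And>x x'. x \<in> KK \<Longrightarrow> x' \<in> KK \<Longrightarrow> dist x' x < d \<Longrightarrow> dist (E x') (E x) < \<eta> k"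
      using eta(2)[of k] unfolding uniformly_continuous_on_def by metis
    define \<rho> where "\<rho> = max (1 - d/2) (max (1 - \<eta> k) (1/2))"
    have \<rho>: "1/2 \<le> \<rho>" "\<rho> < 1" "1 - \<eta> k \<le> \<rho>" "1 - \<rho> < d" 
      using d(1) eta(2)[of k] unfolding \<rho>_def by linarith+
    have "\<bar>Im (Q (of_real \<rho> * cis t)) - Im (q (cis t))\<bar> \<le> \<eta> k" if t: "t \<in> X k" for t
    proof -
      have "of_real \<rho> * cis t \<in> KK" using t \<rho> by (auto simp: KK_def intro!: image_eqI[of _ _ "(\<rho>, t)"])
      moreover have "cis t \<in> KK" using t by (auto simp: KK_def intro!: image_eqI[of _ _ "(1, t)"])
      moreover have "dist (of_real \<rho> * cis t) (cis t) < d"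
      proof -
        have "of_real \<rho> * cis t - cis t = of_real (\<rho> - 1) * cis t" by (simp add: algebra_simps)
        then have "dist (of_real \<rho> * cis t) (cis t) = \<bar>\<rho> - 1\<bar>"
          by (simp only: dist_norm norm_mult norm_of_real norm_cis mult_1_right)
        then show ?thesis using \<rho> by simp
      qed
      ultimately have "dist (E (of_real \<rho> * cis t)) (E (cis t)) < \<eta> k" using d(2) by blast
      moreover have "E (of_real \<rho> * cis t) = Q (of_real \<rho> * cis t)" "E (cis t) = q (cis t)"
        using \<rho> by (auto simp: E_def norm_mult)
      ultimately have "norm (Q (of_real \<rho> * cis t) - q (cis t)) < \<eta> k" by (simp add: dist_norm)
      then show ?thesis using abs_Im_le_cmod[of "Q (of_real \<rho> * cis t) - q (cis t)"] by simp
    qed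
    then show ?thesis using \<rho> by (intro exI[of _ \<rho>]) auto
  qed
  then obtain \<rho> where \<rho>: "\<And>k. 0 < \<rho> k" "\<And>k. \<rho> k < 1" "\<And>k. 1 - \<eta> k \<le> \<rho> k"
      "\<And>k t. t \<in> X k \<Longrightarrow> \<bar>Im (Q (of_real (\<rho> k) * cis t)) - Im (q (cis t))\<bar> \<le> \<eta> k" by metis
  define u where "u = (\<lambda>k t. Im (Q (of_real (\<rho> k) * cis t)))"
  have inball: "of_real (\<rho> k) * cis t \<in> ball 0 1" for k t using \<rho>(1,2)[of k] by (simp add: norm_mult)
  have ucont: "continuous_on A (u k)" for A k
    unfolding u_def
    by (intro continuous_intros continuous_on_compose2[OF holomorphic_on_imp_continuous_on[OF Q]]) (use inball in auto)
  have LM: "(\<integral>t. F t \<partial>M) = integral ?I F" "integrable M F" if "continuous_on ?I F" for F :: "real \<Rightarrow> 'b::euclidean_space"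
  proof -
    have "set_integrable lborel ?I F" using that by (intro borel_integrable_compact[of ?I F, folded set_integrable_def]) auto
    then show "(\<integral>t. F t \<partial>M) = integral ?I F" "integrable M F"
      by (simp_all add: M_def integral_restrict_space integrable_restrict_space set_integrable_def
          set_borel_integral_eq_integral(2)[unfolded set_lebesgue_integral_def])
  qed
  have schw: "(\<integral>t. of_real (u k t) * (cis t / (cis t - z)) \<partial>M) = - \<i> * of_real pi * (Q (of_real (\<rho> k) * z) - cnj (Q 0))"
    if z: "norm z < 1" for k z
  proof -
    have ne: "cis t - z \<noteq> 0" for t using z by (metis norm_cis eq_iff_diff_eq_0 less_irrefl)
    have "continuous_on ?I (\<lambda>t. of_real (u k t) * (cis t / (cis t - z)))"
      using ne by (intro continuous_intros ucont) auto
    from LM(1)[OF this] show ?thesis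
      unfolding u_def by (simp only: integral_unique[OF schwarz_formula[OF Q \<rho>(1,2)[of k] z]])
  qed
  have mass: "integral\<^sup>L M (u k) = 2 * pi * Im (Q 0)" for k
  proof -
    have "complex_of_real (integral\<^sup>L M (u k)) = (\<integral>t. of_real (u k t) * (cis t / (cis t - 0)) \<partial>M)"
      by simp
    also have "\<dots> = - \<i> * of_real pi * (Q 0 - cnj (Q 0))" using schw[of 0 k] by simp
    also have "\<dots> = of_real (2 * pi * Im (Q 0))" by (simp add: complex_eq_iff)
    finally show ?thesis by (simp only: of_real_eq_iff)
  qed
  have vX: "v t = Im (q (cis t))" if "t \<in> X k" for t k
    using that eta(2)[of k] by (auto simp: v_def X_def)
  have tX: "\<forall>\<^sub>F k in sequentially. t \<in> X k" if t: "t \<in> ?I" "t \<notin> {0, pi, 2 * pi}" for t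
  proof -
    have "norm (cis t - 1) > 0" "norm (cis t + 1) > 0"
      using cis_eq_1_imp[of t] cis_eq_minus_1_imp[of t] t by (auto simp: add_eq_0_iff2)
    then have "\<forall>\<^sub>F k in sequentially. \<eta> k < norm (cis t - 1)" "\<forall>\<^sub>F k in sequentially. \<eta> k < norm (cis t + 1)"
      using order_tendstoD(2)[OF eta(1)] by auto
    then show ?thesis by eventually_elim (use t in \<open>auto simp: X_def\<close>)
  qed
  have u_meas: "u k \<in> borel_measurable M" for k using LM(2)[OF ucont] by blast
  have vlim: "(\<lambda>k. u k t) \<longlonglongrightarrow> v t" if t: "t \<in> ?I" "t \<notin> {0, pi, 2 * pi}" for t
  proof -
    have "(\<lambda>k. u k t - v t) \<longlonglongrightarrow> 0"
      by (rule Lim_null_comparison[OF _ eta(1)])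
         (use tX[OF t] in eventually_elim, use \<rho>(4) vX in \<open>auto simp: u_def\<close>)
    then show ?thesis by (simp add: LIM_zero_iff)
  qed
  have v_meas: "v \<in> borel_measurable M"
  proof (rule borel_measurable_LIMSEQ_real)
    show "(\<lambda>k. indicator ({0..2 * pi} - {0, pi, 2 * pi}) t * u k t) \<longlonglongrightarrow> v t" if "t \<in> space M" for t
      using vlim[of t] that by (cases "t \<in> {0, pi, 2*pi}") (auto simp: spM v_def)
    show "(\<lambda>t. indicator ({0..2 * pi} - {0, pi, 2 * pi}) t * u k t) \<in> borel_measurable M" for k
      using u_meas[of k] by (intro borel_measurable_times borel_measurable_indicator) (simp_all add: M_def sets_restrict_space_iff)
  qed
  have v_nn: "0 \<le> v t" if "t \<in> space M" for t
  proof (cases "t \<in> {0, pi, 2*pi}")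
    case False
    have "\<And>k. 0 \<le> u k t" unfolding u_def using nn inball by auto
    then show ?thesis using vlim[of t] that False LIMSEQ_le_const[of "\<lambda>k. u k t"] by (auto simp: spM)
  qed (auto simp: v_def)
  have cover: "AE t in M. \<forall>\<^sub>F k in sequentially. t \<in> X k"
  proof -
    have "AE t in lborel. t \<notin> {0, pi, 2 * pi}"
      by (rule AE_not_in) (simp add: finite_imp_null_set_lborel)
    then have "AE t in M. t \<notin> {0, pi, 2 * pi}" unfolding M_def by (subst AE_restrict_space_iff) auto
    then show ?thesis using AE_space by eventually_elim (use tX in \<open>auto simp: spM\<close>)
  qed
  note CL = concentration_limit[OF finM setsM, where u=u and v=v and \<eta>=\<eta> and ?m0.0="2 * pi * Im (Q 0)"]
  have part: "space M = X k \<union> Y k \<union> Z k" "X k \<inter> Y k = {}" "X k \<inter> Z k = {}" for k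
    by (auto simp: spM X_def Y_def Z_def)
  have u_nn: "0 \<le> u k x" for k x unfolding u_def using nn inball by auto
  have close: "\<bar>u k x - v x\<bar> \<le> \<eta> k" if "x \<in> X k" for k x
    using \<rho>(4)[OF that] vX[OF that] by (simp add: u_def)
  have "integrable M v"
    by (rule CL(1); (rule part YZ LM(2)[OF ucont] u_nn mass v_meas v_nn close eta(1)
          less_imp_le[OF eta(2)] less_imp_le[OF eta(3)] cover; assumption))
  then show "set_integrable lborel {0..2 * pi} v"
    by (simp add: M_def integrable_restrict_space set_integrable_def)
  obtain A B where AB: "A \<ge> 0" "B \<ge> 0" and rep: "\<And>(K :: real \<Rightarrow> complex) cY cZ C R.
          K \<in> borel_measurable M \<Longrightarrow> (\<forall>x\<in>space M. norm (K x) \<le> C) \<Longrightarrow>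
          (\<forall>k. \<forall>x\<in>Y k. norm (K x - cY) \<le> C * \<eta> k) \<Longrightarrow> (\<forall>k. \<forall>x\<in>Z k. norm (K x - cZ) \<le> C * \<eta> k) \<Longrightarrow>
          (\<lambda>k. \<integral>x. of_real (u k x) * K x \<partial>M) \<longlonglongrightarrow> R \<Longrightarrow>
          R = (\<integral>x. of_real (v x) * K x \<partial>M) + of_real A * cY + of_real B * cZ"
  proof -
    have "\<exists>A B. A \<ge> 0 \<and> B \<ge> 0 \<and> (\<forall>(K :: real \<Rightarrow> complex) cY cZ C R.
          K \<in> borel_measurable M \<longrightarrow> (\<forall>x\<in>space M. norm (K x) \<le> C) \<longrightarrow>
          (\<forall>k. \<forall>x\<in>Y k. norm (K x - cY) \<le> C * \<eta> k) \<longrightarrow> (\<forall>k. \<forall>x\<in>Z k. norm (K x - cZ) \<le> C * \<eta> k) \<longrightarrow>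
          (\<lambda>k. \<integral>x. of_real (u k x) * K x \<partial>M) \<longlonglongrightarrow> R \<longrightarrow>
          R = (\<integral>x. of_real (v x) * K x \<partial>M) + of_real A * cY + of_real B * cZ)"
      by (rule CL(2); (rule part YZ LM(2)[OF ucont] u_nn mass v_meas v_nn close eta(1)
          less_imp_le[OF eta(2)] less_imp_le[OF eta(3)] cover; assumption))
    then show thesis using that by blast
  qed
  have "- \<i> * of_real pi * (Q z - cnj (Q 0)) =
         (LINT t:{0..2*pi}|lborel. of_real (v t) * (cis t / (cis t - z))) + of_real A / (1 - z) + of_real B / (1 + z)"
    if z: "norm z < 1" for z
  proof -
    define K where "K = (\<lambda>t. cis t / (cis t - z))"
    define g where "g = 1 - norm z"
    have g: "0 < g" "g \<le> 1" using z by (auto simp: g_def)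
    have ne: "norm (c - z) \<ge> g" if "norm c = 1" for c
      using norm_triangle_ineq2[of c z] that by (simp add: g_def)
    define C where "C = 1 / g / g"
    have C: "1 / g \<le> C" using g by (simp add: C_def field_simps)
    have diff: "norm (cis t / (cis t - z) - c / (c - z)) \<le> C * norm (cis t - c)" if c: "norm c = 1" for t c
    proof -
      have n: "norm (cis t - z) \<ge> g" "norm (c - z) \<ge> g" using ne c by auto
      then have "cis t - z \<noteq> 0" "c - z \<noteq> 0" using g by auto
      then have "cis t / (cis t - z) - c / (c - z) = z * (c - cis t) / ((cis t - z) * (c - z))"
        by (simp add: field_simps)
      also have "norm \<dots> = norm z * norm (cis t - c) / (norm (cis t - z) * norm (c - z))"
        by (simp add: norm_mult norm_divide norm_minus_commute)
      also have "\<dots> \<le> 1 * norm (cis t - c) / (g * g)"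
        using n g z by (intro frac_le mult_mono) auto
      finally show ?thesis by (simp add: C_def)
    qed
    have lim: "(\<lambda>k. \<integral>x. of_real (u k x) * K x \<partial>M) \<longlonglongrightarrow> - \<i> * of_real pi * (Q z - cnj (Q 0))"
    proof -
      have "\<rho> \<longlonglongrightarrow> 1"
      proof (rule tendsto_sandwich[of "\<lambda>k. 1 - \<eta> k" _ _ "\<lambda>_. 1"])
        show "(\<lambda>k. 1 - \<eta> k) \<longlonglongrightarrow> 1" using eta(1) by (auto intro!: tendsto_eq_intros)
      qed (simp_all add: \<rho>(3) less_imp_le[OF \<rho>(2)])
      then have "(\<lambda>k. of_real (\<rho> k) * z) \<longlonglongrightarrow> of_real 1 * z" by (intro tendsto_intros)
      moreover have "isCont Q z"
        using holomorphic_on_imp_continuous_on[OF Q] z by (simp add: continuous_on_eq_continuous_at)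
      ultimately have "(\<lambda>k. Q (of_real (\<rho> k) * z)) \<longlonglongrightarrow> Q z"
        by (intro isCont_tendsto_compose[of z Q]) auto
      then show ?thesis unfolding K_def schw[OF z] by (intro tendsto_intros)
    qed
    have K1: "norm (K x) \<le> C" for x
    proof -
      have "norm (K x) \<le> 1 / g" unfolding K_def norm_divide norm_cis
        using ne[of "cis x"] g by (intro frac_le) auto
      then show ?thesis using C by simp
    qed
    have Kcont: "continuous_on UNIV K" unfolding K_def
      using ne g by (intro continuous_intros) (metis norm_cis norm_zero not_less eq_iff_diff_eq_0)
    then have Km: "K \<in> borel_measurable M"
      unfolding M_def by (intro measurable_restrict_space1) (simp add: borel_measurable_continuous_onI)
    have KY: "norm (K x - 1 / (1 - z)) \<le> C * \<eta> k" if "x \<in> Y k" for x k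
    proof -
      have "C * norm (cis x - 1) \<le> C * \<eta> k" using that C g by (intro mult_left_mono) (auto simp: Y_def C_def)
      then show ?thesis using diff[of 1 x] by (simp add: K_def)
    qed
    have KZ: "norm (K x - 1 / (1 + z)) \<le> C * \<eta> k" if "x \<in> Z k" for x k
    proof -
      have e: "(-1) / (-1 - z) = 1 / (1 + z)"
      proof -
        have "-1 - z = - (1 + z)" by simp
        then show ?thesis by (simp only: minus_divide_divide)
      qed
      have "C * norm (cis x + 1) \<le> C * \<eta> k" using that C g by (intro mult_left_mono) (auto simp: Z_def C_def)
      then show ?thesis using diff[of "-1" x] unfolding e by (simp add: K_def)
    qed
    have "- \<i> * of_real pi * (Q z - cnj (Q 0)) = (\<integral>x. of_real (v x) * K x \<partial>M) + of_real A * (1 / (1 - z)) + of_real B * (1 / (1 + z))"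
      by (rule rep[of K C]) (use Km K1 KY KZ lim in auto)
    also have "(\<integral>x. of_real (v x) * K x \<partial>M) = (LINT t:{0..2*pi}|lborel. of_real (v t) * (cis t / (cis t - z)))"
      by (simp add: M_def integral_restrict_space set_lebesgue_integral_def K_def)
    finally show ?thesis by simp
  qed
  then show "\<exists>A B. A \<ge> 0 \<and> B \<ge> 0 \<and> (\<forall>z. norm z < 1 \<longrightarrow>
       - \<i> * of_real pi * (Q z - cnj (Q 0)) =
         (LINT t:{0..2*pi}|lborel. of_real (v t) * (cis t / (cis t - z))) + of_real A / (1 - z) + of_real B / (1 + z))"
    using AB by blast
qed

definition cayley :: "complex \<Rightarrow> complex" where "cayley z = \<i> * (1 + z) / (1 - z)"

lemma Im_cayley: "z \<noteq> 1 \<Longrightarrow> Im (cayley z) = (1 - norm z ^ 2) / norm (1 - z) ^ 2"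
proof -
  assume "z \<noteq> 1"
  have "cayley z = (\<i> * (1 + z)) * cnj (1 - z) / of_real (norm (1 - z) ^ 2)"
    unfolding cayley_def by (metis complex_div_cnj of_real_power)
  then have "Im (cayley z) = Im ((\<i> * (1 + z)) * cnj (1 - z)) / norm (1 - z) ^ 2"
    by (simp only: Im_divide_of_real)
  also have "Im ((\<i> * (1 + z)) * cnj (1 - z)) = 1 - norm z ^ 2"
    by (simp add: cmod_power2) (simp add: power2_eq_square algebra_simps)
  finally show ?thesis .
qed

lemma cayley_cis:
  assumes "0 < t" "t < 2 * pi"
  shows "cayley (cis t) = of_real (- cot (t / 2))"
proof -
  define s where "s = t / 2"
  have sn: "sin s > 0" using assms by (intro sin_gt_zero) (auto simp: s_def)
  have c: "cis t = cis s * cis s" by (simp add: s_def cis_mult)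
  have inv: "cis s * cis (- s) = 1" by (simp add: cis_mult)
  have 1: "1 + cis t = cis s * of_real (2 * cos s)"
  proof -
    have "cis s + cis (- s) = of_real (2 * cos s)" by (simp add: complex_eq_iff)
    then have "cis s * (cis s + cis (-s)) = cis s * of_real (2 * cos s)" by (simp only:)
    then show ?thesis using inv by (simp add: c algebra_simps)
  qed
  have 2: "1 - cis t = cis s * (- 2 * \<i> * of_real (sin s))"
  proof -
    have "cis (- s) - cis s = - 2 * \<i> * of_real (sin s)" by (simp add: complex_eq_iff)
    then have "cis s * (cis (-s) - cis s) = cis s * (- 2 * \<i> * of_real (sin s))" by (simp only:)
    then show ?thesis using inv by (simp add: c algebra_simps)
  qed
  have "cayley (cis t) = of_real (2 * cos s) * \<i> / (- 2 * \<i> * of_real (sin s))"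
    unfolding cayley_def 1 2 by (simp add: mult_ac)
  also have "\<dots> = of_real (- (cos s / sin s))" using sn by (simp add: field_simps)
  finally show ?thesis by (simp add: cot_def s_def)
qed

lemma cayley_inverse:
  assumes "w + \<i> \<noteq> 0"
  shows "cayley ((w - \<i>) / (w + \<i>)) = w" "1 - (w - \<i>) / (w + \<i>) = 2 * \<i> / (w + \<i>)"
    "1 + (w - \<i>) / (w + \<i>) = 2 * w / (w + \<i>)"
proof -
  show 1: "1 - (w - \<i>) / (w + \<i>) = 2 * \<i> / (w + \<i>)" using assms by (simp add: field_simps)
  show 2: "1 + (w - \<i>) / (w + \<i>) = 2 * w / (w + \<i>)" using assms by (simp add: field_simps)
  show "cayley ((w - \<i>) / (w + \<i>)) = w" unfolding cayley_def 1 2 using assms by simp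
qed

lemma neg_cot_half_deriv:
  assumes "0 < t" "t < 2 * pi"
  shows "((\<lambda>t. - cot (t / 2)) has_real_derivative (1 + (- cot (t/2))^2) / 2) (at t within A)"
proof -
  have sn: "sin (t/2) > 0" using assms by (intro sin_gt_zero) auto
  have "((\<lambda>t. - cot (t / 2)) has_real_derivative - (- inverse ((sin (t/2))\<^sup>2) * (1/2))) (at t within A)"
    using sn by (intro DERIV_minus DERIV_chain'[where f="\<lambda>t. t/2" and g=cot] DERIV_cot) (auto intro!: derivative_eq_intros)
  moreover have "- (- inverse ((sin (t/2))\<^sup>2) * (1/2)) = (1 + (- cot (t/2))^2) / 2"
  proof -
    have "inverse ((sin (t/2))\<^sup>2) = 1 + (cot (t/2))^2"
      using sn sin_cos_squared_add[of "t/2"] by (simp add: cot_def field_simps)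
    then show ?thesis by (simp only:) (simp add: field_simps)
  qed
  ultimately show ?thesis by simp
qed

lemma neg_cot_half_bij: "bij_betw (\<lambda>t. - cot (t / 2)) {0<..<2 * pi} UNIV"
proof (rule bij_betwI[where g="\<lambda>x. pi + 2 * arctan x"])
  show "(\<lambda>x. pi + 2 * arctan x) \<in> UNIV \<rightarrow> {0<..<2 * pi}"
  proof
    fix x :: real
    show "pi + 2 * arctan x \<in> {0<..<2 * pi}" using arctan_bounded[of x] by (auto simp: field_simps)
  qed
  have eq: "- cot (t / 2) = tan ((t - pi) / 2)" if "0 < t" "t < 2 * pi" for t
  proof -
    have "cot (t/2) = - tan (t/2 - pi/2)"
      by (simp add: cot_def tan_def sin_diff cos_diff)
    then show ?thesis by (simp add: diff_divide_distrib)
  qed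
  show "pi + 2 * arctan (- cot (t / 2)) = t" if "t \<in> {0<..<2 * pi}" for t
    using that eq[of t] arctan_tan[of "(t - pi) / 2"] by auto
  show "- cot ((pi + 2 * arctan x) / 2) = x" if "x \<in> UNIV" for x
    using eq[of "pi + 2 * arctan x"] arctan_bounded[of x] by (auto simp: field_simps tan_arctan)
qed auto

lemma integral_neg_cot_half:
  fixes F :: "real \<Rightarrow> 'b::euclidean_space"
  assumes F: "F \<in> borel_measurable lborel"
    and I: "set_integrable lborel {0..2 * pi} (\<lambda>t. ((1 + (- cot (t/2))^2) / 2) *\<^sub>R F (- cot (t / 2)))"
  shows "integrable lborel F"
    and "(LINT t:{0..2*pi}|lborel. ((1 + (- cot (t/2))^2) / 2) *\<^sub>R F (- cot (t / 2))) = integral\<^sup>L lborel F"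
proof -
  let ?S = "{0<..<2 * pi}"
  let ?g = "\<lambda>t::real. - cot (t / 2)"
  let ?G = "\<lambda>t. \<bar>(1 + (?g t)^2) / 2\<bar> *\<^sub>R F (?g t)"
  have abs: "\<bar>(1 + x^2) / 2\<bar> = (1 + x^2) / 2" for x :: real
    by (simp add: add_nonneg_nonneg)
  have im: "?g ` ?S = UNIV" and inj: "inj_on ?g ?S"
    using neg_cot_half_bij by (auto simp: bij_betw_def)
  have IG: "set_integrable lborel {0..2 * pi} ?G" using I by (simp only: abs)
  have IS: "set_integrable lborel ?S ?G"
    by (rule set_integrable_subset[OF IG]) auto
  have eqI: "(LINT t:{0..2*pi}|lborel. ?G t) = (LINT t:?S|lborel. ?G t)"
  proof (rule set_integral_cong_set)
    have "AE t in lborel. t \<notin> {0, 2 * pi}"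
      by (rule AE_not_in) (simp add: finite_imp_null_set_lborel)
    then show "AE t in lborel. (t \<in> ?S) = (t \<in> {0..2 * pi})" by eventually_elim auto
  qed (use IG IS in \<open>auto simp: set_integrable_def set_borel_measurable_def\<close>)
  have "(\<lambda>t. indicator ?S t *\<^sub>R ?G t) \<in> borel_measurable lborel"
    using IS by (auto simp: set_integrable_def)
  then have AS: "?G absolutely_integrable_on ?S"
    using IS unfolding set_integrable_def by (simp add: integrable_completion)
  have "F absolutely_integrable_on ?g ` ?S \<and> integral (?g ` ?S) F = integral ?S ?G"
    by (rule has_absolute_integral_change_of_variables_real[THEN iffD1, of ?S ?g "\<lambda>t. (1 + (?g t)^2) / 2"])
       (use inj AS neg_cot_half_deriv in auto)
  then have AF: "F absolutely_integrable_on UNIV" and iF: "integral UNIV F = integral ?S ?G"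
    by (simp_all add: im)
  show IF: "integrable lborel F"
    using AF F by (simp add: set_integrable_def integrable_completion)
  have "integral\<^sup>L lborel F = integral UNIV F" using integral_lborel[OF IF] by simp
  also have "\<dots> = (LINT t:?S|lborel. ?G t)" unfolding iF
    by (rule set_borel_integral_eq_integral(2)[OF IS, symmetric])
  finally show "(LINT t:{0..2*pi}|lborel. ((1 + (?g t)^2) / 2) *\<^sub>R F (?g t)) = integral\<^sup>L lborel F"
    using eqI by (simp only: abs)
qed

theorem herglotz_upper_half_plane:
  fixes p pb :: "complex \<Rightarrow> complex"
  assumes p: "p holomorphic_on UH" and nn: "\<And>w. Im w > 0 \<Longrightarrow> Im (p w) \<ge> 0"
    and lim: "\<And>x. x \<noteq> 0 \<Longrightarrow> (p \<longlongrightarrow> k x) (at_UH x)"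
  defines "v \<equiv> \<lambda>x. if x = 0 then 0 else Im (k x)"
  shows "integrable lborel (\<lambda>x. v x / (1 + x^2))"
    and "v \<in> borel_measurable lborel" and "\<And>x. v x \<ge> 0"
    and "\<exists>A B. A \<ge> 0 \<and> B \<ge> 0 \<and> (\<forall>w. Im w > 0 \<longrightarrow>
       p w = cnj (p \<i>) + of_real A * (w + \<i>) + of_real B * (\<i> - 1 / w) +
         of_real (1 / pi) * (\<integral>x. of_real (v x) * ((w + \<i>) / ((of_real x - w) * (of_real x + \<i>))) \<partial>lborel))"
proof -
  have kc: "continuous_on (- {0}) k"
    by (rule boundary_limit_continuous_on[of _ p]) (use lim in auto)
  have kIm: "Im (k x) \<ge> 0" if "x \<noteq> 0" for x
    by (rule tendsto_lowerbound[OF tendsto_Im[OF lim[OF that]] _ at_UH_neq_bot])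
       (use nn in \<open>auto simp: eventually_at_UH intro!: exI[of _ 1]\<close>)
  then show v0: "v x \<ge> 0" for x by (simp add: v_def)
  have v_eq: "v = (\<lambda>x. if x \<in> - {0} then Im (k x) else 0)" by (auto simp: v_def)
  show v_meas: "v \<in> borel_measurable lborel"
  proof -
    have "(\<lambda>x. if x \<in> - {0} then Im (k x) else 0) \<in> borel_measurable borel"
      by (rule borel_measurable_continuous_on_if) (auto intro!: continuous_intros kc)
    then show ?thesis unfolding v_eq by simp
  qed
  define Q where "Q = (\<lambda>z. p (cayley z))"
  have cay_UH: "Im (cayley z) > 0" if "norm z < 1" for z
  proof -
    have z1: "z \<noteq> 1" using that by auto
    have "norm z ^ 2 < 1" using that by (simp add: power_less_one_iff abs_square_less_1)
    then show ?thesis using z1 by (simp add: Im_cayley)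
  qed
  have Q: "Q holomorphic_on ball 0 1"
    unfolding Q_def
  proof (rule holomorphic_on_compose_gen[OF _ p, unfolded o_def])
    show "cayley holomorphic_on ball 0 1"
      unfolding cayley_def[abs_def] by (intro holomorphic_intros) auto
  qed (use cay_UH in auto)
  define q where "q = (\<lambda>s. k (Re (cayley s)))"
  have cay_real: "cayley s = of_real (Re (cayley s))" "Re (cayley s) \<noteq> 0"
    if s: "norm s = 1" "s \<noteq> 1" "s \<noteq> -1" for s
  proof -
    have "Im (cayley s) = 0" using s by (simp add: Im_cayley)
    then show r: "cayley s = of_real (Re (cayley s))" by (simp add: complex_eq_iff)
    have "1 + s \<noteq> 0" using s by (metis add_eq_0_iff)
    then have "cayley s \<noteq> 0" using s by (simp add: cayley_def)
    then show "Re (cayley s) \<noteq> 0" using r by (metis of_real_0)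
  qed
  have Qlim: "(Q \<longlongrightarrow> q s) (at s within ball 0 1)" if s: "norm s = 1" "s \<noteq> 1" "s \<noteq> -1" for s
  proof -
    have "filterlim cayley (at_UH (Re (cayley s))) (at s within ball 0 1)"
      unfolding filterlim_at
    proof
      have "isCont cayley s" unfolding cayley_def[abs_def] using s by (intro continuous_intros) auto
      then have "(cayley \<longlongrightarrow> cayley s) (at s within ball 0 1)"
        unfolding isCont_def by (rule tendsto_within_subset) auto
      then show "(cayley \<longlongrightarrow> of_real (Re (cayley s))) (at s within ball 0 1)" using cay_real[OF s] by simp
      have "\<forall>\<^sub>F z in at s within ball 0 1. z \<in> ball 0 1" by (simp add: eventually_at_filter)
      then show "\<forall>\<^sub>F z in at s within ball 0 1. cayley z \<in> UH \<and> cayley z \<noteq> of_real (Re (cayley s))"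
      proof eventually_elim
        case (elim z)
        then have "Im (cayley z) > 0" using cay_UH by simp
        then show ?case by (metis Im_complex_of_real UH_iff less_irrefl)
      qed
    qed
    then show ?thesis unfolding Q_def q_def by (rule filterlim_compose[OF lim[OF cay_real(2)[OF s]]])
  qed
  have Qnn: "Im (Q z) \<ge> 0" if "norm z < 1" for z using nn cay_UH[OF that] by (simp add: Q_def)
  define vd where "vd = (\<lambda>t. if t \<in> {0, pi, 2 * pi} then 0 else Im (q (cis t)))"
  have H1: "set_integrable lborel {0..2 * pi} vd"
    unfolding vd_def by (rule herglotz_disc(1)[OF Q Qnn Qlim])
  obtain A B where AB: "A \<ge> 0" "B \<ge> 0" and H2: "\<And>z. norm z < 1 \<Longrightarrow>
       - \<i> * of_real pi * (Q z - cnj (Q 0)) =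
         (LINT t:{0..2*pi}|lborel. of_real (vd t) * (cis t / (cis t - z))) + of_real A / (1 - z) + of_real B / (1 + z)"
    using herglotz_disc(2)[OF Q Qnn Qlim] unfolding vd_def by blast
  have vd_eq: "vd t = v (- cot (t / 2))" if t: "0 < t" "t < 2 * pi" for t
  proof (cases "t = pi")
    case True then show ?thesis by (simp add: vd_def v_def cot_def)
  next
    case False
    have "cis t \<noteq> 1" "cis t \<noteq> -1" using cis_eq_1_imp[of t] cis_eq_minus_1_imp[of t] t False by auto
    then have "- cot (t/2) \<noteq> 0" using cay_real(2)[of "cis t"] cayley_cis[OF t] by simp
    then show ?thesis using t False by (simp add: vd_def v_def q_def cayley_cis)
  qed
  have AEt: "AE t in lborel. t \<in> {0..2 * pi} \<longrightarrow> 0 < t \<and> t < 2 * pi"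
  proof -
    have "AE t in lborel. t \<notin> {0, 2 * pi}"
      by (rule AE_not_in) (simp add: finite_imp_null_set_lborel)
    then show ?thesis by eventually_elim auto
  qed
  define jac where "jac = (\<lambda>t::real. (1 + (- cot (t/2))^2) / 2)"
  have p1: "1 + x^2 > 0" for x :: real by (smt (verit) zero_le_power2)
  let ?F1 = "\<lambda>x. 2 * v x / (1 + x^2)"
  have F1m: "?F1 \<in> borel_measurable lborel" using v_meas by simp
  have jt: "(1 + (- cot (t/2))^2) / 2 = jac t" for t by (simp add: jac_def)
  have jF: "jac t *\<^sub>R ?F1 (- cot (t/2)) = v (- cot (t/2))" for t
    using p1[of "- cot (t/2)"] by (simp add: jac_def)
  have H1': "set_integrable lborel {0..2 * pi} (\<lambda>t. v (- cot (t/2)))"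
  proof -
    have meas: "(\<lambda>t. v (- cot (t/2))) \<in> borel_measurable lborel"
      using v_meas unfolding cot_def by measurable
    show ?thesis
      unfolding set_integrable_def
    proof (rule integrable_cong_AE_imp[OF H1[unfolded set_integrable_def]])
      show "(\<lambda>t. indicator {0..2 * pi} t *\<^sub>R v (- cot (t/2))) \<in> borel_measurable lborel"
        using meas by (intro borel_measurable_scaleR borel_measurable_indicator) auto
      show "AE t in lborel. indicator {0..2 * pi} t *\<^sub>R vd t = indicator {0..2 * pi} t *\<^sub>R v (- cot (t/2))"
        using AEt
      proof eventually_elim
        case (elim t) then show ?case using vd_eq[of t] by (auto simp: indicator_def)
      qed
    qed
  qed
  have I1: "integrable lborel ?F1"
    by (rule integral_neg_cot_half(1)[OF F1m]) (use H1' in \<open>simp only: jt jF\<close>)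
  show "integrable lborel (\<lambda>x. v x / (1 + x^2))"
    using integrable_mult_right[OF I1, of "1/2"] by simp
  have "p w = cnj (p \<i>) + of_real (A / (2 * pi)) * (w + \<i>) + of_real (B / (2 * pi)) * (\<i> - 1 / w) +
         of_real (1 / pi) * (\<integral>x. of_real (v x) * ((w + \<i>) / ((of_real x - w) * (of_real x + \<i>))) \<partial>lborel)"
    if w: "Im w > 0" for w
  proof -
    have wi: "w + \<i> \<noteq> 0" "w \<noteq> 0" using w by (auto simp: complex_eq_iff)
    define z where "z = (w - \<i>) / (w + \<i>)"
    have zw: "cayley z = w" unfolding z_def by (rule cayley_inverse(1)[OF wi(1)])
    have z1: "norm z < 1"
    proof -
      have "norm (w - \<i>) ^ 2 < norm (w + \<i>) ^ 2"
        using w by (simp add: cmod_power2) (simp add: power2_eq_square algebra_simps)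
      then have "norm (w - \<i>) < norm (w + \<i>)" by (rule power_less_imp_less_base) simp
      then show ?thesis using wi by (simp add: z_def norm_divide)
    qed
    let ?K = "\<lambda>x. (of_real x - \<i>) * (w + \<i>) / (2 * \<i> * (of_real x - w))"
    let ?F = "\<lambda>x. of_real (2 * v x / (1 + x^2)) * ?K x"
    have Kcis: "cis t / (cis t - z) = ?K (- cot (t/2))" if t: "0 < t" "t < 2 * pi" for t
    proof -
      define x where "x = - cot (t/2)"
      have cx: "cayley (cis t) = of_real x" using cayley_cis[OF t] by (simp add: x_def)
      have c1: "cis t \<noteq> 1" using cis_eq_1_imp[of t] t by auto
      have xi: "of_real x + \<i> \<noteq> 0" "of_real x - w \<noteq> 0" using w by (auto simp: complex_eq_iff)
      have "\<i> * (1 + cis t) = of_real x * (1 - cis t)" using cx c1 by (simp add: cayley_def field_simps)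
      then have "cis t * (of_real x + \<i>) = of_real x - \<i>" by (simp add: algebra_simps)
      then have c: "cis t = (of_real x - \<i>) / (of_real x + \<i>)" using xi by (simp add: field_simps)
      have d: "cis t - z = 2 * \<i> * (of_real x - w) / ((of_real x + \<i>) * (w + \<i>))"
        unfolding c z_def using xi wi by (simp add: divide_simps) (simp add: algebra_simps)
      have "(a1 / a2) / (a3 / (a2 * a4)) = a1 * a4 / a3" if "a2 \<noteq> 0" for a1 a2 a3 a4 :: complex
        using that by simp
      then show ?thesis unfolding d x_def[symmetric] unfolding c using xi(1) by blast
    qed
    have Fm: "?F \<in> borel_measurable lborel" using v_meas by measurable
    have cm: "(\<lambda>t. cis t / (cis t - z)) \<in> borel_measurable lborel"
    proof -
      have "cis t - z \<noteq> 0" for t using z1 by (metis norm_cis eq_iff_diff_eq_0 less_irrefl)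
      then have "continuous_on UNIV (\<lambda>t. cis t / (cis t - z))" by (intro continuous_intros) auto
      then show ?thesis by (simp add: borel_measurable_continuous_onI)
    qed
    have jF2: "jac t *\<^sub>R ?F (- cot (t/2)) = of_real (v (- cot (t/2))) * ?K (- cot (t/2))" for t
    proof -
      define x where "x = - cot (t/2)"
      have "complex_of_real (jac t) * of_real (2 * v x / (1 + x^2)) = of_real (v x)"
      proof -
        have "jac t = (1 + x^2) / 2" by (simp only: jac_def x_def)
        moreover have "s / 2 * (2 * V / s) = V" if "s > 0" for s V :: real using that by simp
        ultimately have "jac t * (2 * v x / (1 + x^2)) = v x" using p1[of x] by (simp only:)
        then show ?thesis by (metis of_real_mult)
      qed
      then show ?thesis unfolding x_def[symmetric] scaleR_conv_of_real by (simp only: mult.assoc[symmetric])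
    qed
    have AE2: "AE t in lborel. t \<in> {0..2 * pi} \<longrightarrow> of_real (vd t) * (cis t / (cis t - z)) = jac t *\<^sub>R ?F (- cot (t/2))"
      using AEt by eventually_elim (auto simp only: jF2 Kcis vd_eq)
    have Ivd: "set_integrable lborel {0..2 * pi} (\<lambda>t. of_real (vd t) * (cis t / (cis t - z)))"
    proof -
      define g where "g = 1 - norm z"
      have g: "g > 0" using z1 by (simp add: g_def)
      have b: "norm (cis t / (cis t - z)) \<le> 1 / g" for t
      proof -
        have "norm (cis t - z) \<ge> g" using norm_triangle_ineq2[of "cis t" z] by (simp add: g_def)
        then show ?thesis unfolding norm_divide norm_cis using g by (intro frac_le) auto
      qed
      have "set_integrable lborel {0..2 * pi} (\<lambda>t. (1 / g) * vd t)" using H1 by (rule set_integrable_mult_right)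
      then show ?thesis unfolding set_integrable_def
      proof (rule Bochner_Integration.integrable_bound)
        have "(\<lambda>t. indicator {0..2 * pi} t *\<^sub>R vd t) \<in> borel_measurable lborel" using H1 by (auto simp: set_integrable_def)
        then have "(\<lambda>t. of_real (indicator {0..2 * pi} t *\<^sub>R vd t) * (cis t / (cis t - z))) \<in> borel_measurable lborel"
          using cm by measurable
        then show "(\<lambda>t. indicator {0..2 * pi} t *\<^sub>R (of_real (vd t) * (cis t / (cis t - z)))) \<in> borel_measurable lborel"
          by (simp add: scaleR_conv_of_real mult.assoc)
        have "norm (indicator {0..2 * pi} t *\<^sub>R (of_real (vd t) * (cis t / (cis t - z)))) \<le> norm (indicator {0..2 * pi} t *\<^sub>R ((1 / g) * vd t))" for t
          using mult_left_mono[OF b[of t], of "\<bar>vd t\<bar>"] g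
          by (auto simp: indicator_def norm_mult abs_mult mult_ac simp del: times_divide_eq_right times_divide_eq_left)
        then show "AE t in lborel. norm (indicator {0..2 * pi} t *\<^sub>R (of_real (vd t) * (cis t / (cis t - z)))) \<le> norm (indicator {0..2 * pi} t *\<^sub>R ((1 / g) * vd t))"
          by simp
      qed
    qed
    have mj: "(\<lambda>t. jac t *\<^sub>R ?F (- cot (t/2))) \<in> borel_measurable lborel"
      unfolding jF2 using v_meas unfolding cot_def by measurable
    have ind_m: "(\<lambda>t. indicator {0..2 * pi} t *\<^sub>R (jac t *\<^sub>R ?F (- cot (t/2)))) \<in> borel_measurable lborel"
      by (rule borel_measurable_scaleR[OF borel_measurable_indicator mj]) simp
    have Ij: "set_integrable lborel {0..2 * pi} (\<lambda>t. jac t *\<^sub>R ?F (- cot (t/2)))"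
      unfolding set_integrable_def
      by (rule integrable_cong_AE_imp[OF Ivd[unfolded set_integrable_def] ind_m])
         (use AE2 in eventually_elim, auto simp: indicator_def)
    have "(LINT t:{0..2*pi}|lborel. of_real (vd t) * (cis t / (cis t - z))) = (LINT t:{0..2*pi}|lborel. jac t *\<^sub>R ?F (- cot (t/2)))"
      unfolding set_lebesgue_integral_def
      by (rule integral_cong_AE) (use Ivd ind_m AE2 in \<open>auto simp: set_integrable_def indicator_def elim!: eventually_mono\<close>)
    also have "\<dots> = integral\<^sup>L lborel ?F"
      using integral_neg_cot_half(2)[OF Fm Ij[unfolded jac_def]] by (simp only: jac_def)
    also have "?F = (\<lambda>x. - \<i> * (of_real (v x) * ((w + \<i>) / ((of_real x - w) * (of_real x + \<i>)))))"
    proof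
      fix x
      have xi: "of_real x + \<i> \<noteq> 0" "of_real x - \<i> \<noteq> 0" "of_real x - w \<noteq> 0" using w by (auto simp: complex_eq_iff)
      have e: "complex_of_real (1 + x^2) = (of_real x + \<i>) * (of_real x - \<i>)"
        by (simp add: algebra_simps power2_eq_square)
      have "of_real (2 * v x / (1 + x^2)) = complex_of_real 2 * of_real (v x) / ((of_real x + \<i>) * (of_real x - \<i>))"
        unfolding e[symmetric] by simp
      moreover have "2 * V / (a1 * a2) * (a2 * c / (2 * \<i> * d)) = - \<i> * (V * (c / (d * a1)))"
        if "a2 \<noteq> 0" for V a1 a2 c d :: complex
      proof -
        have "2 * V / (a1 * a2) * (a2 * c / (2 * \<i> * d)) = V * c / (\<i> * (d * a1))"
          using that by (simp add: field_simps)
        also have "\<dots> = V * c / \<i> / (d * a1)" by (rule divide_divide_eq_left[symmetric])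
        also have "V * c / \<i> = - \<i> * (V * c)" by simp
        finally show ?thesis by simp
      qed
      ultimately show "?F x = - \<i> * (of_real (v x) * ((w + \<i>) / ((of_real x - w) * (of_real x + \<i>))))"
        using xi(2) by (simp only: of_real_numeral)
    qed
    finally have int: "(LINT t:{0..2*pi}|lborel. of_real (vd t) * (cis t / (cis t - z))) =
        - \<i> * (\<integral>x. of_real (v x) * ((w + \<i>) / ((of_real x - w) * (of_real x + \<i>))) \<partial>lborel)"
      by (simp only: integral_mult_right_zero)
    define J where "J = (\<integral>x. of_real (v x) * ((w + \<i>) / ((of_real x - w) * (of_real x + \<i>))) \<partial>lborel)"
    have "- \<i> * of_real pi * (p w - cnj (p \<i>)) = - \<i> * J + of_real A / (2 * \<i> / (w + \<i>)) + of_real B / (2 * w / (w + \<i>))"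
    proof -
      have "Q 0 = p \<i>" "Q z = p w" by (simp_all add: Q_def zw) (simp add: cayley_def)
      then show ?thesis using H2[OF z1] unfolding int J_def[symmetric]
        unfolding z_def cayley_inverse(2,3)[OF wi(1)] by simp
    qed
    then have "\<i> * (- \<i> * of_real pi * (p w - cnj (p \<i>))) =
        \<i> * (- \<i> * J + of_real A / (2 * \<i> / (w + \<i>)) + of_real B / (2 * w / (w + \<i>)))"
      by (rule arg_cong)
    then have "of_real pi * (p w - cnj (p \<i>)) = J + \<i> * (of_real A / (2 * \<i> / (w + \<i>)) + of_real B / (2 * w / (w + \<i>)))"
      by (simp only: distrib_left add.assoc mult.assoc[symmetric] mult_minus_right mult_minus_left i_squared minus_minus mult_1_left)
    also have "\<dots> = J + of_real (A / 2) * (w + \<i>) + of_real (B / 2) * (\<i> - 1 / w)"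
      using wi by (simp add: field_simps)
    finally have "p w - cnj (p \<i>) = (J + of_real (A / 2) * (w + \<i>) + of_real (B / 2) * (\<i> - 1 / w)) / of_real pi"
      by (simp add: field_simps)
    then have "p w = cnj (p \<i>) + (J + of_real (A / 2) * (w + \<i>) + of_real (B / 2) * (\<i> - 1 / w)) / of_real pi"
      by (metis add_diff_cancel_left' diff_add_cancel add.commute)
    then show ?thesis unfolding J_def[symmetric] by (simp add: add_divide_distrib)
  qed
  moreover have "A / (2 * pi) \<ge> 0" "B / (2 * pi) \<ge> 0" using AB by auto
  ultimately show "\<exists>A B. A \<ge> 0 \<and> B \<ge> 0 \<and> (\<forall>w. Im w > 0 \<longrightarrow>
       p w = cnj (p \<i>) + of_real A * (w + \<i>) + of_real B * (\<i> - 1 / w) +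
         of_real (1 / pi) * (\<integral>x. of_real (v x) * ((w + \<i>) / ((of_real x - w) * (of_real x + \<i>))) \<partial>lborel))"
    by blast
qed

section \<open>The representation of the inverse\<close>

lemma real_analytic_Im_holomorphic:
  assumes G: "\<And>x. x \<in> S \<Longrightarrow> \<exists>e>0. \<exists>G. G holomorphic_on ball (of_real x) e \<and> (\<forall>t. \<bar>t - x\<bar> < e \<longrightarrow> d t = Im (G (of_real t)))"
  shows "real_analytic_on d S"
  unfolding real_analytic_on_def
proof
  fix x assume "x \<in> S"
  then obtain e G where e: "e > 0" and G: "G holomorphic_on ball (of_real x) e"
    and d: "\<And>t. \<bar>t - x\<bar> < e \<Longrightarrow> d t = Im (G (of_real t))" using assms by metis
  define c where "c = (\<lambda>n. Im ((deriv ^^ n) G (of_real x) / fact n))"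
  have "(\<lambda>n. c n * (t - x) ^ n) sums d t" if t: "\<bar>t - x\<bar> < e" for t
  proof -
    have "of_real t \<in> ball (complex_of_real x) e"
      using t by (simp add: dist_norm abs_minus_commute flip: of_real_diff)
    from holomorphic_power_series[OF G this]
    have "(\<lambda>n. Im ((deriv ^^ n) G (of_real x) / fact n * (of_real t - of_real x) ^ n)) sums Im (G (of_real t))"
      by (rule sums_Im)
    moreover have "Im (a * (of_real t - of_real x) ^ n) = Im a * (t - x) ^ n" for a n
    proof -
      have "(complex_of_real t - of_real x) ^ n = of_real ((t - x) ^ n)" by simp
      then show ?thesis by (simp only: Im_complex_of_real Re_complex_of_real times_complex.sel mult_zero_right add_0_left)
    qed
    ultimately show ?thesis using d[OF t] by (simp only: c_def)
  qed
  then show "\<exists>\<epsilon>>0. \<exists>c. \<forall>y. \<bar>y - x\<bar> < \<epsilon> \<longrightarrow> (\<lambda>n. c n * (y - x) ^ n) sums d y"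
    using e by blast
qed

lemma sqrt_growth_contradiction:
  assumes B: "B > 0" and e0: "e0 > 0" and bd: "\<And>e. 0 < e \<Longrightarrow> e < e0 \<Longrightarrow> B / e + ln e \<le> (K::real)"
  shows False
proof -
  have "filterlim (\<lambda>s. s * (B * s - 2)) at_top at_top"
  proof (rule filterlim_at_top_mult_at_top[OF filterlim_ident])
    have "filterlim (\<lambda>s. - 2 + B * s) at_top at_top"
      by (intro filterlim_tendsto_add_at_top[OF tendsto_const]
            filterlim_tendsto_pos_mult_at_top[OF tendsto_const B filterlim_ident])
    then show "filterlim (\<lambda>s. B * s - 2) at_top at_top" by simp
  qed
  then have "\<forall>\<^sub>F s in at_top. s * (B * s - 2) \<ge> K + 1" by (auto simp: filterlim_at_top)
  moreover have "\<forall>\<^sub>F s in at_top. s > max 1 (1 / e0)" by (rule eventually_gt_at_top)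
  ultimately have "\<forall>\<^sub>F s::real in at_top. s * (B * s - 2) \<ge> K + 1 \<and> s > max 1 (1 / e0)" by (rule eventually_conj)
  then obtain s :: real where s: "s * (B * s - 2) \<ge> K + 1" "s > 1" "s > 1 / e0"
    by (auto simp: eventually_at_top_linorder)
  define e where "e = 1 / s^2"
  have "1 / s^2 < 1 / s" using s(2) by (simp add: power2_eq_square divide_simps)
  also have "1 / s < e0" using s e0 by (simp add: field_simps)
  finally have "e < e0" by (simp add: e_def)
  moreover have "e > 0" using s by (simp add: e_def)
  ultimately have "B / e + ln e \<le> K" by (intro bd)
  moreover have "B / e = B * s^2" by (simp add: e_def)
  moreover have "ln e = - 2 * ln s" using s by (simp add: e_def ln_div ln_realpow)
  moreover have "ln s < s" using s by (intro ln_less_self) simp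
  ultimately have "B * s^2 - 2 * s \<le> K" by linarith
  then show False using s(1) by (simp add: algebra_simps power2_eq_square)
qed

context pick_inverse begin

lemma p_cnj: assumes w: "w \<in> cut_plane m" shows "p (cnj w) = cnj (p w)"
proof -
  have cc: "cnj ` cut_plane m = cut_plane m"
    by (auto simp: image_iff cut_plane_iff intro!: bexI[of _ "cnj _"])
  have "(\<lambda>w. cnj (p (cnj w))) holomorphic_on cut_plane m"
    using holomorphic_on_compose_cnj_cnj[of p "cut_plane m"] p_hol cc open_cut_plane by (simp add: o_def)
  then have hol: "(\<lambda>w. cnj (p (cnj w)) - p w) holomorphic_on cut_plane m"
    by (intro holomorphic_intros p_hol)
  have lp: "complex_of_real (m + 1) islimpt (of_real ` {m<..})" by (rule of_real_ray_islimpt) simp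
  have "cnj (p (cnj w)) - p w = 0"
    by (rule analytic_continuation[OF hol open_cut_plane connected_cut_plane _ _ lp _ w])
       (auto simp: cut_plane_iff p_real)
  then have "p w = cnj (p (cnj w))" by simp
  then show ?thesis by simp
qed

end

locale pick_boundary = pick_inverse +
  fixes v :: "real \<Rightarrow> real" and A B :: real
  assumes v_int: "integrable lborel (\<lambda>x. v x / (1 + x^2))"
    and v_meas[measurable]: "v \<in> borel_measurable borel"
    and v_nn: "\<And>x. v x \<ge> 0"
    and v_m: "\<And>x. x \<ge> m \<Longrightarrow> v x = 0"
    and AB: "A \<ge> 0" "B \<ge> 0"
    and rep_raw: "\<And>w. Im w > 0 \<Longrightarrow> p w = cnj (p \<i>) + of_real A * (w + \<i>) + of_real B * (\<i> - 1 / w) +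
         of_real (1 / pi) * (\<integral>x. of_real (v x) * ((w + \<i>) / ((of_real x - w) * (of_real x + \<i>))) \<partial>lborel)"
begin

definition I :: "complex \<Rightarrow> complex" where
  "I w = (\<integral>x. of_real (v x) * ((w + \<i>) / ((of_real x - w) * (of_real x + \<i>))) \<partial>lborel)"

definition d :: "real \<Rightarrow> real" where "d x = v (m - x) / (pi * x)"

definition F :: "complex \<Rightarrow> complex" where
  "F w = (LINT t:{0<..}|lborel. of_real (d t) / (of_real t + w - of_real m))"

definition G :: "real \<Rightarrow> real" where "G x = v x * (1 / (m - x) + x / (1 + x^2))"

definition l0 :: real where
  "l0 = - Re (of_real pi * (of_real \<beta> - cnj (p \<i>) - of_real A * (of_real m + \<i>) - of_real B * (\<i> - 1 / of_real m)))"

lemma rep: "Im w > 0 \<Longrightarrow>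
    p w = cnj (p \<i>) + of_real A * (w + \<i>) + of_real B * (\<i> - 1 / w) + of_real (1 / pi) * I w"
  unfolding I_def by (rule rep_raw)

lemma d_meas[measurable]: "d \<in> borel_measurable borel"
  unfolding d_def[abs_def] by measurable

lemma d_nn: "d x \<ge> 0" if "x > 0" for x
  using v_nn that by (simp add: d_def)

lemma one_plus_square_pos: "1 + x^2 > 0" for x :: real by (smt (verit) zero_le_power2)

lemma of_real_plus_i_nonzero: "of_real x + \<i> \<noteq> (0::complex)" by (simp add: complex_eq_iff)

lemma one_plus_square_factor: "complex_of_real (1 + x^2) = (of_real x + \<i>) * (of_real x - \<i>)"
  by (simp add: algebra_simps power2_eq_square)

lemma kernel: "(w + \<i>) / ((of_real x - w) * (of_real x + \<i>)) = 1 / (of_real x - w) - 1 / (of_real x + \<i>)"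
  if "of_real x \<noteq> w" for x and w :: complex
  using that of_real_plus_i_nonzero[of x] by (simp add: divide_simps)

lemma kernel_int: "integrable lborel (\<lambda>x. of_real (v x) * ((w + \<i>) / ((of_real x - w) * (of_real x + \<i>))))"
  if w: "Im w > 0" for w
proof (rule Bochner_Integration.integrable_bound)
  define C where "C = norm (w + \<i>) * (1 + (1 + norm w) / Im w)"
  show "integrable lborel (\<lambda>x. C * (v x / (1 + x^2)))" by (rule integrable_mult_right[OF v_int])
  show "(\<lambda>x. of_real (v x) * ((w + \<i>) / ((of_real x - w) * (of_real x + \<i>)))) \<in> borel_measurable lborel" by measurable
  have "norm (of_real (v x) * ((w + \<i>) / ((of_real x - w) * (of_real x + \<i>)))) \<le> norm (C * (v x / (1 + x^2)))" for x
  proof -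
    define D where "D = norm (of_real x - w)"
    define E where "E = norm (of_real x + \<i>)"
    have E: "E > 0" "E^2 = 1 + x^2" using of_real_plus_i_nonzero[of x] by (auto simp: E_def cmod_power2 add.commute)
    have Dw: "D \<ge> Im w" using abs_Im_le_cmod[of "of_real x - w"] w by (simp add: D_def)
    have D: "D > 0" using Dw w by linarith
    have "E \<le> D + (norm w + 1)"
      using norm_triangle_ineq[of "of_real x - w" "w + \<i>"] norm_triangle_ineq[of w \<i>] by (simp add: D_def E_def)
    also have "\<dots> \<le> D + D * ((norm w + 1) / Im w)"
    proof -
      have "1 \<le> D / Im w" using Dw w by (simp add: pos_le_divide_eq)
      then have "1 * (norm w + 1) \<le> D / Im w * (norm w + 1)" by (intro mult_right_mono) auto
      then show ?thesis by simp
    qed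
    finally have "E \<le> D * (1 + (1 + norm w) / Im w)" by (simp add: algebra_simps add_divide_distrib)
    then have "1 / D \<le> (1 + (1 + norm w) / Im w) / E" using D E by (simp add: field_simps)
    then have "v x * (norm (w + \<i>) * (1 / D / E)) \<le> v x * (norm (w + \<i>) * ((1 + (1 + norm w) / Im w) / E / E))"
      using v_nn[of x] E by (intro mult_left_mono divide_right_mono) auto
    also have "\<dots> = C * (v x / E^2)" by (simp add: C_def power2_eq_square)
    also have "\<dots> \<le> norm (C * (v x / (1 + x^2)))" unfolding E(2) real_norm_def by (rule abs_ge_self)
    finally show ?thesis using v_nn[of x] by (simp add: norm_mult norm_divide D_def E_def)
  qed
  then show "AE x in lborel. norm (of_real (v x) * ((w + \<i>) / ((of_real x - w) * (of_real x + \<i>)))) \<le> norm (C * (v x / (1 + x^2)))"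
    by simp
qed

text \<open>
  Monotone convergence along the points \<open>m + \<i> / (n + 1)\<close>: minus the real part of the kernel
  increases with \<open>n\<close>, and the integrals converge because \<open>p\<close> has the limit \<open>\<beta>\<close> at \<open>m\<close>.
\<close>
lemma boundary_kernel_integral: "integrable lborel G" "integral\<^sup>L lborel G = l0"
proof -
  define g where "g = (\<lambda>n x. v x * ((m - x) / ((x - m)^2 + (1 / Suc n)^2) + x / (1 + x^2)))"
  define wn where "wn = (\<lambda>n. of_real m + \<i> * of_real (1 / Suc n))"
  have wnU: "Im (wn n) > 0" for n by (simp add: wn_def)
  have g_eq: "g n x = - Re (of_real (v x) * ((wn n + \<i>) / ((of_real x - wn n) * (of_real x + \<i>))))" for n x
  proof -
    have ne: "of_real x \<noteq> wn n" using wnU[of n] by (metis Im_complex_of_real less_irrefl)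
    have "Re (1 / (of_real x - wn n)) = (x - m) / ((x - m)^2 + (1 / Suc n)^2)"
      by (simp add: Re_divide wn_def power2_eq_square)
    moreover have "Re (1 / (of_real x + \<i>)) = x / (1 + x^2)"
      by (simp add: Re_divide power2_eq_square add.commute)
    moreover have "(m - x) / D = - ((x - m) / D)" for D by (metis minus_diff_eq minus_divide_left)
    moreover have "V * (- u + w) = - Re (of_real V * (U - W))" if "Re U = u" "Re W = w" for V u w and U W :: complex
      using that by (simp add: algebra_simps)
    ultimately show ?thesis unfolding kernel[OF ne] g_def by (simp only:)
  qed
  have g_int: "integrable lborel (g n)" for n
    unfolding g_eq[abs_def] using kernel_int[OF wnU[of n]] by (intro integrable_minus integrable_Re)
  have g_integral: "integral\<^sup>L lborel (g n) = - Re (I (wn n))" for n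
    unfolding g_eq[abs_def] I_def using kernel_int[OF wnU[of n]] by (simp only: integral_minus integral_Re)
  have wlim: "wn \<longlonglongrightarrow> of_real m"
  proof -
    have "(\<lambda>n. 1 / real (Suc n)) \<longlonglongrightarrow> 0" by (rule LIMSEQ_Suc[OF lim_1_over_n])
    then have "(\<lambda>n. of_real m + \<i> * of_real (1 / Suc n)) \<longlonglongrightarrow> of_real m + \<i> * of_real 0" by (intro tendsto_intros)
    then show ?thesis by (simp add: wn_def)
  qed
  have wfl: "filterlim wn (at_UH m) sequentially"
    unfolding filterlim_at using wlim wnU by (auto intro!: always_eventually) (metis Im_complex_of_real less_irrefl)
  have Ilim: "(\<lambda>n. - Re (I (wn n))) \<longlonglongrightarrow> l0"
  proof -
    have "I w = of_real pi * (p w - cnj (p \<i>) - of_real A * (w + \<i>) - of_real B * (\<i> - 1 / w))" if "Im w > 0" for w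
      using rep[OF that] by (simp add: field_simps)
    then have "(\<lambda>n. - Re (I (wn n))) = (\<lambda>n. - Re (of_real pi * (p (wn n) - cnj (p \<i>) - of_real A * (wn n + \<i>) - of_real B * (\<i> - 1 / wn n))))"
      using wnU by auto
    moreover have "(\<lambda>n. p (wn n)) \<longlonglongrightarrow> of_real \<beta>" by (rule filterlim_compose[OF p_lim_m wfl])
    ultimately show ?thesis unfolding l0_def using m_pos
      by (simp only:) (intro tendsto_intros wlim; simp)
  qed
  have mono: "mono (\<lambda>n. g n x)" for x
  proof (rule monoI)
    fix i j :: nat assume "i \<le> j"
    show "g i x \<le> g j x"
    proof (cases "x < m")
      case True
      have "(1 / real (Suc j))^2 \<le> (1 / real (Suc i))^2" using \<open>i \<le> j\<close> by (intro power_mono divide_left_mono) auto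
      then have "(m - x) / ((x - m)^2 + (1 / Suc i)^2) \<le> (m - x) / ((x - m)^2 + (1 / Suc j)^2)"
        using True by (intro divide_left_mono) (auto intro!: mult_pos_pos add_nonneg_pos)
      then show ?thesis unfolding g_def using v_nn[of x] by (intro mult_left_mono) auto
    qed (use v_m[of x] in \<open>simp add: g_def\<close>)
  qed
  have glim: "(\<lambda>n. g n x) \<longlonglongrightarrow> G x" for x
  proof (cases "x < m")
    case True
    have "(\<lambda>n. 1 / real (Suc n)) \<longlonglongrightarrow> 0" by (rule LIMSEQ_Suc[OF lim_1_over_n])
    then have "(\<lambda>n. v x * ((m - x) / ((x - m)^2 + (1 / Suc n)^2) + x / (1 + x^2))) \<longlonglongrightarrow>
        v x * ((m - x) / ((x - m)^2 + 0^2) + x / (1 + x^2))"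
      using True by (intro tendsto_intros) auto
    moreover have "(m - x) / ((x - m)^2 + 0^2) = 1 / (m - x)"
    proof -
      have "(x - m)^2 + 0^2 = (m - x) * (m - x)" by (simp add: power2_eq_square algebra_simps)
      then show ?thesis using True by simp
    qed
    ultimately show ?thesis by (simp add: g_def G_def)
  qed (use v_m[of x] in \<open>simp add: g_def G_def\<close>)
  have Gm: "G \<in> borel_measurable lborel" unfolding G_def[abs_def] by measurable
  show "integrable lborel G" "integral\<^sup>L lborel G = l0"
  proof -
    have ae: "AE x in lborel. mono (\<lambda>n. g n x)" "AE x in lborel. (\<lambda>n. g n x) \<longlonglongrightarrow> G x"
      using mono glim by simp_all
    have il: "(\<lambda>n. integral\<^sup>L lborel (g n)) \<longlonglongrightarrow> l0" using Ilim by (simp only: g_integral)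
    show "integrable lborel G" by (rule integrable_monotone_convergence[OF g_int ae il Gm])
    show "integral\<^sup>L lborel G = l0" by (rule integral_monotone_convergence[OF g_int ae il Gm])
  qed
qed

lemma d_set_integrable: "set_integrable lborel {0<..} (\<lambda>t. d t / (t + 1))"
proof -
  define Q where "Q = (\<lambda>x. indicator {..<m} x * (v x / ((m - x) * (1 + (m - x)))))"
  have "integrable lborel (\<lambda>x. G x + m * (v x / (1 + x^2)))" by (intro Bochner_Integration.integrable_add boundary_kernel_integral integrable_mult_right v_int)
  moreover have "G x + m * (v x / (1 + x^2)) = (1 + m^2) * (v x / ((m - x) * (1 + x^2)))" for x
  proof (cases "x < m")
    case True
    then have "m - x \<noteq> 0" "1 + x^2 \<noteq> 0" using one_plus_square_pos[of x] by auto
    then show ?thesis by (simp add: G_def divide_simps) (simp add: algebra_simps power2_eq_square)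
  qed (use v_m[of x] in \<open>simp add: G_def\<close>)
  ultimately have "integrable lborel (\<lambda>x. (1 + m^2) * (v x / ((m - x) * (1 + x^2))))" by simp
  then have "integrable lborel (\<lambda>x. (1 / (1 + m^2)) * ((1 + m^2) * (v x / ((m - x) * (1 + x^2)))))" by (rule integrable_mult_right)
  moreover have "(1 / (1 + m^2)) * ((1 + m^2) * y) = y" for y using one_plus_square_pos[of m] by simp
  ultimately have G0: "integrable lborel (\<lambda>x. v x / ((m - x) * (1 + x^2)))" by simp
  have Qint: "integrable lborel Q"
  proof (rule Bochner_Integration.integrable_bound)
    show "integrable lborel (\<lambda>x. (1 + m)^2 * (v x / ((m - x) * (1 + x^2)) + v x / (1 + x^2)))"
      by (intro integrable_mult_right Bochner_Integration.integrable_add G0 v_int)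
    show "Q \<in> borel_measurable lborel" unfolding Q_def by measurable
    have "norm (Q x) \<le> norm ((1 + m)^2 * (v x / ((m - x) * (1 + x^2)) + v x / (1 + x^2)))" for x
    proof (cases "x < m")
      case True
      define \<tau> where "\<tau> = m - x"
      have tau: "\<tau> > 0" "x = m - \<tau>" using True by (auto simp: \<tau>_def)
      have "1 + x^2 \<le> ((1 + m) * (1 + \<tau>))^2"
      proof -
        have "((1 + m) * (1 + \<tau>))^2 - (1 + x^2) = 2 * m + 2 * \<tau> + 6 * m * \<tau> + 2 * m^2 * \<tau> + 2 * m * \<tau>^2 + m^2 * \<tau>^2"
          unfolding tau(2) by (simp add: algebra_simps power2_eq_square)
        moreover have "\<dots> \<ge> 0" using m_pos tau by (intro add_nonneg_nonneg mult_nonneg_nonneg) auto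
        ultimately show ?thesis by linarith
      qed
      then have "1 \<le> (1 + m)^2 * (1 + \<tau>)^2 / (1 + x^2)" using one_plus_square_pos[of x] by (simp add: power_mult_distrib pos_le_divide_eq)
      then have "v x / (\<tau> * (1 + \<tau>)) * 1 \<le> v x / (\<tau> * (1 + \<tau>)) * ((1 + m)^2 * (1 + \<tau>)^2 / (1 + x^2))"
        using v_nn[of x] tau by (intro mult_left_mono) auto
      also have "\<dots> = (1 + m)^2 * (v x / (\<tau> * (1 + x^2)) + v x / (1 + x^2))"
      proof -
        have "1 + \<tau> \<noteq> 0" "\<tau> \<noteq> 0" "1 + x^2 \<noteq> 0" using tau one_plus_square_pos[of x] by auto
        then show ?thesis by (simp add: divide_simps) (simp add: algebra_simps power2_eq_square)
      qed
      finally have "Q x \<le> (1 + m)^2 * (v x / ((m - x) * (1 + x^2)) + v x / (1 + x^2))"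
        using True by (simp add: Q_def \<tau>_def)
      moreover have "Q x \<ge> 0" using True v_nn[of x] by (simp add: Q_def)
      ultimately show ?thesis by simp
    qed (simp add: Q_def)
    then show "AE x in lborel. norm (Q x) \<le> norm ((1 + m)^2 * (v x / ((m - x) * (1 + x^2)) + v x / (1 + x^2)))" by simp
  qed
  have "integrable lborel (\<lambda>t. Q (m + (-1) * t))"
    using lborel_integrable_real_affine[OF Qint, of "-1" m] by simp
  then have "integrable lborel (\<lambda>t. (1 / pi) * Q (m + (-1) * t))" by (rule integrable_mult_right)
  moreover have "(1 / pi) * Q (m + (-1) * t) = indicator {0<..} t *\<^sub>R (d t / (t + 1))" for t
    by (auto simp: Q_def d_def indicator_def field_simps)
  ultimately show ?thesis by (simp add: set_integrable_def)
qed

lemma kernel_norm_le: "norm (of_real (d t) / (of_real t + w - of_real m)) \<le> C * (d t / (t + 1))"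
  if "t > 0" and C: "t + 1 \<le> C * norm (of_real t + w - of_real m)" for t C and w :: complex
proof -
  have "norm (of_real t + w - of_real m) \<noteq> 0" using C that by auto
  then have n: "norm (of_real t + w - of_real m) > 0" by simp
  then have "1 / norm (of_real t + w - of_real m) \<le> C / (t + 1)" using C that(1) by (simp add: field_simps)
  then have "d t * (1 / norm (of_real t + w - of_real m)) \<le> d t * (C / (t + 1))" using d_nn[OF that(1)] by (intro mult_left_mono)
  then show ?thesis using d_nn[OF that(1)] by (simp add: norm_divide mult_ac)
qed

lemma kernel_lower_bound: "t + 1 \<le> (1 + (norm w + m + 1) / Im w) * norm (of_real t + w - of_real m)" if w: "Im w > 0" and t: "t > 0" for t w
proof -
  define N where "N = norm (of_real t + w - of_real m)"
  have NI: "N \<ge> Im w" using abs_Im_le_cmod[of "of_real t + w - of_real m"] w by (simp add: N_def)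
  have "t = norm (complex_of_real t)" using t by simp
  also have "\<dots> \<le> N + norm (w - of_real m)"
    using norm_triangle_ineq4[of "of_real t + w - of_real m" "w - of_real m"] by (simp add: N_def)
  also have "norm (w - of_real m) \<le> norm w + m" using norm_triangle_ineq4[of w "of_real m"] m_pos by simp
  finally have "t + 1 \<le> N + 1 * (norm w + m + 1)" by simp
  also have "1 * (norm w + m + 1) \<le> N / Im w * (norm w + m + 1)"
    using NI w m_pos by (intro mult_right_mono) (auto simp: pos_le_divide_eq)
  finally show ?thesis by (simp add: N_def algebra_simps)
qed

lemma F_int: "set_integrable lborel {0<..} (\<lambda>t. of_real (d t) / (of_real t + w - of_real m))"
  if "\<And>t. t > 0 \<Longrightarrow> t + 1 \<le> C * norm (of_real t + w - of_real m)" for C and w :: complex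
  unfolding set_integrable_def
proof (rule Bochner_Integration.integrable_bound)
  show "integrable lborel (\<lambda>t. C * (indicator {0<..} t *\<^sub>R (d t / (t + 1))))"
    using d_set_integrable unfolding set_integrable_def by (rule integrable_mult_right)
  show "(\<lambda>t. indicator {0<..} t *\<^sub>R (of_real (d t) / (of_real t + w - of_real m))) \<in> borel_measurable lborel"
    by measurable
  have "norm (indicator {0<..} t *\<^sub>R (of_real (d t) / (of_real t + w - of_real m))) \<le> norm (C * (indicator {0<..} t *\<^sub>R (d t / (t + 1))))" for t
  proof -
    have "norm (indicator {0<..} t *\<^sub>R (of_real (d t) / (of_real t + w - of_real m))) \<le> C * (indicator {0<..} t *\<^sub>R (d t / (t + 1)))"
      using kernel_norm_le[of t C w] that[of t] by (auto simp: indicator_def)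
    also have "\<dots> \<le> norm (C * (indicator {0<..} t *\<^sub>R (d t / (t + 1))))"
      unfolding real_norm_def by (rule abs_ge_self)
    finally show ?thesis .
  qed
  then show "AE t in lborel. norm (indicator {0<..} t *\<^sub>R (of_real (d t) / (of_real t + w - of_real m))) \<le> norm (C * (indicator {0<..} t *\<^sub>R (d t / (t + 1))))"
    by simp
qed

lemma representation_upper: "p w = of_real \<beta> + of_real A * (w - of_real m) + of_real B * (1 / of_real m - 1 / w) + (w - of_real m) * F w"
  if w: "Im w > 0" for w
proof -
  have w0: "w \<noteq> 0" using w by auto
  have iI: "integrable lborel (\<lambda>x. of_real (v x) * ((w + \<i>) / ((of_real x - w) * (of_real x + \<i>))))" by (rule kernel_int[OF w])
  have iG: "integrable lborel (\<lambda>x. complex_of_real (G x))" using boundary_kernel_integral(1) by (rule integrable_of_real)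
  have iV: "integrable lborel (\<lambda>x. complex_of_real (v x / (1 + x^2)))" using v_int by (rule integrable_of_real)
  define V where "V = (\<integral>x. v x / (1 + x^2) \<partial>lborel)"
  have sum: "(\<integral>x. of_real (v x) * ((w + \<i>) / ((of_real x - w) * (of_real x + \<i>))) + of_real (G x) - \<i> * of_real (v x / (1 + x^2)) \<partial>lborel)
      = I w + of_real l0 - \<i> * of_real V"
    using iI iG iV boundary_kernel_integral(2) by (simp add: I_def V_def del: of_real_divide)
  have "of_real (v x) * ((w + \<i>) / ((of_real x - w) * (of_real x + \<i>))) + of_real (G x) - \<i> * of_real (v x / (1 + x^2)) =
     of_real (v x) * ((w - of_real m) / ((of_real x - w) * (of_real x - of_real m)))" for x
  proof (cases "x < m")
    case True
    have ne: "of_real x \<noteq> w" using w by auto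
    have mx: "complex_of_real x - of_real m \<noteq> 0" using True by auto
    have e1: "1 / (of_real x + \<i>) = (of_real x - \<i>) / complex_of_real (1 + x^2)"
      unfolding one_plus_square_factor using of_real_plus_i_nonzero[of x] by (simp add: complex_eq_iff)
    have e2: "complex_of_real (1 / (m - x) + x / (1 + x^2)) = - 1 / (of_real x - of_real m) + of_real x / complex_of_real (1 + x^2)"
    proof -
      have "1 / (m - x) = - 1 / (x - m)" by (metis minus_diff_eq minus_divide_right divide_minus_left)
      then show ?thesis by simp
    qed
    have "(w + \<i>) / ((of_real x - w) * (of_real x + \<i>)) + complex_of_real (1 / (m - x) + x / (1 + x^2)) - \<i> * of_real (1 / (1 + x^2)) 
       = 1 / (of_real x - w) - 1 / (of_real x - of_real m)"
      unfolding kernel[OF ne] e1 e2 by (simp add: diff_divide_distrib)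
    also have "\<dots> = (w - of_real m) / ((of_real x - w) * (of_real x - of_real m))"
      using ne mx by (simp add: divide_simps)
    finally have K: "(w + \<i>) / ((of_real x - w) * (of_real x + \<i>)) + complex_of_real (1 / (m - x) + x / (1 + x^2)) - \<i> * of_real (1 / (1 + x^2))
        = (w - of_real m) / ((of_real x - w) * (of_real x - of_real m))" .
    have "of_real (v x) * ((w + \<i>) / ((of_real x - w) * (of_real x + \<i>))) + of_real (G x) - \<i> * of_real (v x / (1 + x^2)) =
      of_real (v x) * ((w + \<i>) / ((of_real x - w) * (of_real x + \<i>)) + complex_of_real (1 / (m - x) + x / (1 + x^2)) - \<i> * of_real (1 / (1 + x^2)))"
      by (simp add: G_def algebra_simps)
    then show ?thesis unfolding K .
  qed (use v_m[of x] in \<open>simp add: G_def\<close>)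
  with sum have sum2: "(\<integral>x. of_real (v x) * ((w - of_real m) / ((of_real x - w) * (of_real x - of_real m))) \<partial>lborel) = I w + of_real l0 - \<i> * of_real V"
    by simp
  have "(\<integral>x. of_real (v x) * ((w - of_real m) / ((of_real x - w) * (of_real x - of_real m))) \<partial>lborel) =
      (\<integral>t. of_real (v (m - t)) * ((w - of_real m) / ((of_real (m - t) - w) * (of_real (m - t) - of_real m))) \<partial>lborel)"
    using lborel_integral_real_affine[of "-1" "\<lambda>x. of_real (v x) * ((w - of_real m) / ((of_real x - w) * (of_real x - of_real m)))" m]
    by simp
  also have "\<dots> = (\<integral>t. (of_real pi * (w - of_real m)) * (indicator {0<..} t *\<^sub>R (of_real (d t) / (of_real t + w - of_real m))) \<partial>lborel)"
  proof (rule Bochner_Integration.integral_cong[OF refl])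
    fix t :: real
    show "of_real (v (m - t)) * ((w - of_real m) / ((of_real (m - t) - w) * (of_real (m - t) - of_real m))) =
        (of_real pi * (w - of_real m)) * (indicator {0<..} t *\<^sub>R (of_real (d t) / (of_real t + w - of_real m)))"
    proof (cases "t > 0")
      case True
      have "(of_real (m - t) - w) * (of_real (m - t) - of_real m) = of_real t * (of_real t + w - of_real m)"
        by (simp add: algebra_simps)
      then show ?thesis using True by (simp add: d_def)
    qed (use v_m[of "m - t"] in simp)
  qed
  also have "\<dots> = of_real pi * (w - of_real m) * F w"
    by (simp only: F_def set_lebesgue_integral_def integral_mult_right_zero)
  finally have FI: "of_real pi * (w - of_real m) * F w = I w + of_real l0 - \<i> * of_real V" using sum2 by simp
  have Iii: "I \<i> = 2 * \<i> * of_real V"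
  proof -
    have "I \<i> = (\<integral>x. 2 * \<i> * of_real (v x / (1 + x^2)) \<partial>lborel)"
      unfolding I_def
    proof (rule Bochner_Integration.integral_cong[OF refl])
      fix x
      have "complex_of_real (1 + x^2) = (of_real x - \<i>) * (of_real x + \<i>)" unfolding one_plus_square_factor by (rule mult.commute)
      then show "of_real (v x) * ((\<i> + \<i>) / ((of_real x - \<i>) * (of_real x + \<i>))) = 2 * \<i> * of_real (v x / (1 + x^2))"
        by simp
    qed
    also have "\<dots> = 2 * \<i> * of_real V" unfolding V_def by (simp only: integral_mult_right_zero integral_complex_of_real)
    finally show ?thesis .
  qed
  have pii: "p \<i> - cnj (p \<i>) = of_real (2 * Im (p \<i>)) * \<i>" by (simp add: complex_eq_iff)
  have "p \<i> - cnj (p \<i>) = 2 * \<i> * (of_real A + of_real B + of_real (V / pi))"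
    using rep[of \<i>] unfolding Iii by (simp add: algebra_simps)
  then have "Im (p \<i> - cnj (p \<i>)) = Im (2 * \<i> * (of_real A + of_real B + of_real (V / pi)))" by (simp only:)
  then have ImV: "Im (p \<i>) = A + B + V / pi" by simp
  have l0': "l0 = - pi * (\<beta> - Re (p \<i>) - A * m + B / m)"
    unfolding l0_def using m_pos by (simp add: Re_divide power2_eq_square)
  have cp: "cnj (p \<i>) = of_real (Re (p \<i>)) - \<i> * of_real (Im (p \<i>))" by (simp add: complex_eq_iff)
  have "of_real (1 / pi) * I w = (w - of_real m) * F w - of_real (l0 / pi) + \<i> * of_real (V / pi)"
    using FI by (simp add: field_simps)
  moreover have "l0 / pi = - (\<beta> - Re (p \<i>) - A * m + B / m)" unfolding l0' by simp
  ultimately show ?thesis unfolding rep[OF w] cp ImV by (simp add: algebra_simps)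
qed

lemma representation_real: "p (of_real y) = of_real \<beta> + of_real A * (of_real y - of_real m) + of_real B * (1 / of_real m - 1 / of_real y) + (of_real y - of_real m) * F (of_real y)"
  "set_integrable lborel {0<..} (\<lambda>t. of_real (d t) / (of_real t + complex_of_real y - of_real m))"
  if y: "y > m" for y
proof -
  define C where "C = 1 + 1 / (y - m)"
  have cb: "t + 1 \<le> C * norm (of_real t + w - of_real m)" if "t > 0" "Re w = y" for t w
  proof -
    have "t + (y - m) \<le> norm (of_real t + w - of_real m)"
      using abs_Re_le_cmod[of "of_real t + w - of_real m"] that y by simp
    then have "C * (t + (y - m)) \<le> C * norm (of_real t + w - of_real m)" using y by (intro mult_left_mono) (auto simp: C_def)
    moreover have "t + 1 \<le> C * (t + (y - m))"
    proof -
      have "C * (t + (y - m)) = t + 1 + (y - m) + t / (y - m)" using y by (simp add: C_def field_simps)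
      moreover have "t / (y - m) \<ge> 0" using that y by simp
      ultimately show ?thesis using y by linarith
    qed
    ultimately show ?thesis by linarith
  qed
  show "set_integrable lborel {0<..} (\<lambda>t. of_real (d t) / (of_real t + complex_of_real y - of_real m))"
    by (rule F_int[of C]) (use cb in auto)
  define u where "u = (\<lambda>n. of_real y + \<i> * of_real (1 / Suc n))"
  have u: "Im (u n) > 0" "Re (u n) = y" for n by (auto simp: u_def)
  have ulim: "u \<longlonglongrightarrow> of_real y"
  proof -
    have "(\<lambda>n. 1 / real (Suc n)) \<longlonglongrightarrow> 0" by (rule LIMSEQ_Suc[OF lim_1_over_n])
    then have "(\<lambda>n. of_real y + \<i> * of_real (1 / Suc n)) \<longlonglongrightarrow> of_real y + \<i> * of_real 0" by (intro tendsto_intros)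
    then show ?thesis by (simp add: u_def)
  qed
  have Flim: "(\<lambda>n. F (u n)) \<longlonglongrightarrow> F (of_real y)"
    unfolding F_def set_lebesgue_integral_def
  proof (rule integral_dominated_convergence[where w="\<lambda>t. C * (indicator {0<..} t *\<^sub>R (d t / (t + 1)))"])
    show "integrable lborel (\<lambda>t. C * (indicator {0<..} t *\<^sub>R (d t / (t + 1))))"
      using d_set_integrable unfolding set_integrable_def by (rule integrable_mult_right)
    have "(\<lambda>n. indicator {0<..} t *\<^sub>R (of_real (d t) / (of_real t + u n - of_real m))) \<longlonglongrightarrow>
        indicator {0<..} t *\<^sub>R (of_real (d t) / (of_real t + of_real y - of_real m))" for t
    proof (cases "t > 0")
      case True
      have "of_real t + of_real y - complex_of_real m \<noteq> 0"
        using True y by (auto simp: complex_eq_iff)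
      then show ?thesis by (intro tendsto_intros ulim)
    qed simp
    then show "AE t in lborel. (\<lambda>n. indicator {0<..} t *\<^sub>R (of_real (d t) / (of_real t + u n - of_real m))) \<longlonglongrightarrow>
        indicator {0<..} t *\<^sub>R (of_real (d t) / (of_real t + complex_of_real y - of_real m))" by simp
    have "norm (indicator {0<..} t *\<^sub>R (of_real (d t) / (of_real t + u n - of_real m))) \<le> C * (indicator {0<..} t *\<^sub>R (d t / (t + 1)))" for t n
      using kernel_norm_le[of t C "u n"] cb[of t "u n"] u by (auto simp: indicator_def)
    then show "AE t in lborel. norm (indicator {0<..} t *\<^sub>R (of_real (d t) / (of_real t + u n - of_real m))) \<le> C * (indicator {0<..} t *\<^sub>R (d t / (t + 1)))" for n
      by simp
  qed measurable
  have y0: "complex_of_real y \<noteq> 0" using y m_pos by auto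
  have "(\<lambda>n. of_real \<beta> + of_real A * (u n - of_real m) + of_real B * (1 / of_real m - 1 / u n) + (u n - of_real m) * F (u n))
     \<longlonglongrightarrow> of_real \<beta> + of_real A * (of_real y - of_real m) + of_real B * (1 / of_real m - 1 / of_real y) + (of_real y - of_real m) * F (of_real y)"
    using y0 by (intro tendsto_intros ulim Flim)
  then have "(\<lambda>n. p (u n)) \<longlonglongrightarrow> of_real \<beta> + of_real A * (of_real y - of_real m) + of_real B * (1 / of_real m - 1 / of_real y) + (of_real y - of_real m) * F (of_real y)"
    using representation_upper[OF u(1)] by simp
  moreover have "(\<lambda>n. p (u n)) \<longlonglongrightarrow> p (of_real y)"
    by (rule isCont_tendsto_compose[OF p_isCont ulim]) (use y in \<open>simp add: cut_plane_iff\<close>)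
  ultimately show "p (of_real y) = of_real \<beta> + of_real A * (of_real y - of_real m) + of_real B * (1 / of_real m - 1 / of_real y) + (of_real y - of_real m) * F (of_real y)"
    using LIMSEQ_unique by blast
qed

lemma linear_coefficient_zero: "A = 0"
proof -
  have "A \<le> finv0 y / y * (y / (y - m))" if y: "y > m" for y
  proof -
    have ReF: "Re (F (of_real y)) \<ge> 0"
    proof -
      have "F (of_real y) = of_real (LINT t:{0<..}|lborel. d t / (t + y - m))"
        unfolding F_def set_lebesgue_integral_def integral_complex_of_real[symmetric]
        by (rule Bochner_Integration.integral_cong) (auto simp: scaleR_conv_of_real)
      moreover have "(LINT t:{0<..}|lborel. d t / (t + y - m)) \<ge> 0"
        unfolding set_lebesgue_integral_def
        by (rule Bochner_Integration.integral_nonneg) (use d_nn y in \<open>auto simp: indicator_def\<close>)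
      ultimately show ?thesis by simp
    qed
    have "finv0 y = Re (p (of_real y))" using p_real[OF y] by simp
    also have "\<dots> = \<beta> + A * (y - m) + B * (1 / m - 1 / y) + (y - m) * Re (F (of_real y))"
      unfolding representation_real(1)[OF y] using m_pos y by (simp add: Re_divide power2_eq_square flip: of_real_diff)
    also have "\<dots> \<ge> A * (y - m)"
    proof -
      have "B * (1 / m - 1 / y) \<ge> 0" using AB y m_pos by (intro mult_nonneg_nonneg) (auto simp: divide_left_mono)
      moreover have "(y - m) * Re (F (of_real y)) \<ge> 0" using ReF y by simp
      ultimately show ?thesis using be0 by linarith
    qed
    finally have "A \<le> finv0 y / (y - m)" using y by (simp add: pos_le_divide_eq)
    then show ?thesis using y m_pos by simp
  qed
  moreover have "((\<lambda>y. finv0 y / y * (y / (y - m))) \<longlongrightarrow> 0 * 1) at_top"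
  proof (rule tendsto_mult[OF finv0_sublinear])
    have "((\<lambda>y. 1 + m / (y - m)) \<longlongrightarrow> 1 + 0) at_top"
      by (intro tendsto_intros tendsto_divide_0[OF tendsto_const] filterlim_at_top_imp_at_infinity)
         (auto intro!: filterlim_tendsto_add_at_top[OF tendsto_const[of "-m"] filterlim_ident, simplified])
    moreover have "\<forall>\<^sub>F y in at_top. 1 + m / (y - m) = y / (y - m)"
      using eventually_gt_at_top[of m] by eventually_elim (simp add: field_simps)
    ultimately show "((\<lambda>y. y / (y - m)) \<longlongrightarrow> 1) at_top" by (simp add: Lim_transform_eventually)
  qed
  ultimately have "A \<le> 0 * 1"
    by (intro tendsto_lowerbound[where F=at_top]) (auto intro: eventually_mono[OF eventually_gt_at_top[of m]])
  then show ?thesis using AB by simp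
qed

lemma Im_p_imaginary_axis_ge: "Im (p (\<i> * of_real e)) \<ge> B / e" if e: "e > 0" for e
proof -
  define w where "w = \<i> * complex_of_real e"
  have w: "Im w > 0" using e by (simp add: w_def)
  have int: "set_integrable lborel {0<..} (\<lambda>t. of_real (d t) / (of_real t + w - of_real m))"
    by (rule F_int[OF kernel_lower_bound[OF w]])
  have "(w - of_real m) * F w = (\<integral>t. (w - of_real m) * (indicator {0<..} t *\<^sub>R (of_real (d t) / (of_real t + w - of_real m))) \<partial>lborel)"
    by (simp only: F_def set_lebesgue_integral_def integral_mult_right_zero)
  then have "Im ((w - of_real m) * F w) = (\<integral>t. Im ((w - of_real m) * (indicator {0<..} t *\<^sub>R (of_real (d t) / (of_real t + w - of_real m)))) \<partial>lborel)"
    using int by (simp only: integral_Im integrable_mult_right set_integrable_def)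
  also have "\<dots> \<ge> 0"
  proof (rule Bochner_Integration.integral_nonneg)
    fix t :: real
    show "0 \<le> Im ((w - of_real m) * (indicator {0<..} t *\<^sub>R (of_real (d t) / (of_real t + w - of_real m))))"
    proof (cases "t > 0")
      case True
      have ne: "of_real t + w - of_real m \<noteq> 0" using w by (auto simp: complex_eq_iff)
      have "(w - of_real m) * (of_real (d t) / (of_real t + w - of_real m)) = of_real (d t) * (1 - of_real t / (of_real t + w - of_real m))"
        using ne by (simp add: field_simps)
      moreover have "Im (1 - of_real t / (of_real t + w - of_real m)) \<ge> 0"
        using True w by (simp add: Im_divide)
      ultimately have "0 \<le> Im ((w - of_real m) * (of_real (d t) / (of_real t + w - of_real m)))"
        using d_nn[OF True]
        by (simp only: times_complex.sel(2) Re_complex_of_real Im_complex_of_real mult_zero_left add_0_right mult_nonneg_nonneg)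
      then show ?thesis using True by simp
    qed simp
  qed
  finally have "Im ((w - of_real m) * F w) \<ge> 0" .
  moreover have "Im (of_real B * (1 / of_real m - 1 / w)) = B / e"
  proof -
    have "1 / w = - \<i> / of_real e" using e by (simp add: w_def field_simps)
    then have "1 / of_real m - 1 / w = of_real (1 / m) + \<i> * of_real (1 / e)" by simp
    then show ?thesis by (simp only: times_complex.sel plus_complex.sel Im_complex_of_real Re_complex_of_real imaginary_unit.sel) simp
  qed
  ultimately show ?thesis using representation_upper[OF w] linear_coefficient_zero by (simp add: w_def)
qed

lemma atom_zero: "B = 0"
proof (rule ccontr)
  assume "B \<noteq> 0"
  then have B: "B > 0" using AB by simp
  define D where "D = (LINT t:{0<..}|lborel. d t / (t + 1))"
  have D: "D \<ge> 0" unfolding D_def set_lebesgue_integral_def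
    by (rule Bochner_Integration.integral_nonneg) (use d_nn in \<open>auto simp: indicator_def\<close>)
  define C where "C = \<beta> + B * (1 / m + 1) + (1 + m) * ((2 + m) * D)"
  have upper: "norm (p (\<i> * of_real e)) \<le> C / e" if e: "0 < e" "e \<le> 1" for e
  proof -
    define w where "w = \<i> * complex_of_real e"
    have w: "Im w > 0" "norm w = e" using e by (auto simp: w_def norm_mult)
    have cb: "t + 1 \<le> (2 + m) / e * norm (of_real t + w - of_real m)" if t: "t > 0" for t
    proof -
      define N where "N = norm (of_real t + w - of_real m)"
      have N1: "N \<ge> e" using abs_Im_le_cmod[of "of_real t + w - of_real m"] e by (simp add: N_def w_def)
      have N2: "N \<ge> \<bar>t - m\<bar>" using abs_Re_le_cmod[of "of_real t + w - of_real m"] by (simp add: N_def w_def)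
      have "e * (t + 1) \<le> e * (\<bar>t - m\<bar> + (1 + m))" using e by (intro mult_left_mono) auto
      also have "\<dots> = e * \<bar>t - m\<bar> + e * (1 + m)" by (simp add: algebra_simps)
      also have "\<dots> \<le> 1 * N + N * (1 + m)" using e N1 N2 m_pos by (intro add_mono mult_mono) auto
      finally have "e * (t + 1) \<le> (2 + m) * N" by (simp add: algebra_simps)
      then show ?thesis using e by (simp add: N_def field_simps)
    qed
    have "norm (F w) \<le> (\<integral>t. (2 + m) / e * (indicator {0<..} t *\<^sub>R (d t / (t + 1))) \<partial>lborel)"
      unfolding F_def set_lebesgue_integral_def
    proof (rule Bochner_Integration.integral_norm_bound_integral)
      show "integrable lborel (\<lambda>t. indicator {0<..} t *\<^sub>R (of_real (d t) / (of_real t + w - of_real m)))"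
        using F_int[OF cb] by (simp add: set_integrable_def)
      show "integrable lborel (\<lambda>t. (2 + m) / e * (indicator {0<..} t *\<^sub>R (d t / (t + 1))))"
        using d_set_integrable unfolding set_integrable_def by (rule integrable_mult_right)
      show "norm (indicator {0<..} t *\<^sub>R (of_real (d t) / (of_real t + w - of_real m))) \<le> (2 + m) / e * (indicator {0<..} t *\<^sub>R (d t / (t + 1)))" for t
        using kernel_norm_le[of t "(2 + m) / e" w] cb[of t] by (auto simp: indicator_def)
    qed
    also have "\<dots> = (2 + m) / e * D" unfolding D_def set_lebesgue_integral_def by (rule integral_mult_right_zero)
    finally have nF: "norm (F w) \<le> (2 + m) * D / e" by simp
    have e1: "1 \<le> 1 / e" using e by simp
    have "norm (p w) \<le> norm (complex_of_real \<beta>) + norm (of_real B * (1 / of_real m - 1 / w)) + norm ((w - of_real m) * F w)"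
      using representation_upper[OF w(1)] linear_coefficient_zero norm_triangle_ineq[of "of_real \<beta> + of_real B * (1 / of_real m - 1 / w)" "(w - of_real m) * F w"]
        norm_triangle_ineq[of "complex_of_real \<beta>" "of_real B * (1 / of_real m - 1 / w)"] by simp
    also have "norm (complex_of_real \<beta>) \<le> \<beta> * (1 / e)" using be0 mult_left_mono[OF e1, of \<beta>] by simp
    also have "norm (of_real B * (1 / of_real m - 1 / w)) \<le> B * (1 / m + 1) * (1 / e)"
    proof -
      have "norm (1 / of_real m - 1 / w) \<le> norm (1 / complex_of_real m) + norm (1 / w)" by (rule norm_triangle_ineq4)
      also have "\<dots> = 1 / m + 1 / e" using m_pos w by (simp add: norm_divide)
      also have "\<dots> \<le> 1 / m * (1 / e) + 1 / e" using mult_left_mono[OF e1, of "1/m"] m_pos by simp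
      finally have "norm (1 / of_real m - 1 / w) \<le> (1 / m + 1) * (1 / e)" by (simp add: algebra_simps)
      then have "B * norm (1 / of_real m - 1 / w) \<le> B * ((1 / m + 1) * (1 / e))" using B by (intro mult_left_mono) auto
      then show ?thesis using B unfolding norm_mult norm_of_real by (simp only: abs_of_pos mult.assoc)
    qed
    also have "norm ((w - of_real m) * F w) \<le> (1 + m) * ((2 + m) * D / e)"
      unfolding norm_mult
    proof (intro mult_mono nF)
      show "norm (w - of_real m) \<le> 1 + m" using norm_triangle_ineq4[of w "of_real m"] w e m_pos by simp
    qed (use m_pos in auto)
    finally show ?thesis unfolding w_def C_def by (simp add: add_divide_distrib)
  qed
  have C: "C > 0" using be0 B m_pos D by (auto simp: C_def intro!: add_pos_nonneg mult_nonneg_nonneg)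
  obtain R where R: "R > 0" "\<And>z. Im z > 0 \<Longrightarrow> Re z \<ge> - (C / B) * Im z \<Longrightarrow> norm z \<ge> R \<Longrightarrow> norm (h z) \<ge> 1"
    using h_large[of "C / B"] C B by auto
  define e0 where "e0 = min 1 (B / R)"
  have e0: "e0 > 0" "e0 \<le> 1" "e0 \<le> B / R" using B R by (auto simp: e0_def)
  have hb: "norm (h (p (\<i> * of_real e))) \<ge> 1" if e: "0 < e" "e \<le> e0" for e
  proof -
    define z where "z = p (\<i> * of_real e)"
    have z: "Im z > 0" using Im_p_pos[of "\<i> * of_real e"] e by (simp add: z_def)
    have lo: "Im z \<ge> B / e" using Im_p_imaginary_axis_ge[OF e(1)] by (simp add: z_def)
    have "norm z \<le> C / e" using upper[of e] e e0 by (simp add: z_def)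
    also have "C / e = C / B * (B / e)" using B by simp
    also have "\<dots> \<le> C / B * Im z" using lo B C by (intro mult_left_mono) auto
    finally have "norm z \<le> C / B * Im z" .
    then have "Re z \<ge> - (C / B) * Im z" using abs_Re_le_cmod[of z] by simp
    moreover have "norm z \<ge> R"
    proof -
      have "e * R \<le> B" using e e0(3) R(1) by (simp add: pos_le_divide_eq) (meson mult_right_mono less_imp_le order_trans)
      then have "R \<le> B / e" using e by (simp add: field_simps)
      then show ?thesis using lo abs_Im_le_cmod[of z] by linarith
    qed
    ultimately show ?thesis using R(2)[OF z] by (simp add: z_def)
  qed
  have mono: "Im (p (\<i> * of_real e)) + ln e \<le> Im (p (\<i> * of_real e0)) + ln e0" if e: "0 < e" "e < e0" for e
  proof (rule DERIV_nonneg_imp_nondecreasing[OF less_imp_le[OF e(2)]])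
    fix s assume s: "e \<le> s" "s \<le> e0"
    then have s0: "s > 0" using e by simp
    define w where "w = \<i> * complex_of_real s"
    have w: "Im w > 0" using s0 by (simp add: w_def)
    define P where "P = 1 / (w * h (p w)) * \<i>"
    have "(p has_field_derivative 1 / (w * h (p w))) (at (\<i> * of_real s))" using p_deriv(1)[OF w] by (simp add: w_def)
    then have "((\<lambda>v. p (\<i> * v)) has_field_derivative P) (at (of_real s))"
      unfolding P_def by (rule DERIV_chain'[where f="\<lambda>v. \<i> * v" and D=\<i>, rotated]) (auto intro!: derivative_eq_intros)
    then have "((\<lambda>s. p (\<i> * of_real s)) has_vector_derivative P) (at s)"
      by (rule has_vector_derivative_real_field)
    then have "((\<lambda>s. Im (p (\<i> * of_real s))) has_vector_derivative Im P) (at s)"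
      by (rule bounded_linear.has_vector_derivative[OF bounded_linear_Im])
    then have "((\<lambda>s. Im (p (\<i> * of_real s))) has_real_derivative Im P) (at s)"
      by (simp only: has_real_derivative_iff_has_vector_derivative)
    then have "((\<lambda>s. Im (p (\<i> * of_real s)) + ln s) has_real_derivative (Im P + 1 / s)) (at s)"
      by (rule DERIV_add[OF _ DERIV_ln_divide[OF s0]])
    moreover have "\<bar>Im P\<bar> \<le> 1 / s"
    proof -
      have "norm P = 1 / (s * norm (h (p w)))" using s0 by (simp add: P_def w_def norm_mult norm_divide)
      also have "\<dots> \<le> 1 / (s * 1)" using hb[OF s0 s(2)] s0 unfolding w_def by (intro divide_left_mono mult_left_mono mult_pos_pos) auto
      finally show ?thesis using abs_Im_le_cmod[of P] by simp
    qed
    ultimately show "\<exists>y. ((\<lambda>s. Im (p (\<i> * of_real s)) + ln s) has_real_derivative y) (at s) \<and> 0 \<le> y"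
      by (intro exI[of _ "Im P + 1 / s"]) auto
  qed
  show False
  proof (rule sqrt_growth_contradiction[OF B e0(1)])
    fix e assume e: "0 < e" "e < e0"
    show "B / e + ln e \<le> Im (p (\<i> * of_real e0)) + ln e0" using mono[OF e] Im_p_imaginary_axis_ge[OF e(1)] by linarith
  qed
qed

lemma F_cnj: "F (cnj w) = cnj (F w)" for w
  unfolding F_def set_lebesgue_integral_def
  unfolding Bochner_Integration.integral_cnj[symmetric]
  by (rule Bochner_Integration.integral_cong) simp_all

lemma representation_cut_plane: "p w = of_real \<beta> + (w - of_real m) * F w" if w: "w \<in> cut_plane m" for w
proof (cases "Im w" "0::real" rule: linorder_cases)
  case greater
  then show ?thesis using representation_upper[OF greater] linear_coefficient_zero atom_zero by simp
next
  case less
  then have "Im (cnj w) > 0" by simp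
  from representation_upper[OF this] have "p (cnj w) = of_real \<beta> + (cnj w - of_real m) * F (cnj w)" using linear_coefficient_zero atom_zero by simp
  then have "cnj (p (cnj w)) = of_real \<beta> + (w - of_real m) * F w" by (simp add: F_cnj)
  then show ?thesis using p_cnj[OF w] by simp
next
  case equal
  then have y: "w = of_real (Re w)" "Re w > m" using w by (auto simp: cut_plane_iff complex_eq_iff)
  show ?thesis using representation_real(1)[OF y(2)] linear_coefficient_zero atom_zero unfolding y(1)[symmetric] by simp
qed

end

context pick_inverse begin

lemma stieltjes_representation:
  shows "\<exists>d. real_analytic_on d ({0<..<m} \<union> {m<..}) \<and>
    (\<forall>t\<in>{0<..<m} \<union> {m<..}. d t > 0) \<and>
    set_integrable lborel {0<..} (\<lambda>t. d t / (t + 1)) \<and>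
    (\<forall>w\<in>cut_plane m. p w = of_real \<beta> + (w - of_real m) *
         (LINT t:{0<..}|lborel. of_real (d t) / (of_real t + w - of_real m)))"
proof -
  have "\<exists>k. (p \<longlongrightarrow> k) (at_UH x) \<and> (x < m \<longrightarrow> Im k > 0) \<and> (x \<ge> m \<longrightarrow> Im k = 0)" if "x \<noteq> 0" for x
  proof (cases x m rule: linorder_cases)
    case less
    then show ?thesis using boundary_limit[OF less that] by auto
  next
    case equal
    then show ?thesis using p_lim_m by (intro exI[of _ "of_real \<beta>"]) auto
  next
    case greater
    then show ?thesis using p_lim_real[OF greater] by (intro exI[of _ "of_real (finv0 x)"]) auto
  qed
  then obtain k where k: "\<And>x. x \<noteq> 0 \<Longrightarrow> (p \<longlongrightarrow> k x) (at_UH x)"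
    "\<And>x. x \<noteq> 0 \<Longrightarrow> x < m \<Longrightarrow> Im (k x) > 0" "\<And>x. x \<noteq> 0 \<Longrightarrow> x \<ge> m \<Longrightarrow> Im (k x) = 0"
    by metis
  define v where "v = (\<lambda>x. if x = 0 then 0 else Im (k x))"
  have pUH: "p holomorphic_on UH" using p_hol UH_subset_cut_plane holomorphic_on_subset by blast
  note H = herglotz_upper_half_plane[OF pUH Im_p_nonneg k(1)]
  have ve: "(if x = 0 then 0 else Im (k x)) = v x" for x by (simp add: v_def)
  have v_int: "integrable lborel (\<lambda>x. v x / (1 + x^2))" using H(1) unfolding ve .
  have v_meas[measurable]: "v \<in> borel_measurable borel" using H(2) unfolding ve by simp
  have v_nn: "v x \<ge> 0" for x using H(3)[of x] unfolding ve .
  have v_m: "v x = 0" if "x \<ge> m" for x using k(3)[of x] that by (simp add: v_def)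
  obtain A B where AB: "A \<ge> 0" "B \<ge> 0" and rep: "\<And>w. Im w > 0 \<Longrightarrow>
       p w = cnj (p \<i>) + of_real A * (w + \<i>) + of_real B * (\<i> - 1 / w) +
         of_real (1 / pi) * (\<integral>x. of_real (v x) * ((w + \<i>) / ((of_real x - w) * (of_real x + \<i>))) \<partial>lborel)"
    using H(4) unfolding ve by blast
  interpret bd: pick_boundary r a b lam f \<alpha> \<beta> p v A B
    by (unfold_locales; fact v_int v_meas v_nn v_m AB rep)
  define d where "d = bd.d"
  have deq: "d = bd.d" by (rule d_def)
  have d_def: "d = (\<lambda>t. v (m - t) / (pi * t))" unfolding deq by (rule ext) (rule bd.d_def)
  have pos: "d t > 0" if "t \<in> {0<..<m} \<union> {m<..}" for t
  proof -
    have t: "t > 0" "m - t \<noteq> 0" "m - t < m" using that m_pos by auto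
    then have "v (m - t) > 0" using k(2)[of "m - t"] by (simp add: v_def)
    then show ?thesis using t by (simp add: d_def)
  qed
  have analytic: "real_analytic_on d ({0<..<m} \<union> {m<..})"
  proof (rule real_analytic_Im_holomorphic)
    fix t0 assume t0: "t0 \<in> {0<..<m} \<union> {m<..}"
    define x0 where "x0 = m - t0"
    have x0: "x0 \<noteq> 0" "x0 < m" using t0 m_pos by (auto simp: x0_def)
    obtain e g where e: "e > 0" and g: "g holomorphic_on ball (of_real x0) e"
      "\<And>s. \<bar>s - x0\<bar> < e \<Longrightarrow> (p \<longlongrightarrow> g (of_real s)) (at_UH s)"
      using local_extension[OF k(1)[OF x0(1)] k(2)[OF x0]] by metis
    define e' where "e' = min e (min t0 \<bar>x0\<bar>)"
    have e': "e' > 0" "e' \<le> e" "e' \<le> t0" "e' \<le> \<bar>x0\<bar>" using e t0 x0 m_pos by (auto simp: e'_def)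
    define G' where "G' = (\<lambda>z. g (of_real m - z) / (of_real pi * z))"
    have "G' holomorphic_on ball (of_real t0) e'"
      unfolding G'_def
    proof (intro holomorphic_intros holomorphic_on_compose_gen[OF _ g(1), unfolded o_def])
      show "(\<lambda>z. of_real m - z) ` ball (of_real t0) e' \<subseteq> ball (complex_of_real x0) e"
        using e'(2) by (auto simp: dist_norm x0_def norm_minus_commute algebra_simps)
      fix z assume z: "z \<in> ball (complex_of_real t0) e'"
      have "z \<noteq> 0"
      proof
        assume "z = 0"
        then have "norm (complex_of_real t0) < e'" using z by (simp add: dist_norm)
        then show False using e'(3) t0 m_pos by auto
      qed
      then show "of_real pi * z \<noteq> 0" by simp
    qed
    moreover have "d t = Im (G' (of_real t))" if t: "\<bar>t - t0\<bar> < e'" for t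
    proof -
      have s: "\<bar>(m - t) - x0\<bar> < e" "m - t \<noteq> 0" "t > 0"
        using t e' by (auto simp: x0_def abs_if split: if_splits)
      have "k (m - t) = g (of_real (m - t))"
        using tendsto_unique[OF at_UH_neq_bot k(1)[OF s(2)] g(2)[OF s(1)]] .
      moreover have "Im (g (of_real (m - t)) / (of_real pi * of_real t)) = Im (g (of_real (m - t))) / (pi * t)"
        by (simp only: of_real_mult[symmetric] Im_divide_of_real)
      ultimately show ?thesis using s by (simp add: d_def v_def G'_def)
    qed
    ultimately show "\<exists>e>0. \<exists>G. G holomorphic_on ball (of_real t0) e \<and> (\<forall>t. \<bar>t - t0\<bar> < e \<longrightarrow> d t = Im (G (of_real t)))"
      using e'(1) by blast
  qed
  have "set_integrable lborel {0<..} (\<lambda>t. d t / (t + 1))"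
    using bd.d_set_integrable by (simp add: deq)
  moreover have "p w = of_real \<beta> + (w - of_real m) *
         (LINT t:{0<..}|lborel. of_real (d t) / (of_real t + w - of_real m))" if "w \<in> cut_plane m" for w
    using bd.representation_cut_plane[OF that] by (simp add: deq bd.F_def)
  ultimately show ?thesis
    using analytic pos by blast
qed

end

theorem proposition5p7:
  fixes f finv :: "complex \<Rightarrow> complex" and r :: nat and a b \<beta> m :: real
    and lam :: "nat \<Rightarrow> real"
  assumes "f \<in> class_G"
    and "genus2_form r a b lam f" and "r > 0"
    and "local_min_on {0<..} (on_reals f) \<beta>"
    and "m = on_reals f \<beta>"
    and "pick_function_in_cut_plane m finv"
    and "\<forall>y>m. finv (of_real y) = of_real (the_inv_into {\<beta><..} (on_reals f) y)"
  shows "\<exists>c d. c \<ge> 0 \<and>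
    real_analytic_on d ({0<..<m} \<union> {m<..}) \<and>
    (\<forall>t\<in>{0<..<m} \<union> {m<..}. d t > 0) \<and>
    set_integrable lborel {0<..} (\<lambda>t. d t / (t + 1)) \<and>
    (\<forall>w\<in>cut_plane m.
       finv w = of_real \<beta> +
         (w - of_real m) *
           (LINT t:{0<..}|lborel. of_real (d t) / (of_real t + w - of_real m)) -
         of_real c / w)"
proof -
  interpret genus2 r a b lam f by unfold_locales (use assms in auto)
  obtain \<alpha> where \<alpha>: "0 < \<alpha>" "\<alpha> < \<beta>" "hr \<alpha> = 0" "hr \<beta> = 0"
    using ex_alpha[OF assms(1,4)] by blast
  interpret z: genus2_zeros r a b lam f \<alpha> \<beta> by unfold_locales (use \<alpha> in auto)
  have m: "z.m = m" by (simp add: z.m_def fr_def assms(5))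
  interpret q: pick_inverse r a b lam f \<alpha> \<beta> finv
    by unfold_locales
       (use assms(6,7) in \<open>auto simp: m pick_function_in_cut_plane_def pick_function_def z.finv0_def fr_def\<close>)
  obtain d where "real_analytic_on d ({0<..<m} \<union> {m<..})" "\<forall>t\<in>{0<..<m} \<union> {m<..}. d t > 0"
    "set_integrable lborel {0<..} (\<lambda>t. d t / (t + 1))"
    "\<forall>w\<in>cut_plane m. finv w = of_real \<beta> + (w - of_real m) *
         (LINT t:{0<..}|lborel. of_real (d t) / (of_real t + w - of_real m))"
    using q.stieltjes_representation unfolding m by blast
  then show ?thesis by (intro exI[of _ 0] exI[of _ d]) auto
qed

end
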